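(* Let $f:\overline{\mathbb R}^d\to[0,\infty]$ be a continuous $1$-homogeneous function such that $f(x)<\infty$ for all $x\in\mathbb R^d$. Suppose that $X\in RV_\alpha(\{a_n\},\{f=0\},\nu)$ and let $X_i$, $i=1,2,\ldots$, be independent copies of $X$. (i) Consider the point process $\mathcal N_n:=\{a_n^{-1}X_i,\ i=1,\ldots,n\}$. Then, as $n\to\infty$, $$\mathcal N_n\cap\{f>0\}\Longrightarrow\mathcal N,$$ where $\mathcal N$ is a Poisson process on $\mathbb R^d\setminus\{f=0\}$ with intensity $\nu$, and $\Rightarrow$ denotes weak convergence of probability distributions on the space of point measures on $\overline{\mathbb R}^d\setminus\{f=0\}$ equipped with the vague convergence topology. (ii) Moreover, with $c:=\nu\{f>1\}=\sigma_S(S)$, $$\mathcal N\stackrel{d}{=}c^{1/\alpha}\Big\{\Gamma_k^{-1/\alpha}\Theta_k,\ k\in\mathbb N\Big\},$$ where $0<\Gamma_1<\Gamma_2<\cdots$ is a standard (unit rate) Poisson process on $(0,\infty)$ and the $\Theta_k$ are iid, independent of the $\Gamma_k$, take values in the unit sphere $S$, and have distribution $\sigma_S(\cdot)/c$. (iii) In particular, for all $m\in\mathbb N$, as $n\to\infty$, $$\frac1{a_n}\big(X_{k(i;n)},\ i=1,\ldots,m\big)\Longrightarrow c^{1/\alpha}\big(\Gamma_i^{-1/\alpha}\Theta_i,\ i=1,\ldots,m\big)$$ in distribution.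
   Context: $\overline{\mathbb R}=[-\infty,\infty]$ carries its usual compact topology and $\overline{\mathbb R}^d$ the product topology. $1$-homogeneous means $f(\lambda x)=\lambda f(x)$ for all $\lambda>0$. Regular variation: put $D:=\{f=0\}$, a closed cone in $\overline{\mathbb R}^d$, and $\overline{\mathbb R}^d_D:=\overline{\mathbb R}^d\setminus D$ with the relative topology. Radon measures on $\overline{\mathbb R}^d_D$ are Borel measures finite on compacts; $\nu_n\stackrel{v}{\to}\nu$ (vague convergence) means $\int h\,d\nu_n\to\int h\,d\nu$ for every continuous compactly supported $h:\overline{\mathbb R}^d_D\to\mathbb R$. $X\in RV_\alpha(\{a_n\},D,\nu)$, $\alpha>0$, means that $\nu$ is a non-trivial Radon measure on $\overline{\mathbb R}^d_D$ supported on $\mathbb R^d\setminus D$, $a_n>0$ is a regularly varying sequence with exponent $1/\alpha$, and $nP(a_n^{-1}X\in\cdot)\stackrel{v}{\to}\nu$ on $\overline{\mathbb R}^d_D$. Then $\nu(\lambda\,\cdot)=\lambda^{-\alpha}\nu(\cdot)$ for $\lambda>0$. Polar coordinates generated by the loss: $(\tau,\theta)(x)=(f(x),x/f(x))$ for $x\in\mathbb R^d\setminus\{f=0\}$; unit sphere $S=\{f=1\}\cap\mathbb R^d$; the spectral measure of $\nu$ is the finite measure on $S$ given by $\sigma_S(B)=\nu\{x: f(x)>1,\ x/f(x)\in B\}$. Implicit order statistics: for $X_1,\ldots,X_n$, let $\{k(1;n),\ldots,k(n;n)\}$ be the permutation of $\{1,\ldots,n\}$ with $f(X_{k(1;n)})\ge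 f(X_{k(2;n)})\ge\cdots\ge f(X_{k(n;n)})$, where ties are resolved by taking the indices $k(\cdot;n)$ in increasing order. Point processes are identified with the corresponding random counting measures. *)

theory Defs
  imports "HOL-Probability.Probability"
begin

section \<open>Vague convergence and point measures on a subset of a topological space\<close>

definition Cc :: "'a::topological_space set \<Rightarrow> ('a \<Rightarrow> real) set" where
  "Cc E = {h. continuous_on E h \<and> compact (E \<inter> closure {x \<in> E. h x \<noteq> 0})}"

definition radon_measure_on :: "'a::topological_space set \<Rightarrow> 'a measure \<Rightarrow> bool" where
  "radon_measure_on E \<mu> \<longleftrightarrow>
     sets \<mu> = sets (restrict_space borel E) \<and>
     (\<forall>K. compact K \<and> K \<subseteq> E \<longrightarrow> emeasure \<mu> K < \<infinity>)"

definition vaguely_converges ::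
  "'a::topological_space set \<Rightarrow> (nat \<Rightarrow> 'a measure) \<Rightarrow> 'a measure \<Rightarrow> bool" where
  "vaguely_converges E \<mu>s \<mu> \<longleftrightarrow>
     (\<forall>h\<in>Cc E. (\<lambda>n. \<integral>x. h x \<partial>\<mu>s n) \<longlonglongrightarrow> (\<integral>x. h x \<partial>\<mu>))"

text \<open>The counting measure of those points \<open>x i\<close>, \<open>i \<in> I\<close>, that lie in \<open>E\<close>;
  points are counted with multiplicity.\<close>

definition counting_measure ::
  "'a::topological_space set \<Rightarrow> 'i set \<Rightarrow> ('i \<Rightarrow> 'a) \<Rightarrow> 'a measure" where
  "counting_measure E I x =
     distr (count_space {i \<in> I. x i \<in> E}) (restrict_space borel E) x"

definition point_measures :: "'a::topological_space set \<Rightarrow> 'a measure set" where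
  "point_measures E =
     {\<mu>. radon_measure_on E \<mu> \<and> (\<exists>(I :: nat set) x. \<mu> = counting_measure E I x)}"

definition vague_topology :: "'a::topological_space set \<Rightarrow> 'a measure topology" where
  "vague_topology E =
     topology_generated_by
       {{\<mu> \<in> point_measures E. (\<integral>x. h x \<partial>\<mu>) \<in> U} | h U. h \<in> Cc E \<and> open U}"


section \<open>Random elements of a topological space\<close>

definition borel_of :: "'t topology \<Rightarrow> 't measure" where
  "borel_of T = sigma (topspace T) {U. openin T U}"

definition converges_in_distribution ::
  "'t topology \<Rightarrow> 'w measure \<Rightarrow> (nat \<Rightarrow> 'w \<Rightarrow> 't) \<Rightarrow> 'p measure \<Rightarrow> ('p \<Rightarrow> 't) \<Rightarrow> bool" where
  "converges_in_distribution T M Y P Z \<longleftrightarrow>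
     (\<forall>n. Y n \<in> measurable M (borel_of T)) \<and> Z \<in> measurable P (borel_of T) \<and>
     (\<forall>H. continuous_map T euclideanreal H \<and> bounded (H ` topspace T) \<longrightarrow>
        (\<lambda>n. \<integral>\<omega>. H (Y n \<omega>) \<partial>M) \<longlonglongrightarrow> (\<integral>\<omega>. H (Z \<omega>) \<partial>P))"

definition equal_in_distribution ::
  "'t topology \<Rightarrow> 'w measure \<Rightarrow> ('w \<Rightarrow> 't) \<Rightarrow> 'p measure \<Rightarrow> ('p \<Rightarrow> 't) \<Rightarrow> bool" where
  "equal_in_distribution T M Y P Z \<longleftrightarrow>
     Y \<in> measurable M (borel_of T) \<and> Z \<in> measurable P (borel_of T) \<and>
     distr M (borel_of T) Y = distr P (borel_of T) Z"


section \<open>Poisson processes\<close>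

definition poisson_process ::
  "'p measure \<Rightarrow> 'a::topological_space set \<Rightarrow> 'a measure \<Rightarrow> ('p \<Rightarrow> 'a measure) \<Rightarrow> bool" where
  "poisson_process P E \<nu> N \<longleftrightarrow>
     prob_space P \<and> N \<in> measurable P (borel_of (vague_topology E)) \<and>
     (\<forall>B\<in>sets \<nu>. \<forall>k::nat.
        measure P {\<omega> \<in> space P. emeasure (N \<omega>) B = of_nat k} =
          (if emeasure \<nu> B = \<infinity> then 0
           else exp (- measure \<nu> B) * measure \<nu> B ^ k / fact k)) \<and>
     (\<forall>(J :: nat set) B. finite J \<and> (\<forall>j\<in>J. B j \<in> sets \<nu>) \<and> disjoint_family_on B J \<longrightarrow>
        prob_space.indep_vars P (\<lambda>_. borel) (\<lambda>j \<omega>. emeasure (N \<omega>) (B j)) J)"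

definition standard_poisson_arrivals :: "'q measure \<Rightarrow> (nat \<Rightarrow> 'q \<Rightarrow> real) \<Rightarrow> bool" where
  "standard_poisson_arrivals Q \<Gamma> \<longleftrightarrow>
     (\<forall>\<omega>\<in>space Q. 0 < \<Gamma> 1 \<omega> \<and> (\<forall>k\<ge>1. \<Gamma> k \<omega> < \<Gamma> (Suc k) \<omega>)) \<and>
     poisson_process Q {0<..} (restrict_space lborel {0<..})
       (\<lambda>\<omega>. counting_measure {0<..} {1..} (\<lambda>k. \<Gamma> k \<omega>))"

text \<open>Arrival times with iid marks of law \<open>\<mu>\<close> that are independent of the arrival times.\<close>

definition marked_poisson_arrivals ::
  "'q measure \<Rightarrow> (nat \<Rightarrow> 'q \<Rightarrow> real) \<Rightarrow> 's measure \<Rightarrow> (nat \<Rightarrow> 'q \<Rightarrow> 's) \<Rightarrow> bool" where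
  "marked_poisson_arrivals Q \<Gamma> \<mu> \<Theta> \<longleftrightarrow>
     prob_space Q \<and> standard_poisson_arrivals Q \<Gamma> \<and>
     prob_space.indep_vars Q (\<lambda>_. \<mu>) \<Theta> {1..} \<and> (\<forall>k\<ge>1. distr Q \<mu> (\<Theta> k) = \<mu>) \<and>
     prob_space.indep_set Q
       (sets (vimage_algebra (space Q) (\<lambda>\<omega>. \<lambda>k\<in>{1..}. \<Gamma> k \<omega>) (PiM {1..} (\<lambda>_. borel))))
       (sets (vimage_algebra (space Q) (\<lambda>\<omega>. \<lambda>k\<in>{1..}. \<Theta> k \<omega>) (PiM {1..} (\<lambda>_. \<mu>))))"


section \<open>Regular variation\<close>

definition to_ereal_vec :: "real ^ 'd \<Rightarrow> ereal ^ 'd" where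
  "to_ereal_vec x = (\<chi> i. ereal (x $ i))"

definition of_ereal_vec :: "ereal ^ 'd \<Rightarrow> real ^ 'd" where
  "of_ereal_vec x = (\<chi> i. real_of_ereal (x $ i))"

definition homogeneous :: "(ereal ^ 'd \<Rightarrow> ennreal) \<Rightarrow> bool" where
  "homogeneous f \<longleftrightarrow> (\<forall>l::real. \<forall>x. 0 < l \<longrightarrow> f (ereal l *s x) = ennreal l * f x)"

definition regularly_varying_seq :: "real \<Rightarrow> (nat \<Rightarrow> real) \<Rightarrow> bool" where
  "regularly_varying_seq \<rho> a \<longleftrightarrow>
     (\<forall>l>0. (\<lambda>n. a (nat \<lfloor>l * real n\<rfloor>) / a n) \<longlonglongrightarrow> l powr \<rho>)"

text \<open>\<open>RV M X \<alpha> a D \<nu>\<close>: the random vector \<open>X\<close> on \<open>M\<close> is in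
  \<open>RV\<^sub>\<alpha>({a\<^sub>n}, D, \<nu>)\<close>; \<open>\<nu>\<close> lives on the complement of \<open>D\<close> in the extended space
  but puts no mass outside \<open>\<real>\<^sup>d\<close>.\<close>

definition RV ::
  "'w measure \<Rightarrow> ('w \<Rightarrow> real ^ 'd) \<Rightarrow> real \<Rightarrow> (nat \<Rightarrow> real) \<Rightarrow> (ereal ^ 'd) set \<Rightarrow>
   (ereal ^ 'd) measure \<Rightarrow> bool" where
  "RV M X \<alpha> a D \<nu> \<longleftrightarrow>
     prob_space M \<and> X \<in> borel_measurable M \<and> \<alpha> > 0 \<and>
     radon_measure_on (- D) \<nu> \<and> emeasure \<nu> (- D) \<noteq> 0 \<and>
     emeasure \<nu> (- D - range to_ereal_vec) = 0 \<and>
     (\<forall>n\<ge>1. a n > 0) \<and> regularly_varying_seq (1 / \<alpha>) a \<and>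
     vaguely_converges (- D)
       (\<lambda>n. scale_measure (of_nat n)
          (restrict_space (distr M borel (\<lambda>\<omega>. to_ereal_vec ((1 / a n) *\<^sub>R X \<omega>))) (- D))) \<nu>"


section \<open>Polar coordinates and implicit order statistics\<close>

definition unit_sphere :: "(ereal ^ 'd \<Rightarrow> ennreal) \<Rightarrow> (real ^ 'd) set" where
  "unit_sphere f = {x. f (to_ereal_vec x) = 1}"

text \<open>The radial part is finite on the image of \<open>to_ereal_vec\<close> for the functions \<open>f\<close> considered.\<close>

definition spectral_measure ::
  "(ereal ^ 'd \<Rightarrow> ennreal) \<Rightarrow> (ereal ^ 'd) measure \<Rightarrow> (real ^ 'd) measure" where
  "spectral_measure f \<nu> =
     distr (restrict_space \<nu> {x \<in> range to_ereal_vec. f x > 1})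
       (restrict_space borel (unit_sphere f))
       (\<lambda>x. (1 / enn2real (f x)) *\<^sub>R of_ereal_vec x)"

text \<open>\<open>order_index v n i\<close> is \<open>k(i;n)\<close> for the values \<open>v 1, \<dots>, v n\<close>; it equals \<open>i\<close> for \<open>i > n\<close>.\<close>

definition order_index :: "(nat \<Rightarrow> 'b::linorder) \<Rightarrow> nat \<Rightarrow> nat \<Rightarrow> nat" where
  "order_index v n =
     (THE k. k permutes {1..n} \<and>
        (\<forall>i j. 1 \<le> i \<and> i < j \<and> j \<le> n \<longrightarrow>
           v (k i) > v (k j) \<or> (v (k i) = v (k j) \<and> k i < k j)))"

end

(*
  All three parts follow from Laplace functionals. A countable family of nonnegative test functions
  phi j determines the vague topology: it is the pullback of the product topology on nat => real
  along mu |-> (exp (- integral of phi j))_j. By the Stone-Weierstrass theorem on the Hilbert cube,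
  convergence of Laplace functionals therefore gives liminf P(Y n in U) >= P(Y in U) for every
  vaguely open U, and this is convergence in distribution; no tightness argument is needed.

  The Laplace functional of the sample is an n-th power whose limit exp (- integral of (1 - exp(-h)) d nu)
  is supplied by regular variation, and it is also the Laplace functional of a Poisson process.
  Comparing the normalisations a (floor (l n)) and a n shows that nu is homogeneous, so nu is the image
  of Lebesgue measure times the normalised spectral measure. For the marked series one integrates out
  the marks, which leaves the Poisson process of arrival times, and the polar form of nu identifies
  the exponent.

  For the order statistics, "the m points of largest loss lie in the open set U" is implied for the
  sample by a vaguely open condition (one point in each of m shells, and no more than m points above
  the lowest shell) which holds for the series whenever its first m terms lie in U.
*)
theory Submission
  imports Defs
begin

section \<open>Test functions on the complement of the zero set\<close>

text \<open>The obstacle is that the measures may have infinite mass near \<open>{f = 0}\<close>, so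
  uniform closeness of two test functions says nothing about their integrals. The countable family
  therefore contains cutoffs as well as approximants: every approximation error is a small constant
  times a cutoff, and the integral of that cutoff is itself one of the coordinates under control.

  Laplace functionals are enough because a product of coordinates
  \<open>exp (- \<integral> \<phi> j)\<close> is the coordinate belonging to the sum of the
  \<open>\<phi> j\<close>. Mixed moments of the random point of the cube are thus Laplace
  functionals of finite sums.

  Only lower bounds for open sets are carried from the sample to the limit. This matters for the
  order statistics: taking the \<open>m\<close> largest points of a point measure is neither
  everywhere defined nor continuous, because of ties and of measures with few points, but inclusions
  between events in the right direction are all that a lower bound asks for.\<close>

instance vec :: (t0_space, finite) t0_space
proof
  fix x y :: "'a ^ 'b"
  assume "x \<noteq> y"
  then obtain i where "x $ i \<noteq> y $ i"
    by (auto simp: vec_eq_iff)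
  then obtain U where "open U" "\<not> (x $ i \<in> U \<longleftrightarrow> y $ i \<in> U)"
    using separation_t0[of "x $ i" "y $ i"] by blast
  then show "\<exists>U. open U \<and> \<not> (x \<in> U \<longleftrightarrow> y \<in> U)"
    by (intro exI[of _ "(\<lambda>z. z $ i) -` U"]) (auto intro: open_vimage_vec_nth)
qed

instance vec :: (t1_space, finite) t1_space
proof
  fix x y :: "'a ^ 'b"
  assume "x \<noteq> y"
  then obtain i where "x $ i \<noteq> y $ i"
    by (auto simp: vec_eq_iff)
  then obtain U where "open U" "x $ i \<in> U" "y $ i \<notin> U"
    using separation_t1[of "x $ i" "y $ i"] by blast
  then show "\<exists>U. open U \<and> x \<in> U \<and> y \<notin> U"
    by (intro exI[of _ "(\<lambda>z. z $ i) -` U"]) (auto intro: open_vimage_vec_nth)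
qed

text \<open>Makes \<open>ereal ^ 'd\<close> a Hausdorff space, so that its compact sets are closed
  and hence Borel.\<close>

instance vec :: (t2_space, finite) t2_space
proof
  fix x y :: "'a ^ 'b"
  assume "x \<noteq> y"
  then obtain i where "x $ i \<noteq> y $ i"
    by (auto simp: vec_eq_iff)
  then obtain U V where UV: "open U" "open V" "x $ i \<in> U" "y $ i \<in> V" "U \<inter> V = {}"
    using hausdorff[of "x $ i" "y $ i"] by blast
  have "open ((\<lambda>z. z $ i) -` W)" if "open W" for W :: "'a set"
    using that by (rule open_vimage_vec_nth)
  then show "\<exists>U V. open U \<and> open V \<and> x \<in> U \<and> y \<in> V \<and> U \<inter> V = {}"
    using UV by (intro exI[of _ "(\<lambda>z. z $ i) -` U"] exI[of _ "(\<lambda>z. z $ i) -` V"]) auto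
qed

text \<open>Abstracts from \<open>ereal ^ 'd\<close> to what the vague topology uses: compactness,
  the levels of \<open>f\<close>, and a continuous injection \<open>\<Psi>\<close> into a Euclidean
  space. \<open>\<Psi>\<close> stands in for a metric: its finitely many coordinates separate
  points, and distances are measured after applying it.\<close>

locale level_space =
  fixes f :: "'a::t2_space \<Rightarrow> ennreal" and \<Psi> :: "'a \<Rightarrow> 'b::euclidean_space"
  assumes compact_space: "compact (UNIV :: 'a set)"
    and f_cont: "continuous_on UNIV f"
    and Psi_cont: "continuous_on UNIV \<Psi>"
    and Psi_inj: "inj \<Psi>"
begin

abbreviation "E \<equiv> - {x. f x = 0}"

text \<open>\<open>Cc E\<close> up to extension by zero, with the support condition phrased through
  \<open>f\<close>: a closed set is a compact subset of \<open>E\<close> exactly if \<open>f\<close>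
  is bounded away from 0 on it. Functions on the whole compact space are bounded and can be
  approximated uniformly.\<close>

definition Cc0 :: "('a \<Rightarrow> real) set" where
  "Cc0 = {h. continuous_on UNIV h \<and> (\<exists>r>0. \<forall>x. h x \<noteq> 0 \<longrightarrow> ennreal r \<le> f x)}"

lemma open_f_greater: "open {x. f x > r}"
  using open_Collect_less[OF continuous_on_const f_cont] by simp

lemma closed_f_ge: "closed {x. f x \<ge> r}"
  using closed_Collect_le[OF continuous_on_const f_cont] by simp

lemma compact_f_ge: "compact {x. f x \<ge> r}"
  using compact_Int_closed[OF compact_space closed_f_ge[of r]] by simp

lemma E_eq_positive: "E = {x. f x > 0}"
  by (auto simp: zero_less_iff_neq_zero)

lemma open_E: "open E"
  unfolding E_eq_positive by (rule open_f_greater)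

lemma E_borel[measurable]: "E \<in> sets borel"
  using open_E by auto

lemma f_borel[measurable]: "f \<in> borel_measurable borel"
  using f_cont by (rule borel_measurable_continuous_onI)

lemma compact_subset_level:
  assumes "compact K" "K \<subseteq> E"
  obtains r where "r > 0" "\<And>x. x \<in> K \<Longrightarrow> ennreal r \<le> f x"
proof (cases "K = {}")
  case True
  then show ?thesis using that[of 1] by auto
next
  case False
  have "continuous_on K f"
    using f_cont continuous_on_subset by blast
  then obtain x0 where x0: "x0 \<in> K" "\<And>x. x \<in> K \<Longrightarrow> f x0 \<le> f x"
    using continuous_attains_inf[OF assms(1) False] by blast
  \<comment> \<open>The minimum of \<open>f\<close> on \<open>K\<close> may be infinite; capping it
    at 1 yields a real level.\<close>
  then have "0 < min 1 (f x0)"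
    using assms by (auto simp: zero_less_iff_neq_zero)
  moreover have fin: "min 1 (f x0) < top"
    by (simp add: min_less_iff_disj)
  ultimately have "enn2real (min 1 (f x0)) > 0"
    by (simp add: enn2real_positive_iff)
  moreover have "ennreal (enn2real (min 1 (f x0))) \<le> f x" if "x \<in> K" for x
  proof -
    have "ennreal (enn2real (min 1 (f x0))) = min 1 (f x0)"
      using fin by (rule ennreal_enn2real)
    also have "\<dots> \<le> f x" using x0(2)[OF that] by (simp add: min.coboundedI2)
    finally show ?thesis .
  qed
  ultimately show ?thesis using that by blast
qed

lemma Cc0_subset_Cc: "h \<in> Cc0 \<Longrightarrow> h \<in> Cc E"
proof -
  assume "h \<in> Cc0"
  then obtain r where h: "continuous_on UNIV h" "r > 0" "\<And>x. h x \<noteq> 0 \<Longrightarrow> ennreal r \<le> f x"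
    by (auto simp: Cc0_def)
  have "closure {x \<in> E. h x \<noteq> 0} \<subseteq> {x. f x \<ge> ennreal r}"
    using h(3) by (intro closure_minimal closed_f_ge) auto
  moreover from this have "closure {x \<in> E. h x \<noteq> 0} \<subseteq> E"
    using h(2) ennreal_eq_0_iff[of r] by (metis (mono_tags, lifting) ComplI le_zero_eq linorder_not_le mem_Collect_eq subset_iff)
  ultimately have "compact (E \<inter> closure {x \<in> E. h x \<noteq> 0})"
    by (metis Int_absorb1 closed_closure compact_Int_closed compact_space inf_top_left)
  then show "h \<in> Cc E"
    using h(1) by (auto simp: Cc_def intro: continuous_on_subset)
qed

text \<open>\<open>E\<close> and the complement of the compact support are open and cover the space;
  the extension is continuous on the first because \<open>h\<close> is, and zero on the
  second.\<close>

lemma Cc_extension: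
  assumes "h \<in> Cc E"
  shows "(\<lambda>x. if x \<in> E then h x else 0) \<in> Cc0" (is "?g \<in> _")
proof -
  define K where "K = E \<inter> closure {x \<in> E. h x \<noteq> 0}"
  have K: "compact K" "K \<subseteq> E" and cont: "continuous_on E h"
    using assms by (auto simp: Cc_def K_def)
  have zero: "?g x = 0" if "x \<notin> K" for x
    using that closure_subset[of "{x \<in> E. h x \<noteq> 0}"] by (auto simp: K_def)
  have "continuous_on E ?g"
    using cont by (rule continuous_on_eq) simp
  moreover have "continuous_on (- K) ?g"
    by (rule continuous_on_eq[OF continuous_on_const[of _ 0]]) (use zero in auto)
  moreover have "E \<union> - K = UNIV" using K by auto
  moreover have "open (- K)" using compact_imp_closed[OF K(1)] by (rule open_Compl)
  ultimately have "continuous_on UNIV ?g"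
    using continuous_on_open_Un[OF open_E] by fastforce
  moreover obtain r where "r > 0" "\<And>x. x \<in> K \<Longrightarrow> ennreal r \<le> f x"
    using compact_subset_level[OF K] by blast
  ultimately show ?thesis
    using zero by (force simp: Cc0_def)
qed

lemma Cc0_bounded: "h \<in> Cc0 \<Longrightarrow> \<exists>B>0. \<forall>x. \<bar>h x\<bar> \<le> B"
proof -
  assume "h \<in> Cc0"
  then have "continuous_on UNIV h" by (simp add: Cc0_def)
  then have "compact (range h)" using compact_space compact_continuous_image by blast
  then show ?thesis using compact_imp_bounded bounded_pos by (metis rangeI real_norm_def)
qed

lemma Cc0_measurable[measurable_dest]: "h \<in> Cc0 \<Longrightarrow> h \<in> borel_measurable borel"
  by (auto simp: Cc0_def intro: borel_measurable_continuous_onI)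

lemma Cc0_zero: "h \<in> Cc0 \<Longrightarrow> x \<notin> E \<Longrightarrow> h x = 0"
  by (force simp: Cc0_def)

lemma Cc0_compose:
  assumes "h \<in> Cc0" "continuous_on UNIV (u :: real \<Rightarrow> real)" "u 0 = 0"
  shows "(\<lambda>x. u (h x)) \<in> Cc0"
proof -
  have "continuous_on UNIV (\<lambda>x. u (h x))"
    using assms by (intro continuous_on_compose2[OF assms(2)]) (auto simp: Cc0_def)
  then show ?thesis using assms(1,3) unfolding Cc0_def by (smt (verit) mem_Collect_eq)
qed

lemma Cc0_mult:
  assumes "h \<in> Cc0" "continuous_on UNIV g"
  shows "(\<lambda>x. g x * h x) \<in> Cc0"
  using assms by (auto simp: Cc0_def intro!: continuous_intros)

lemma Cc0_add:
  assumes "g \<in> Cc0" "h \<in> Cc0"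
  shows "(\<lambda>x. g x + h x) \<in> Cc0"
proof -
  obtain r s where "r > 0" "\<And>x. g x \<noteq> 0 \<Longrightarrow> ennreal r \<le> f x" "s > 0" "\<And>x. h x \<noteq> 0 \<Longrightarrow> ennreal s \<le> f x"
    using assms by (auto simp: Cc0_def)
  then have "ennreal (min r s) \<le> f x" if "g x + h x \<noteq> 0" for x
    using that by (metis add.right_neutral add_0 ennreal_leI min.cobounded1 min.cobounded2 order_trans)
  then show ?thesis
    using assms \<open>r > 0\<close> \<open>s > 0\<close> unfolding Cc0_def
    by (auto intro!: continuous_intros exI[of _ "min r s"])
qed

text \<open>A cutoff that rises linearly in \<open>f\<close> from 0 at level \<open>r\<close> to 1
  at level \<open>s\<close>. Truncating at \<open>s\<close> before \<open>enn2real\<close> keeps it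
  continuous where \<open>f\<close> is infinite, since \<open>enn2real\<close> sends infinity to
  0.\<close>

definition bump :: "real \<Rightarrow> real \<Rightarrow> 'a \<Rightarrow> real" where
  "bump r s x = min 1 (max 0 ((enn2real (min (f x) (ennreal s)) - r) / (s - r)))"

lemma bump_nonneg: "0 \<le> bump r s x" and bump_le_1: "bump r s x \<le> 1"
  by (auto simp: bump_def)

lemma bump_eq_1:
  assumes "0 < r" "r < s" "ennreal s \<le> f x"
  shows "bump r s x = 1"
  using assms by (simp add: bump_def min_def)

lemma bump_nonzero:
  assumes "0 < r" "r < s" "bump r s x \<noteq> 0"
  shows "ennreal r < f x"
proof -
  have "enn2real (min (f x) (ennreal s)) > r"
    using assms by (auto simp: bump_def max_def split: if_splits) (smt (verit) divide_nonpos_pos)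
  then have "ennreal r < ennreal (enn2real (min (f x) (ennreal s)))"
    using assms by (intro ennreal_lessI) auto
  also have "\<dots> = min (f x) (ennreal s)"
    by (rule ennreal_enn2real) (simp add: min_less_iff_disj)
  finally show ?thesis by simp
qed

lemma bump_Cc0:
  assumes "0 < r" "r < s"
  shows "bump r s \<in> Cc0"
proof -
  have "continuous_on UNIV (\<lambda>x. enn2real (min (f x) (ennreal s)))"
    unfolding continuous_on_def
  proof
    fix x
    have "((\<lambda>x. min (f x) (ennreal s)) \<longlongrightarrow> min (f x) (ennreal s)) (at x)"
      using f_cont by (intro tendsto_min tendsto_const) (simp add: continuous_on_def)
    moreover have "min (f x) (ennreal s) < top" by (simp add: min_less_iff_disj)
    then have "min (f x) (ennreal s) = ennreal (enn2real (min (f x) (ennreal s)))"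
      by (simp add: ennreal_enn2real)
    ultimately show "((\<lambda>x. enn2real (min (f x) (ennreal s))) \<longlongrightarrow>
        enn2real (min (f x) (ennreal s))) (at x)"
      by (metis enn2real_nonneg tendsto_enn2real)
  qed
  then have "continuous_on UNIV (bump r s)"
    unfolding bump_def using assms by (intro continuous_intros) auto
  then show ?thesis
    using bump_nonzero[OF assms] assms by (auto simp: Cc0_def intro!: exI[of _ r] less_imp_le)
qed

text \<open>Countably many cutoffs serve all test functions; this is where the countability of the
  family in \<open>vague_topology_pullback\<close> starts.\<close>

lemma Cc0_level_bump:
  assumes "h \<in> Cc0"
  obtains m :: nat where "\<And>x. h x = h x * bump (1 / (2 * (real m + 1))) (1 / (real m + 1)) x"
proof -
  obtain r where r: "r > 0" "\<And>x. h x \<noteq> 0 \<Longrightarrow> ennreal r \<le> f x"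
    using assms by (auto simp: Cc0_def)
  obtain m :: nat where m: "1 / (real m + 1) < r"
    using r(1) by (metis add.commute nat_approx_posE of_nat_Suc)
  have "h x = h x * bump (1 / (2 * (real m + 1))) (1 / (real m + 1)) x" for x
  proof (cases "h x = 0")
    case False
    have "ennreal (1 / (real m + 1)) \<le> f x"
      using r(2)[OF False] m by (meson ennreal_leI less_imp_le order_trans)
    then show ?thesis
      by (subst bump_eq_1) (auto simp: field_simps)
  qed simp
  then show ?thesis by (rule that)
qed

end

section \<open>Moments of random points of the Hilbert cube\<close>

lemma compact_PiE_UNIV:
  assumes "\<And>i. compact (S i)"
  shows "compact (PiE (UNIV :: 'i set) S)"
proof -
  have "compactin (product_topology (\<lambda>_. euclidean) UNIV) (PiE UNIV S)"
    unfolding compactin_PiE using assms by auto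
  then show ?thesis by (simp add: euclidean_product_topology)
qed

text \<open>Polynomials in finitely many coordinates. Repeated entries of the list \<open>js\<close>
  encode powers, so expectations of the generators are the mixed moments.\<close>

inductive_set monomial_span :: "((nat \<Rightarrow> real) \<Rightarrow> real) set" where
  monomial: "(\<lambda>x. c * (\<Prod>j\<leftarrow>js. x j)) \<in> monomial_span"
| add: "g \<in> monomial_span \<Longrightarrow> h \<in> monomial_span \<Longrightarrow> (\<lambda>x. g x + h x) \<in> monomial_span"

lemma monomial_span_mult:
  assumes "g \<in> monomial_span" "h \<in> monomial_span"
  shows "(\<lambda>x. g x * h x) \<in> monomial_span"
  using assms(1)
proof induction
  case (monomial c js)
  show ?case using assms(2)
  proof induction
    case (monomial d ks)
    have "(\<lambda>x. c * (\<Prod>j\<leftarrow>js. x j) * (d * (\<Prod>j\<leftarrow>ks. x j))) =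
        (\<lambda>x. (c * d) * (\<Prod>j\<leftarrow>js @ ks. x j))"
      by (simp add: fun_eq_iff)
    then show ?case using monomial_span.monomial by metis
  next
    case (add g h)
    then show ?case by (auto simp: distrib_left intro: monomial_span.add)
  qed
next
  case (add g h)
  then show ?case by (auto simp: distrib_right intro: monomial_span.add)
qed

lemma monomial_span_continuous:
  "g \<in> monomial_span \<Longrightarrow> continuous_on UNIV g"
proof (induction rule: monomial_span.induct)
  case (monomial c js)
  have "continuous_on UNIV (\<lambda>x :: nat \<Rightarrow> real. \<Prod>j\<leftarrow>js. x j)" for js :: "nat list"
  proof (induction js)
    case (Cons j js)
    then show ?case
      by (auto intro!: continuous_on_mult)
  qed simp
  then show ?case by (intro continuous_intros)
next
  case (add g h)
  then show ?case by (intro continuous_intros)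
qed

abbreviation unit_cube :: "(nat \<Rightarrow> real) set" where
  "unit_cube \<equiv> PiE UNIV (\<lambda>_. {0..1})"

lemma function_ring_on_monomial_span:
  "function_ring_on monomial_span unit_cube"
proof
  show "compact unit_cube" by (intro compact_PiE_UNIV compact_Icc)
  show "continuous_on unit_cube g" if "g \<in> monomial_span" for g
    using monomial_span_continuous[OF that] continuous_on_subset by blast
  show "(\<lambda>_. c) \<in> monomial_span" for c
    using monomial_span.monomial[of c "[]"] by simp
  show "\<exists>g\<in>monomial_span. g x \<noteq> g y" if "x \<noteq> y" for x y
  proof -
    obtain j where "x j \<noteq> y j" using \<open>x \<noteq> y\<close> by auto
    moreover have "(\<lambda>x. x j) \<in> monomial_span"
      using monomial_span.monomial[of 1 "[j]"] by simp
    ultimately show ?thesis by (intro bexI[of _ "\<lambda>x. x j"]) auto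
  qed
qed (auto intro: monomial_span.add monomial_span_mult)

lemma expectation_diff_le:
  assumes "prob_space M" "X \<in> borel_measurable M" "\<And>\<omega>. \<omega> \<in> space M \<Longrightarrow> X \<omega> \<in> S"
    and "g \<in> borel_measurable borel" "h \<in> borel_measurable borel"
    and "\<And>x. x \<in> S \<Longrightarrow> \<bar>g x\<bar> \<le> (B :: real)" "\<And>x. x \<in> S \<Longrightarrow> \<bar>g x - h x\<bar> \<le> e"
  shows "\<bar>(\<integral>\<omega>. g (X \<omega>) \<partial>M) - (\<integral>\<omega>. h (X \<omega>) \<partial>M)\<bar> \<le> e"
proof -
  interpret prob_space M by fact
  note [measurable] = assms(2,4,5)
  have "\<bar>h x\<bar> \<le> B + e" if "x \<in> S" for x
    using assms(6,7)[OF that] by linarith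
  then have int: "integrable M (\<lambda>\<omega>. g (X \<omega>))" "integrable M (\<lambda>\<omega>. h (X \<omega>))"
    using assms(3,6) by (auto intro!: integrable_const_bound[where B = B and f = "\<lambda>\<omega>. g (X \<omega>)"]
        integrable_const_bound[where B = "B + e" and f = "\<lambda>\<omega>. h (X \<omega>)"] AE_I2)
  have "\<bar>(\<integral>\<omega>. g (X \<omega>) \<partial>M) - (\<integral>\<omega>. h (X \<omega>) \<partial>M)\<bar> = \<bar>\<integral>\<omega>. g (X \<omega>) - h (X \<omega>) \<partial>M\<bar>"
    using int by simp
  also have "\<dots> \<le> (\<integral>\<omega>. \<bar>g (X \<omega>) - h (X \<omega>)\<bar> \<partial>M)"
    by (rule integral_abs_bound)
  also have "\<dots> \<le> (\<integral>\<omega>. e \<partial>M)"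
    using int assms(3,7) by (intro integral_mono) auto
  finally show ?thesis by (simp add: prob_space)
qed

text \<open>Polynomials are uniformly dense on the compact cube, so \<open>g\<close> is replaced by
  a polynomial at cost \<open>e / 3\<close> on each side and the moments supply the remaining
  third.\<close>

lemma tendsto_expectation_of_moments:
  fixes X :: "nat \<Rightarrow> 'w \<Rightarrow> nat \<Rightarrow> real" and Y :: "'p \<Rightarrow> nat \<Rightarrow> real"
  assumes M: "prob_space M" and P: "prob_space P"
    and X: "\<And>n. X n \<in> borel_measurable M" "\<And>n \<omega>. \<omega> \<in> space M \<Longrightarrow> X n \<omega> \<in> unit_cube"
    and Y: "Y \<in> borel_measurable P" "\<And>\<omega>. \<omega> \<in> space P \<Longrightarrow> Y \<omega> \<in> unit_cube"
    and moments: "\<And>js. (\<lambda>n. \<integral>\<omega>. (\<Prod>j\<leftarrow>js. X n \<omega> j) \<partial>M) \<longlonglongrightarrow> (\<integral>\<omega>. (\<Prod>j\<leftarrow>js. Y \<omega> j) \<partial>P)"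
    and g: "continuous_on UNIV g"
  shows "(\<lambda>n. \<integral>\<omega>. g (X n \<omega>) \<partial>M) \<longlonglongrightarrow> (\<integral>\<omega>. (g (Y \<omega>) :: real) \<partial>P)"
proof -
  interpret M: prob_space M by fact
  interpret P: prob_space P by fact
  interpret R: function_ring_on monomial_span unit_cube
    by (rule function_ring_on_monomial_span)
  have bdd: "\<exists>B. \<forall>x\<in>unit_cube. \<bar>k x\<bar> \<le> B" if "continuous_on UNIV k" for k :: "(nat \<Rightarrow> real) \<Rightarrow> real"
  proof -
    have "compact (k ` unit_cube)"
      using that R.compact by (meson compact_continuous_image continuous_on_subset subset_UNIV)
    from compact_imp_bounded[OF this] show ?thesis
      unfolding bounded_iff by auto
  qed
  have span: "(\<lambda>n. \<integral>\<omega>. k (X n \<omega>) \<partial>M) \<longlonglongrightarrow> (\<integral>\<omega>. k (Y \<omega>) \<partial>P)" if "k \<in> monomial_span" for k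
    using that
  proof induction
    case (monomial c js)
    show ?case using moments by (simp add: tendsto_mult_left)
  next
    case (add k l)
    have int: "integrable M (\<lambda>\<omega>. q (X n \<omega>))" "integrable P (\<lambda>\<omega>. q (Y \<omega>))"
      if "q \<in> monomial_span" for q n
    proof -
      have c: "continuous_on UNIV q" using monomial_span_continuous[OF that] .
      then have [measurable]: "q \<in> borel_measurable borel" by (rule borel_measurable_continuous_onI)
      note [measurable] = X(1) Y(1)
      obtain B where B: "\<And>x. x \<in> unit_cube \<Longrightarrow> \<bar>q x\<bar> \<le> B" using bdd[OF c] by auto
      show "integrable M (\<lambda>\<omega>. q (X n \<omega>))" "integrable P (\<lambda>\<omega>. q (Y \<omega>))"
        using B X(2) Y(2) by (auto intro!: M.integrable_const_bound[of _ B] P.integrable_const_bound[of _ B] AE_I2)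
    qed
    show ?case
      using tendsto_add[OF add.IH] int[OF add.hyps(1)] int[OF add.hyps(2)] by simp
  qed
  obtain B where B: "\<And>x. x \<in> unit_cube \<Longrightarrow> \<bar>g x\<bar> \<le> B" using bdd[OF g] by auto
  have gm: "g \<in> borel_measurable borel" using g by (rule borel_measurable_continuous_onI)
  show ?thesis
  proof (rule LIMSEQ_I)
    fix e :: real assume "e > 0"
    then obtain k where k: "k \<in> monomial_span" "\<And>x. x \<in> unit_cube \<Longrightarrow> \<bar>g x - k x\<bar> < e / 3"
      using R.Stone_Weierstrass_basic[of g "e / 3"] g continuous_on_subset
      by (metis divide_pos_pos subset_UNIV zero_less_numeral)
    have km: "k \<in> borel_measurable borel"
      using monomial_span_continuous[OF k(1)] by (rule borel_measurable_continuous_onI)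
    obtain n0 where n0: "\<And>n. n \<ge> n0 \<Longrightarrow> norm ((\<integral>\<omega>. k (X n \<omega>) \<partial>M) - (\<integral>\<omega>. k (Y \<omega>) \<partial>P)) < e / 3"
      using LIMSEQ_D[OF span[OF k(1)], of "e / 3"] \<open>e > 0\<close> by auto
    have "norm ((\<integral>\<omega>. g (X n \<omega>) \<partial>M) - (\<integral>\<omega>. g (Y \<omega>) \<partial>P)) < e" if "n \<ge> n0" for n
      using n0[OF that] expectation_diff_le[OF M X gm km B less_imp_le[OF k(2)], of n]
        expectation_diff_le[OF P Y gm km B less_imp_le[OF k(2)]]
      by (simp add: abs_if split: if_splits)
    then show "\<exists>n0. \<forall>n\<ge>n0. norm ((\<integral>\<omega>. g (X n \<omega>) \<partial>M) - (\<integral>\<omega>. g (Y \<omega>) \<partial>P)) < e"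
      by blast
  qed
qed

text \<open>One half of the portmanteau theorem: the indicator of an open set is the increasing
  limit of continuous functions, and each of them bounds the probability from below.\<close>

lemma open_set_lower_bound_of_moments:
  fixes X :: "nat \<Rightarrow> 'w \<Rightarrow> nat \<Rightarrow> real" and Y :: "'p \<Rightarrow> nat \<Rightarrow> real"
  assumes M: "prob_space M" and P: "prob_space P"
    and X: "\<And>n. X n \<in> borel_measurable M" "\<And>n \<omega>. \<omega> \<in> space M \<Longrightarrow> X n \<omega> \<in> unit_cube"
    and Y: "Y \<in> borel_measurable P" "\<And>\<omega>. \<omega> \<in> space P \<Longrightarrow> Y \<omega> \<in> unit_cube"
    and moments: "\<And>js. (\<lambda>n. \<integral>\<omega>. (\<Prod>j\<leftarrow>js. X n \<omega> j) \<partial>M) \<longlonglongrightarrow> (\<integral>\<omega>. (\<Prod>j\<leftarrow>js. Y \<omega> j) \<partial>P)"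
    and W: "open W" and e: "e > 0"
  shows "\<forall>\<^sub>F n in sequentially.
    measure P {\<omega> \<in> space P. Y \<omega> \<in> W} - e < measure M {\<omega> \<in> space M. X n \<omega> \<in> W}"
proof -
  interpret M: prob_space M by fact
  interpret P: prob_space P by fact
  \<comment> \<open>\<open>infdist\<close> to the empty set is 0, so \<open>W = UNIV\<close> would
    make all approximants vanish. Removing a point outside the cube keeps the complement nonempty
    and changes no probability.\<close>
  define V where "V = W - {\<lambda>_. -1}"
  have V: "open V" "- V \<noteq> {}" using W by (auto simp: V_def intro: open_delete)
  have not_cube: "(\<lambda>_. -1) \<notin> unit_cube" by auto
  define g where "g k x = min 1 (real k * infdist x (- V))" for k :: nat and x
  have g01: "0 \<le> g k x" "g k x \<le> 1" for k x
    by (auto simp: g_def infdist_nonneg)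
  have g_zero: "g k x = 0" if "x \<notin> V" for k x
    using that by (simp add: g_def)
  have g_cont: "continuous_on UNIV (g k)" for k
    unfolding g_def by (intro continuous_intros)
  have gm[measurable]: "g k \<in> borel_measurable borel" for k
    using g_cont by (rule borel_measurable_continuous_onI)
  note [measurable] = X(1) Y(1)
  have Vm[measurable]: "V \<in> sets borel" using V by auto
  have "(\<lambda>k. \<integral>\<omega>. g k (Y \<omega>) \<partial>P) \<longlonglongrightarrow> (\<integral>\<omega>. indicator V (Y \<omega>) \<partial>P)"
  proof (rule integral_dominated_convergence[where w = "\<lambda>_. 1"])
    show "AE \<omega> in P. (\<lambda>k. g k (Y \<omega>)) \<longlonglongrightarrow> indicator V (Y \<omega>)"
    proof (rule AE_I2)
      fix \<omega>
      show "(\<lambda>k. g k (Y \<omega>)) \<longlonglongrightarrow> indicator V (Y \<omega>)"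
      proof (cases "Y \<omega> \<in> V")
        case True
        then have d: "infdist (Y \<omega>) (- V) > 0"
          using V by (metis ComplD closed_Compl in_closed_iff_infdist_zero infdist_nonneg order_less_le)
        obtain k0 :: nat where "1 < real k0 * infdist (Y \<omega>) (- V)"
          using reals_Archimedean3[OF d] by blast
        then have "1 < real k * infdist (Y \<omega>) (- V)" if "k \<ge> k0" for k
          using that d by (smt (verit) mult_right_mono of_nat_le_iff)
        then have "\<forall>\<^sub>F k in sequentially. g k (Y \<omega>) = 1"
          unfolding g_def eventually_sequentially by (intro exI[of _ k0]) auto
        then show ?thesis using True by (simp add: tendsto_eventually)
      qed (simp add: g_zero)
    qed
  qed (use g01 in auto)
  also have "(\<integral>\<omega>. indicator V (Y \<omega>) \<partial>P) = (\<integral>\<omega>. indicator {\<omega> \<in> space P. Y \<omega> \<in> V} \<omega> \<partial>P)"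
    by (intro Bochner_Integration.integral_cong) (auto simp: indicator_def)
  also have "\<dots> = measure P {\<omega> \<in> space P. Y \<omega> \<in> V}"
    by simp
  also have "{\<omega> \<in> space P. Y \<omega> \<in> V} = {\<omega> \<in> space P. Y \<omega> \<in> W}"
    using Y(2) not_cube unfolding V_def by (metis Diff_iff singletonD)
  finally have "\<forall>\<^sub>F k in sequentially. measure P {\<omega> \<in> space P. Y \<omega> \<in> W} - e < (\<integral>\<omega>. g k (Y \<omega>) \<partial>P)"
    using e by (intro order_tendstoD(1)) auto
  then obtain k where "measure P {\<omega> \<in> space P. Y \<omega> \<in> W} - e < (\<integral>\<omega>. g k (Y \<omega>) \<partial>P)"
    by (auto simp: eventually_sequentially)
  then have "\<forall>\<^sub>F n in sequentially.
      measure P {\<omega> \<in> space P. Y \<omega> \<in> W} - e < (\<integral>\<omega>. g k (X n \<omega>) \<partial>M)"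
    using tendsto_expectation_of_moments[OF M P X Y moments g_cont] by (intro order_tendstoD(1)) auto
  moreover have "(\<integral>\<omega>. g k (X n \<omega>) \<partial>M) \<le> measure M {\<omega> \<in> space M. X n \<omega> \<in> W}" for n
  proof -
    have Wm[measurable]: "W \<in> sets borel" using W by auto
    have "(\<integral>\<omega>. g k (X n \<omega>) \<partial>M) \<le> (\<integral>\<omega>. indicator {\<omega> \<in> space M. X n \<omega> \<in> W} \<omega> \<partial>M)"
    proof (rule integral_mono)
      show "g k (X n \<omega>) \<le> indicator {\<omega> \<in> space M. X n \<omega> \<in> W} \<omega>" if "\<omega> \<in> space M" for \<omega>
        using that g01[of k "X n \<omega>"] g_zero[of "X n \<omega>" k] by (auto simp: V_def split: split_indicator)
    qed (use g01 in \<open>auto intro!: M.integrable_const_bound[of _ 1] AE_I2\<close>)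
    then show ?thesis by simp
  qed
  ultimately show ?thesis
    by (auto elim!: eventually_mono intro: less_le_trans)
qed

section \<open>Weak convergence through open sets\<close>

text \<open>Preimages of open sets under \<open>\<psi>\<close> are stable under unions and finite
  intersections, so the generators decide.\<close>

lemma openin_of_pullback_generators:
  assumes gen: "\<And>S. S \<in> \<S> \<Longrightarrow> \<exists>W. open W \<and> S = {x \<in> X. \<psi> x \<in> W}"
    and U: "openin (topology_generated_by \<S>) U"
  shows "\<exists>W. open W \<and> U = {x \<in> X. \<psi> x \<in> W}"
proof -
  from U have "generate_topology_on \<S> U" by (rule openin_topology_generated_by)
  then show ?thesis
  proof induction
    case Empty
    show ?case by (intro exI[of _ "{}"]) auto
  next
    case (Int a b)
    then obtain V W where "open V" "a = {x \<in> X. \<psi> x \<in> V}" "open W" "b = {x \<in> X. \<psi> x \<in> W}"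
      by blast
    then show ?case by (intro exI[of _ "V \<inter> W"]) auto
  next
    case (UN K)
    then obtain W where W: "\<And>k. k \<in> K \<Longrightarrow> open (W k)" "\<And>k. k \<in> K \<Longrightarrow> k = {x \<in> X. \<psi> x \<in> W k}"
      by metis
    have "\<Union>K = {x \<in> X. \<psi> x \<in> (\<Union>k\<in>K. W k)}"
      using W(2) by blast
    then show ?case using W(1) by (intro exI[of _ "\<Union>k\<in>K. W k"]) auto
  qed (use gen in auto)
qed

lemma measurable_borel_of:
  assumes "\<And>\<omega>. \<omega> \<in> space M \<Longrightarrow> Y \<omega> \<in> topspace T"
    and "\<And>U. openin T U \<Longrightarrow> {\<omega> \<in> space M. Y \<omega> \<in> U} \<in> sets M"
  shows "Y \<in> measurable M (borel_of T)"
  unfolding borel_of_def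
proof (rule measurable_sigma_sets)
  show "sets (sigma (topspace T) {U. openin T U}) = sigma_sets (topspace T) {U. openin T U}"
    by (rule sets_measure_of) (auto dest: openin_subset)
  show "Y -` U \<inter> space M \<in> sets M" if "U \<in> {U. openin T U}" for U
    using assms(2)[of U] that by (simp add: vimage_def Int_def conj_commute)
qed (use assms(1) in \<open>auto dest: openin_subset\<close>)

lemma space_borel_of[simp]: "space (borel_of T) = topspace T"
  unfolding borel_of_def by (rule space_measure_of) (auto dest: openin_subset)

lemma sets_borel_of: "sets (borel_of T) = sigma_sets (topspace T) {U. openin T U}"
  unfolding borel_of_def by (rule sets_measure_of) (auto dest: openin_subset)

lemma openin_sets_borel_of: "openin T U \<Longrightarrow> U \<in> sets (borel_of T)"
  unfolding sets_borel_of by auto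

lemma measurable_borel_of_openin:
  assumes "Y \<in> measurable M (borel_of T)" "openin T U"
  shows "{\<omega> \<in> space M. Y \<omega> \<in> U} \<in> sets M"
  using measurable_sets[OF assms(1) openin_sets_borel_of[OF assms(2)]]
  by (simp add: vimage_def Int_def conj_commute)

lemma continuous_map_borel_of:
  assumes "Y \<in> measurable M (borel_of T)" "continuous_map T euclideanreal H"
  shows "(\<lambda>\<omega>. H (Y \<omega>)) \<in> borel_measurable M"
proof (rule borel_measurableI)
  fix S :: "real set" assume "open S"
  then have "openin T {x \<in> topspace T. H x \<in> S}"
    using assms(2) by (auto simp: continuous_map_def)
  from measurable_borel_of_openin[OF assms(1) this]
  have "{\<omega> \<in> space M. Y \<omega> \<in> topspace T \<and> H (Y \<omega>) \<in> S} \<in> sets M" by simp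
  moreover have "(\<lambda>\<omega>. H (Y \<omega>)) -` S \<inter> space M =
      {\<omega> \<in> space M. Y \<omega> \<in> topspace T \<and> H (Y \<omega>) \<in> S}"
    using measurable_space[OF assms(1)] by auto
  ultimately show "(\<lambda>\<omega>. H (Y \<omega>)) -` S \<inter> space M \<in> sets M" by simp
qed

text \<open>With \<open>t = H x\<close>, this bounds the expectation of \<open>H\<close> through the open sets \<open>{H > i / K}\<close>.\<close>

lemma level_sum_bounds:
  fixes t :: real
  assumes "0 \<le> t" "t \<le> 1" "K > 0"
  shows "(\<Sum>i<K. if real i < t * real K then 1 / real K else 0) \<le> t + 1 / real K"
    and "t \<le> (\<Sum>i<K. if real i < t * real K then 1 / real K else 0)"
proof -
  define m where "m = nat \<lceil>t * real K\<rceil>"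
  have mK: "m \<le> K"
    using assms by (simp add: m_def ceiling_le_iff mult_left_le_one_le)
  have *: "real i < t * real K \<longleftrightarrow> i < m" for i
    unfolding m_def by (simp add: less_ceiling_iff zless_nat_eq_int_zless)
  have "(\<Sum>i<K. if real i < t * real K then 1 / real K else 0) = (\<Sum>i<K. if i < m then 1 / real K else 0)"
    by (simp add: *)
  also have "\<dots> = (\<Sum>i\<in>{i\<in>{..<K}. i < m}. 1 / real K)"
    by (subst sum.inter_filter) auto
  also have "{i\<in>{..<K}. i < m} = {..<m}" using mK by auto
  finally have eq: "(\<Sum>i<K. if real i < t * real K then 1 / real K else 0) = real m / real K"
    by simp
  have "t * real K \<le> real m" "real m < t * real K + 1"
    using assms unfolding m_def by (simp_all add: of_nat_nat)  linarith+
  then show "(\<Sum>i<K. if real i < t * real K then 1 / real K else 0) \<le> t + 1 / real K"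
    "t \<le> (\<Sum>i<K. if real i < t * real K then 1 / real K else 0)"
    using assms unfolding eq by (simp_all add: field_simps)
qed

lemma expectation_lower_bound_of_open_sets:
  assumes M: "prob_space M" and P: "prob_space P"
    and Y: "\<And>n. Y n \<in> measurable M (borel_of T)" and Z: "Z \<in> measurable P (borel_of T)"
    and opens: "\<And>U e. openin T U \<Longrightarrow> e > 0 \<Longrightarrow> \<forall>\<^sub>F n in sequentially.
      measure P {\<omega> \<in> space P. Z \<omega> \<in> U} - e < measure M {\<omega> \<in> space M. Y n \<omega> \<in> U}"
    and H: "continuous_map T euclideanreal H" "\<And>x. x \<in> topspace T \<Longrightarrow> 0 \<le> H x"
      "\<And>x. x \<in> topspace T \<Longrightarrow> H x \<le> 1"
    and e: "e > 0"
  shows "\<forall>\<^sub>F n in sequentially. (\<integral>\<omega>. H (Z \<omega>) \<partial>P) - e < (\<integral>\<omega>. H (Y n \<omega>) \<partial>M)"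
proof -
  interpret M: prob_space M by fact
  interpret P: prob_space P by fact
  \<comment> \<open>Half of \<open>e\<close> pays for rounding \<open>H\<close> to multiples of
    \<open>1 / K\<close>, the other half for the bounds on the \<open>K\<close> open level
    sets.\<close>
  obtain K :: nat where K: "K > 0" "1 / real K < e / 2"
    using e by (metis half_gt_zero nat_approx_posE zero_less_Suc)
  define U where "U i = {x \<in> topspace T. real i < H x * real K}" for i :: nat
  have U: "openin T (U i)" for i
  proof -
    have "open {t. real i < t * real K}" by (intro open_Collect_less continuous_intros)
    then show ?thesis using H(1) unfolding U_def continuous_map_def by auto
  qed
  have level: "(\<integral>\<omega>. H (X \<omega>) \<partial>N) \<le> (\<Sum>i<K. measure N {\<omega> \<in> space N. X \<omega> \<in> U i} / real K) \<and>
      (\<Sum>i<K. measure N {\<omega> \<in> space N. X \<omega> \<in> U i} / real K) \<le> (\<integral>\<omega>. H (X \<omega>) \<partial>N) + 1 / real K"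
    if N: "prob_space N" and X: "X \<in> measurable N (borel_of T)" for N and X :: "_ \<Rightarrow> 'c"
  proof -
    interpret N: prob_space N by fact
    have top: "X \<omega> \<in> topspace T" if "\<omega> \<in> space N" for \<omega>
      using measurable_space[OF X that] by simp
    have [measurable]: "{\<omega> \<in> space N. X \<omega> \<in> U i} \<in> sets N" for i
      using measurable_borel_of_openin[OF X U] .
    have [measurable]: "(\<lambda>\<omega>. H (X \<omega>)) \<in> borel_measurable N"
      using continuous_map_borel_of[OF X H(1)] .
    have eq: "(\<Sum>i<K. measure N {\<omega> \<in> space N. X \<omega> \<in> U i} / real K) =
        (\<integral>\<omega>. (\<Sum>i<K. if real i < H (X \<omega>) * real K then 1 / real K else 0) \<partial>N)" (is "_ = (\<integral>\<omega>. ?S \<omega> \<partial>N)")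
    proof -
      have "(\<Sum>i<K. measure N {\<omega> \<in> space N. X \<omega> \<in> U i} / real K) =
          (\<integral>\<omega>. (\<Sum>i<K. indicator {\<omega> \<in> space N. X \<omega> \<in> U i} \<omega> / real K) \<partial>N)"
        by (subst Bochner_Integration.integral_sum) (auto simp: N.emeasure_eq_measure)
      also have "\<dots> = (\<integral>\<omega>. ?S \<omega> \<partial>N)"
        using top by (intro Bochner_Integration.integral_cong sum.cong) (auto simp: U_def)
      finally show ?thesis .
    qed
    have int: "integrable N (\<lambda>\<omega>. H (X \<omega>))"
      using H top by (intro N.integrable_const_bound[of _ 1] AE_I2) auto
    have intS: "integrable N ?S"
      by (intro Bochner_Integration.integrable_sum N.integrable_const_bound[of _ "1 / real K"]) auto
    have "(\<integral>\<omega>. H (X \<omega>) \<partial>N) \<le> (\<integral>\<omega>. ?S \<omega> \<partial>N)"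
      using int intS level_sum_bounds(2)[OF _ _ K(1)] H top by (intro integral_mono) auto
    moreover have "(\<integral>\<omega>. ?S \<omega> \<partial>N) \<le> (\<integral>\<omega>. H (X \<omega>) + 1 / real K \<partial>N)"
      using int intS level_sum_bounds(1)[OF _ _ K(1)] H top by (intro integral_mono) auto
    moreover have "(\<integral>\<omega>. H (X \<omega>) + 1 / real K \<partial>N) = (\<integral>\<omega>. H (X \<omega>) \<partial>N) + 1 / real K"
      using int by (simp add: N.prob_space)
    ultimately show ?thesis using eq by simp
  qed
  have "\<forall>\<^sub>F n in sequentially. \<forall>i\<in>{..<K}.
      measure P {\<omega> \<in> space P. Z \<omega> \<in> U i} - e / 2 < measure M {\<omega> \<in> space M. Y n \<omega> \<in> U i}"
    using e by (intro eventually_ball_finite ballI opens U) auto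
  then show ?thesis
  proof (rule eventually_mono)
    fix n assume *: "\<forall>i\<in>{..<K}.
      measure P {\<omega> \<in> space P. Z \<omega> \<in> U i} - e / 2 < measure M {\<omega> \<in> space M. Y n \<omega> \<in> U i}"
    have "(\<Sum>i<K. measure P {\<omega> \<in> space P. Z \<omega> \<in> U i} / real K) - e / 2 =
        (\<Sum>i<K. (measure P {\<omega> \<in> space P. Z \<omega> \<in> U i} - e / 2) / real K)"
      using K by (simp add: sum_subtractf diff_divide_distrib)
    also have "\<dots> \<le> (\<Sum>i<K. measure M {\<omega> \<in> space M. Y n \<omega> \<in> U i} / real K)"
      using * by (intro sum_mono divide_right_mono) (auto intro: less_imp_le)
    finally show "(\<integral>\<omega>. H (Z \<omega>) \<partial>P) - e < (\<integral>\<omega>. H (Y n \<omega>) \<partial>M)"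
      using level[OF P Z] level[OF M Y, of n] K(2) by linarith
  qed
qed

text \<open>The lower bound is applied to \<open>H\<close> and to \<open>- H\<close>, each moved
  affinely into the unit interval; together they give the limit. Only open level sets of
  \<open>H\<close> enter, so \<open>T\<close> may be any topological space.\<close>

theorem converges_in_distribution_of_open_sets:
  assumes M: "prob_space M" and P: "prob_space P"
    and Y: "\<And>n. Y n \<in> measurable M (borel_of T)" and Z: "Z \<in> measurable P (borel_of T)"
    and opens: "\<And>U e. openin T U \<Longrightarrow> e > 0 \<Longrightarrow> \<forall>\<^sub>F n in sequentially.
      measure P {\<omega> \<in> space P. Z \<omega> \<in> U} - e < measure M {\<omega> \<in> space M. Y n \<omega> \<in> U}"
  shows "converges_in_distribution T M Y P Z"
  unfolding converges_in_distribution_def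
proof (intro conjI allI impI Y Z)
  fix H assume H: "continuous_map T euclideanreal H \<and> bounded (H ` topspace T)"
  interpret M: prob_space M by fact
  interpret P: prob_space P by fact
  obtain B where B: "B > 0" "\<And>x. x \<in> topspace T \<Longrightarrow> \<bar>H x\<bar> \<le> B"
    using H unfolding bounded_pos by auto
  have lower: "\<forall>\<^sub>F n in sequentially. (\<integral>\<omega>. s * H (Z \<omega>) \<partial>P) - e < (\<integral>\<omega>. s * H (Y n \<omega>) \<partial>M)"
    if s: "\<bar>s\<bar> = 1" and e: "e > 0" for s e :: real
  proof -
    define G where "G x = (s * H x + B) / (2 * B)" for x
    have sH: "\<bar>s * H x\<bar> \<le> B" if "x \<in> topspace T" for x
      using B(2)[OF that] s by (simp add: abs_mult)
    have G: "0 \<le> G x" "G x \<le> 1" if "x \<in> topspace T" for x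
      using sH[OF that] B(1) unfolding G_def by (auto simp: field_simps abs_le_iff)
    have cont: "continuous_map T euclideanreal G"
      unfolding G_def using H B(1) by (intro continuous_intros) auto
    have int: "(\<integral>\<omega>. G (X \<omega>) \<partial>N) = ((\<integral>\<omega>. s * H (X \<omega>) \<partial>N) + B) / (2 * B)"
      if N: "prob_space N" and X: "X \<in> measurable N (borel_of T)" for N and X :: "_ \<Rightarrow> 'c"
    proof -
      interpret N: prob_space N by fact
      have "(\<lambda>\<omega>. H (X \<omega>)) \<in> borel_measurable N"
        using continuous_map_borel_of[OF X] H by blast
      then have "integrable N (\<lambda>\<omega>. H (X \<omega>))"
        using measurable_space[OF X] B by (intro N.integrable_const_bound[of _ B] AE_I2) auto
      then show ?thesis by (simp add: G_def N.prob_space)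
    qed
    have "\<forall>\<^sub>F n in sequentially. (\<integral>\<omega>. G (Z \<omega>) \<partial>P) - e / (2 * B) < (\<integral>\<omega>. G (Y n \<omega>) \<partial>M)"
      using expectation_lower_bound_of_open_sets[OF M P Y Z opens cont G, of "e / (2 * B)"] e B(1) by simp
    then show ?thesis
      unfolding int[OF P Z] int[OF M Y] using B(1)
      by (auto elim!: eventually_mono simp flip: diff_divide_distrib simp: divide_less_cancel)
  qed
  show "(\<lambda>n. \<integral>\<omega>. H (Y n \<omega>) \<partial>M) \<longlonglongrightarrow> (\<integral>\<omega>. H (Z \<omega>) \<partial>P)"
  proof (rule order_tendstoI)
    fix a assume "a < (\<integral>\<omega>. H (Z \<omega>) \<partial>P)"
    then show "\<forall>\<^sub>F n in sequentially. a < (\<integral>\<omega>. H (Y n \<omega>) \<partial>M)"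
      using lower[of 1 "(\<integral>\<omega>. H (Z \<omega>) \<partial>P) - a"] by simp
  next
    fix a assume "(\<integral>\<omega>. H (Z \<omega>) \<partial>P) < a"
    then show "\<forall>\<^sub>F n in sequentially. (\<integral>\<omega>. H (Y n \<omega>) \<partial>M) < a"
      using lower[of "-1" "a - (\<integral>\<omega>. H (Z \<omega>) \<partial>P)"] by simp
  qed
qed

lemma equal_in_distribution_of_open_sets:
  assumes M: "prob_space M" and P: "prob_space P"
    and Y: "Y \<in> measurable M (borel_of T)" and Z: "Z \<in> measurable P (borel_of T)"
    and opens: "\<And>U. openin T U \<Longrightarrow>
      measure M {\<omega> \<in> space M. Y \<omega> \<in> U} = measure P {\<omega> \<in> space P. Z \<omega> \<in> U}"
  shows "equal_in_distribution T M Y P Z"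
proof -
  interpret M: prob_space M by fact
  interpret P: prob_space P by fact
  interpret Y: prob_space "distr M (borel_of T) Y" by (rule M.prob_space_distr[OF Y])
  have "distr M (borel_of T) Y = distr P (borel_of T) Z"
  proof (rule measure_eqI_generator_eq[where E = "{U. openin T U}" and \<Omega> = "topspace T"
        and A = "\<lambda>_. topspace T"])
    show "emeasure (distr M (borel_of T) Y) U = emeasure (distr P (borel_of T) Z) U"
      if "U \<in> {U. openin T U}" for U
    proof -
      have U: "U \<in> sets (borel_of T)" using that openin_sets_borel_of by auto
      have "Y -` U \<inter> space M = {\<omega> \<in> space M. Y \<omega> \<in> U}" "Z -` U \<inter> space P = {\<omega> \<in> space P. Z \<omega> \<in> U}"
        by auto
      then show ?thesis
        using opens[of U] that U Y Z
        by (simp add: emeasure_distr M.emeasure_eq_measure P.emeasure_eq_measure)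
    qed
  qed (auto simp: Int_stable_def sets_borel_of dest: openin_subset)
  then show ?thesis using Y Z by (simp add: equal_in_distribution_def)
qed

section \<open>The vague topology\<close>

lemma topspace_vague: "topspace (vague_topology E) = point_measures E"
proof -
  have "(\<lambda>_. 0) \<in> Cc E" by (auto simp: Cc_def)
  then have "point_measures E \<in> {{\<mu> \<in> point_measures E. (\<integral>x. h x \<partial>\<mu>) \<in> U} | h U. h \<in> Cc E \<and> open U}"
    by (intro CollectI exI[of _ "\<lambda>_. 0"] exI[of _ UNIV]) auto
  then show ?thesis unfolding vague_topology_def topology_generated_by_topspace by auto
qed

context level_space
begin

text \<open>Sums and products of rational constants and of the coordinates of \<open>\<Psi>\<close>
  form a countable set, and they separate points because \<open>\<Psi>\<close> is injective.\<close>

lemma uniformly_dense_countable: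
  obtains G :: "('a \<Rightarrow> real) set"
  where "countable G" "\<And>g. g \<in> G \<Longrightarrow> continuous_on UNIV g" "(\<lambda>_. 1) \<in> G"
    "\<And>h e. continuous_on UNIV h \<Longrightarrow> e > 0 \<Longrightarrow> \<exists>g\<in>G. \<forall>x. \<bar>h x - g x\<bar> < e"
proof -
  define G0 :: "('a \<Rightarrow> real) set" where
    "G0 = range (\<lambda>q _. of_rat q) \<union> (\<lambda>b x. \<Psi> x \<bullet> b) ` Basis"
  define step :: "('a \<Rightarrow> real) set \<Rightarrow> ('a \<Rightarrow> real) set" where
    "step A = A \<union> (\<lambda>(g, h) x. g x + h x) ` (A \<times> A) \<union> (\<lambda>(g, h) x. g x * h x) ` (A \<times> A)" for A
  define G where "G = (\<Union>n. (step ^^ n) G0)"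
  have "countable ((step ^^ n) G0)" for n
    by (induction n) (auto simp: G0_def step_def countable_finite)
  then have countable: "countable G" by (auto simp: G_def)
  have mono: "(step ^^ m) G0 \<subseteq> (step ^^ n) G0" if "m \<le> n" for m n
    using that by (induction rule: dec_induct) (auto simp: step_def)
  have G0: "g \<in> G" if "g \<in> G0" for g
    unfolding G_def by (rule UN_I[of 0]) (use that in auto)
  have closed: "(\<lambda>x. g x + h x) \<in> G \<and> (\<lambda>x. g x * h x) \<in> G" if gh: "g \<in> G" "h \<in> G" for g h
  proof -
    obtain m n where "g \<in> (step ^^ m) G0" "h \<in> (step ^^ n) G0"
      using gh by (auto simp: G_def)
    then have "g \<in> (step ^^ max m n) G0" "h \<in> (step ^^ max m n) G0"
      using mono by (meson max.cobounded1 max.cobounded2 subsetD)+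
    then have "(\<lambda>x. g x + h x) \<in> (step ^^ Suc (max m n)) G0" "(\<lambda>x. g x * h x) \<in> (step ^^ Suc (max m n)) G0"
      by (force simp: step_def)+
    then show ?thesis unfolding G_def by blast
  qed
  have "\<forall>g\<in>(step ^^ n) G0. continuous_on UNIV g" for n
  proof (induction n)
    case 0
    show ?case using Psi_cont by (auto simp: G0_def intro!: continuous_intros)
  next
    case (Suc n)
    then show ?case by (auto simp: step_def intro!: continuous_intros)
  qed
  then have cont: "continuous_on UNIV g" if "g \<in> G" for g
    using that by (auto simp: G_def)
  \<comment> \<open>Stone-Weierstrass asks for all real constants, which \<open>G\<close> does not
    contain. It is therefore applied to the uniform closure \<open>R\<close> of
    \<open>G\<close>.\<close>
  define R where "R = {h. continuous_on UNIV h \<and> (\<forall>e>0. \<exists>g\<in>G. \<forall>x. \<bar>h x - g x\<bar> < e)}"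
  have bdd: "\<exists>B>0. \<forall>x. \<bar>h x\<bar> \<le> B" if "continuous_on UNIV h" for h :: "'a \<Rightarrow> real"
  proof -
    have "compact (range h)" using that compact_space compact_continuous_image by blast
    then show ?thesis using compact_imp_bounded bounded_pos by (metis rangeI real_norm_def)
  qed
  have GR: "g \<in> R" if "g \<in> G" for g
    using that cont by (auto simp: R_def intro!: bexI[of _ g])
  have RD: "\<exists>g\<in>G. \<forall>x. \<bar>h x - g x\<bar> < e" if "h \<in> R" "e > 0" for h e
    using that by (simp add: R_def)
  interpret R: function_ring_on R UNIV
  proof
    show "compact (UNIV :: 'a set)" by (rule compact_space)
    show "continuous_on UNIV h" if "h \<in> R" for h using that by (simp add: R_def)
    show "(\<lambda>x. g x + h x) \<in> R" if gh: "g \<in> R" "h \<in> R" for g h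
    proof -
      have "\<exists>k\<in>G. \<forall>x. \<bar>g x + h x - k x\<bar> < e" if "e > 0" for e
      proof -
        obtain g' h' where gh': "g' \<in> G" "\<And>x. \<bar>g x - g' x\<bar> < e / 2" "h' \<in> G" "\<And>x. \<bar>h x - h' x\<bar> < e / 2"
          using RD[OF gh(1), of "e / 2"] RD[OF gh(2), of "e / 2"] \<open>e > 0\<close> by auto
        have "\<bar>g x + h x - (g' x + h' x)\<bar> < e" for x
          using gh'(2)[of x] gh'(4)[of x] by linarith
        then show ?thesis
          using closed[OF gh'(1,3)] by (intro bexI[of _ "\<lambda>x. g' x + h' x"]) auto
      qed
      then show ?thesis using gh by (auto simp: R_def intro!: continuous_intros)
    qed
    show "(\<lambda>x. g x * h x) \<in> R" if gh: "g \<in> R" "h \<in> R" for g h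
    proof -
      have gh_cont: "continuous_on UNIV g" "continuous_on UNIV h" using gh by (auto simp: R_def)
      obtain B where B: "B > 0" "\<And>x. \<bar>g x\<bar> \<le> B" using bdd[OF gh_cont(1)] by blast
      obtain C where C: "C > 0" "\<And>x. \<bar>h x\<bar> \<le> C" using bdd[OF gh_cont(2)] by blast
      have "\<exists>k\<in>G. \<forall>x. \<bar>g x * h x - k x\<bar> < e" if "e > 0" for e
      proof -
        \<comment> \<open>\<open>d \<le> 1\<close> bounds the approximant \<open>h'\<close> by
          \<open>C + 1\<close>; the product error is then at most \<open>(B + C + 1) * d\<close>,
          which is at most \<open>e / 2\<close>.\<close>
        define d where "d = min 1 (e / (2 * (B + C + 1)))"
        have d: "d > 0" "d \<le> 1" "d * (B + C + 1) \<le> e / 2"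
        proof -
          have "d \<le> e / (2 * (B + C + 1))" by (simp add: d_def)
          then show "d * (B + C + 1) \<le> e / 2" using B(1) C(1) by (simp add: field_simps)
        qed (use \<open>e > 0\<close> B(1) C(1) in \<open>auto simp: d_def\<close>)
        obtain g' h' where gh': "g' \<in> G" "\<And>x. \<bar>g x - g' x\<bar> < d" "h' \<in> G" "\<And>x. \<bar>h x - h' x\<bar> < d"
          using RD[OF gh(1) d(1)] RD[OF gh(2) d(1)] by blast
        have "\<bar>g x * h x - g' x * h' x\<bar> < e" for x
        proof -
          have "\<bar>g x * h x - g' x * h' x\<bar> = \<bar>g x * (h x - h' x) + h' x * (g x - g' x)\<bar>"
            by (simp add: algebra_simps)
          also have "\<dots> \<le> \<bar>g x\<bar> * \<bar>h x - h' x\<bar> + \<bar>h' x\<bar> * \<bar>g x - g' x\<bar>"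
            by (metis abs_mult abs_triangle_ineq)
          also have "\<dots> \<le> B * d + (C + 1) * d"
            using B(2)[of x] C(2)[of x] gh'(2)[of x] gh'(4)[of x] d B(1) C(1)
            by (intro add_mono mult_mono) auto
          also have "\<dots> \<le> e / 2" using d(3) by (simp add: algebra_simps)
          finally show ?thesis using \<open>e > 0\<close> by simp
        qed
        then show ?thesis using closed gh' by (intro bexI[of _ "\<lambda>x. g' x * h' x"]) auto
      qed
      then show ?thesis using gh by (auto simp: R_def intro!: continuous_intros)
    qed
    show "(\<lambda>_. c) \<in> R" for c
    proof -
      have "\<exists>k\<in>G. \<forall>x. \<bar>c - k x\<bar> < e" if "e > 0" for e
      proof -
        obtain q where "c < real_of_rat q" "real_of_rat q < c + e"
          using of_rat_dense[of c "c + e"] \<open>e > 0\<close> by auto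
        moreover have "(\<lambda>_. real_of_rat q) \<in> G" by (intro G0) (auto simp: G0_def)
        ultimately show ?thesis by (intro bexI[of _ "\<lambda>_. real_of_rat q"]) auto
      qed
      then show ?thesis by (auto simp: R_def)
    qed
    show "\<exists>g\<in>R. g x \<noteq> g y" if "x \<noteq> y" for x y
    proof -
      have "\<Psi> x \<noteq> \<Psi> y" using that Psi_inj by (auto dest: injD)
      then obtain b where b: "b \<in> Basis" "\<Psi> x \<bullet> b \<noteq> \<Psi> y \<bullet> b"
        using euclidean_eqI by blast
      then have "(\<lambda>x. \<Psi> x \<bullet> b) \<in> R" by (intro GR G0) (auto simp: G0_def)
      then show ?thesis using b(2) by (intro bexI[of _ "\<lambda>x. \<Psi> x \<bullet> b"]) auto
    qed
  qed
  have "\<exists>g\<in>G. \<forall>x. \<bar>h x - g x\<bar> < e" if h: "continuous_on UNIV h" and e: "e > 0" for h e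
  proof -
    obtain k where k: "k \<in> R" "\<And>x. \<bar>h x - k x\<bar> < e / 2"
      using R.Stone_Weierstrass_basic[OF h, of "e / 2"] e by auto
    obtain g where g: "g \<in> G" "\<And>x. \<bar>k x - g x\<bar> < e / 2"
      using RD[OF k(1), of "e / 2"] e by auto
    have "\<bar>h x - g x\<bar> < e" for x using k(2)[of x] g(2)[of x] by linarith
    then show ?thesis using g(1) by blast
  qed
  moreover have "(\<lambda>_. 1) \<in> G"
    by (intro G0, unfold G0_def, intro UnI1 range_eqI[of _ _ 1]) simp
  ultimately show ?thesis using that[OF countable cont] by blast
qed

lemma point_measures_radon: "\<mu> \<in> point_measures E \<Longrightarrow> radon_measure_on E \<mu>"
  by (simp add: point_measures_def)

lemma radon_sets: "radon_measure_on E \<mu> \<Longrightarrow> sets \<mu> = sets (restrict_space borel E)"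
  by (simp add: radon_measure_on_def)

lemma radon_space: "radon_measure_on E \<mu> \<Longrightarrow> space \<mu> = E"
  using sets_eq_imp_space_eq[OF radon_sets] by (simp add: space_restrict_space)

lemma radon_level_finite:
  assumes "radon_measure_on E \<mu>" "r > 0"
  shows "emeasure \<mu> {x. f x \<ge> ennreal r} < \<infinity>"
proof -
  have "{x. f x \<ge> ennreal r} \<subseteq> E" using assms(2) by auto
  then show ?thesis using assms(1) compact_f_ge by (auto simp: radon_measure_on_def)
qed

lemma radon_measurable:
  assumes "radon_measure_on E \<mu>" "h \<in> measurable borel N"
  shows "h \<in> measurable \<mu> N"
  using measurable_restrict_space1[OF assms(2), of E] radon_sets[OF assms(1)]
  by (metis measurable_cong_sets)

lemma sets_radon_Int:
  assumes "radon_measure_on E \<mu>" "A \<in> sets borel"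
  shows "A \<inter> E \<in> sets \<mu>"
  using assms by (auto simp: radon_sets sets_restrict_space)

lemma sets_radon:
  assumes "radon_measure_on E \<mu>" "A \<in> sets borel" "A \<subseteq> E"
  shows "A \<in> sets \<mu>"
  using sets_radon_Int[OF assms(1,2)] assms(3) by (simp add: inf.absorb1)

lemma sets_radon_level:
  assumes "radon_measure_on E \<mu>" "r > 0"
  shows "{x. f x \<ge> ennreal r} \<in> sets \<mu>"
  using assms(2) closed_f_ge by (intro sets_radon[OF assms(1)] borel_closed) auto

lemma Cc0_integrable:
  assumes "radon_measure_on E \<mu>" "h \<in> Cc0"
  shows "integrable \<mu> h"
proof -
  obtain r where r: "r > 0" "\<And>x. h x \<noteq> 0 \<Longrightarrow> ennreal r \<le> f x"
    using assms(2) by (auto simp: Cc0_def)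
  obtain B where "\<And>x. \<bar>h x\<bar> \<le> B" using Cc0_bounded[OF assms(2)] by blast
  then show ?thesis
    using r radon_level_finite[OF assms(1) r(1)] sets_radon_level[OF assms(1) r(1)]
      radon_measurable[OF assms(1) Cc0_measurable[OF assms(2)]]
    by (intro integrableI_bounded_set[where A = "{x. f x \<ge> ennreal r}" and B = B]) auto
qed

lemma openin_vague_integral:
  assumes "h \<in> Cc0" "open U"
  shows "openin (vague_topology E) {\<mu> \<in> point_measures E. (\<integral>x. h x \<partial>\<mu>) \<in> U}"
  unfolding vague_topology_def using assms Cc0_subset_Cc
  by (intro topology_generated_by_Basis) auto

text \<open>Members of the family are \<open>max 0 g * b m\<close> with \<open>g\<close> from the
  dense set and \<open>b m\<close> a cutoff. A test function supported where \<open>b m = 1\<close>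
  is, up to \<open>2 * d * b m\<close>, a difference of two members approximating its positive and
  negative part. Since the constant 1 is in \<open>G\<close>, \<open>b m\<close> is a member too,
  and nearness in its coordinate bounds the integral of the error. The map \<open>exp (- _)\<close>
  brings the integrals of nonnegative functions into the unit interval.\<close>

lemma vague_topology_pullback:
  obtains \<phi> :: "nat \<Rightarrow> 'a \<Rightarrow> real"
  where "\<And>j. \<phi> j \<in> Cc0" "\<And>j x. 0 \<le> \<phi> j x"
    "\<And>U. openin (vague_topology E) U \<Longrightarrow>
      \<exists>W. open W \<and> U = {\<mu> \<in> point_measures E. (\<lambda>j. exp (- (\<integral>x. \<phi> j x \<partial>\<mu>))) \<in> W}"
proof -
  obtain G :: "('a \<Rightarrow> real) set" where G: "countable G" "\<And>g. g \<in> G \<Longrightarrow> continuous_on UNIV g" "(\<lambda>_. 1) \<in> G"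
    "\<And>h e. continuous_on UNIV h \<Longrightarrow> e > 0 \<Longrightarrow> \<exists>g\<in>G. \<forall>x. \<bar>h x - g x\<bar> < e"
    using uniformly_dense_countable by blast
  define b where "b m = bump (1 / (2 * (real m + 1))) (1 / (real m + 1))" for m :: nat
  have b: "b m \<in> Cc0" "0 \<le> b m x" for m x
    unfolding b_def by (auto intro!: bump_Cc0 bump_nonneg simp: field_simps)
  define F where "F = (\<lambda>(g, m) x. max 0 (g x) * b m x) ` (G \<times> (UNIV :: nat set))"
  have FI: "(\<lambda>x. max 0 (g x) * b m x) \<in> F" if "g \<in> G" for g m
    unfolding F_def by (rule image_eqI[of _ _ "(g, m)"]) (use that in auto)
  have F: "k \<in> Cc0" "0 \<le> k x" if "k \<in> F" for k x
    using that G(2) b by (auto simp: F_def intro!: Cc0_mult continuous_intros)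
  have Fne: "countable F" "F \<noteq> {}" using G(1,3) by (auto simp: F_def)
  define \<phi> where "\<phi> = from_nat_into F"
  have \<phi>: "\<phi> j \<in> F" for j using Fne by (simp add: \<phi>_def from_nat_into)
  have ex: "\<exists>j. \<phi> j = k" if "k \<in> F" for k
    using from_nat_into_surj[OF Fne(1) that] by (auto simp: \<phi>_def)
  define \<psi> where "\<psi> \<mu> = (\<lambda>j. exp (- (\<integral>x. \<phi> j x \<partial>\<mu>)))" for \<mu>
  have local: "\<exists>W. open W \<and> \<psi> \<mu>0 \<in> W \<and> (\<forall>\<mu>\<in>point_measures E. \<psi> \<mu> \<in> W \<longrightarrow> \<bar>(\<integral>x. h x \<partial>\<mu>) - (\<integral>x. h x \<partial>\<mu>0)\<bar> < e)"
    if h: "h \<in> Cc0" and \<mu>0: "\<mu>0 \<in> point_measures E" and e: "e > 0" for h \<mu>0 e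
  proof -
    obtain m where m: "\<And>x. h x = h x * b m x"
      using Cc0_level_bump[OF h] unfolding b_def by blast
    define A where "A = (\<integral>x. b m x \<partial>\<mu>0)"
    have "A \<ge> 0" unfolding A_def using b by (intro Bochner_Integration.integral_nonneg) auto
    \<comment> \<open>The approximation errors are \<open>2 * d * (A + 1)\<close> for
      \<open>\<mu>\<close> and \<open>2 * d * A\<close> for \<open>\<mu>0\<close>, and the
      coordinates of \<open>P\<close> and \<open>Q\<close> add \<open>2 * d\<close>. The sum
      \<open>d * (4 * A + 4)\<close> stays below \<open>e\<close>.\<close>
    define d where "d = e / (4 * A + 5)"
    have d: "d > 0" "d * (4 * A + 5) = e"
      using e \<open>A \<ge> 0\<close> by (auto simp: d_def)
    have hc: "continuous_on UNIV (\<lambda>x. max 0 (h x))" "continuous_on UNIV (\<lambda>x. max 0 (- h x))"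
      using h by (auto simp: Cc0_def intro!: continuous_intros)
    obtain p q where p: "p \<in> G" "\<And>x. \<bar>max 0 (h x) - p x\<bar> < d" and q: "q \<in> G" "\<And>x. \<bar>max 0 (- h x) - q x\<bar> < d"
      using G(4)[OF hc(1) d(1)] G(4)[OF hc(2) d(1)] by blast
    define P where "P x = max 0 (p x) * b m x" for x
    define Q where "Q x = max 0 (q x) * b m x" for x
    have PQ: "P \<in> F" "Q \<in> F" "b m \<in> F"
      using FI[OF p(1)] FI[OF q(1)] FI[OF G(3)] by (simp_all add: P_def[abs_def] Q_def[abs_def])
    obtain i j k where ijk: "\<phi> i = P" "\<phi> j = Q" "\<phi> k = b m" using ex PQ by metis
    have approx: "\<bar>h x - (P x - Q x)\<bar> \<le> 2 * d * b m x" for x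
    proof -
      have "\<bar>h x - (max 0 (p x) - max 0 (q x))\<bar> \<le> 2 * d"
        using p(2)[of x] q(2)[of x] by linarith
      then have "\<bar>h x - (max 0 (p x) - max 0 (q x))\<bar> * b m x \<le> 2 * d * b m x"
        using b(2) by (rule mult_right_mono)
      moreover have "\<bar>h x - (max 0 (p x) - max 0 (q x))\<bar> * b m x
          = \<bar>(h x - (max 0 (p x) - max 0 (q x))) * b m x\<bar>"
        using b(2)[of m x] by (simp add: abs_mult)
      moreover have "(h x - (max 0 (p x) - max 0 (q x))) * b m x = h x - (P x - Q x)"
        using m[of x] by (simp add: P_def Q_def algebra_simps)
      ultimately show ?thesis by simp
    qed
    have int_approx: "\<bar>(\<integral>x. h x \<partial>\<mu>) - ((\<integral>x. P x \<partial>\<mu>) - (\<integral>x. Q x \<partial>\<mu>))\<bar> \<le> 2 * d * (\<integral>x. b m x \<partial>\<mu>)"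
      if "\<mu> \<in> point_measures E" for \<mu>
    proof -
      note int = Cc0_integrable[OF point_measures_radon[OF that]]
      have i: "integrable \<mu> h" "integrable \<mu> P" "integrable \<mu> Q" "integrable \<mu> (b m)"
        using h F(1) PQ b int by auto
      have "\<bar>(\<integral>x. h x \<partial>\<mu>) - ((\<integral>x. P x \<partial>\<mu>) - (\<integral>x. Q x \<partial>\<mu>))\<bar> = \<bar>\<integral>x. h x - (P x - Q x) \<partial>\<mu>\<bar>"
        using i by simp
      also have "\<dots> \<le> (\<integral>x. \<bar>h x - (P x - Q x)\<bar> \<partial>\<mu>)" by (rule integral_abs_bound)
      also have "\<dots> \<le> (\<integral>x. 2 * d * b m x \<partial>\<mu>)"
        using i approx by (intro integral_mono) auto
      finally show ?thesis by simp
    qed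
    \<comment> \<open>An open condition on the single coordinate \<open>l\<close>; taking
      logarithms, it says that the two integrals of \<open>\<phi> l\<close> differ by less than
      \<open>t\<close>.\<close>
    define box where "box l t = {y :: nat \<Rightarrow> real. exp (- (\<integral>x. \<phi> l x \<partial>\<mu>0) - t) < y l \<and> y l < exp (- (\<integral>x. \<phi> l x \<partial>\<mu>0) + t)}"
      for l t
    have box_open: "open (box l t)" for l t
      unfolding box_def by (intro open_Collect_conj open_Collect_less continuous_intros) auto
    have box_iff: "\<psi> \<mu> \<in> box l t \<longleftrightarrow> \<bar>(\<integral>x. \<phi> l x \<partial>\<mu>) - (\<integral>x. \<phi> l x \<partial>\<mu>0)\<bar> < t" for \<mu> l t
      by (auto simp: box_def \<psi>_def)
    define W where "W = box i d \<inter> box j d \<inter> box k 1"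
    have "\<bar>(\<integral>x. h x \<partial>\<mu>) - (\<integral>x. h x \<partial>\<mu>0)\<bar> < e" if \<mu>: "\<mu> \<in> point_measures E" and W: "\<psi> \<mu> \<in> W" for \<mu>
    proof -
      have 1: "\<bar>(\<integral>x. P x \<partial>\<mu>) - (\<integral>x. P x \<partial>\<mu>0)\<bar> < d" "\<bar>(\<integral>x. Q x \<partial>\<mu>) - (\<integral>x. Q x \<partial>\<mu>0)\<bar> < d"
        and 2: "(\<integral>x. b m x \<partial>\<mu>) < A + 1"
        using W unfolding W_def Int_iff box_iff ijk A_def by auto
      have "2 * d * (\<integral>x. b m x \<partial>\<mu>) \<le> 2 * d * (A + 1)"
        using 2 d(1) by (intro mult_left_mono) auto
      then have "\<bar>(\<integral>x. h x \<partial>\<mu>) - (\<integral>x. h x \<partial>\<mu>0)\<bar> < 2 * d * (A + 1) + 2 * d * A + 2 * d"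
        using int_approx[OF \<mu>] int_approx[OF \<mu>0] 1 unfolding A_def[symmetric] by linarith
      also have "\<dots> = d * (4 * A + 4)" by (simp add: algebra_simps)
      also have "\<dots> < e" using d by (simp add: algebra_simps)
      finally show ?thesis .
    qed
    moreover have "open W" unfolding W_def using box_open by blast
    moreover have "\<psi> \<mu>0 \<in> W" unfolding W_def using d(1) by (simp add: box_iff)
    ultimately show ?thesis by blast
  qed
  have "\<exists>W. open W \<and> U = {\<mu> \<in> point_measures E. \<psi> \<mu> \<in> W}" if "openin (vague_topology E) U" for U
  proof (rule openin_of_pullback_generators[OF _ that[unfolded vague_topology_def]])
    fix S assume "S \<in> {{\<mu> \<in> point_measures E. (\<integral>x. h x \<partial>\<mu>) \<in> U} | h U. h \<in> Cc E \<and> open U}"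
    then obtain h V where S: "S = {\<mu> \<in> point_measures E. (\<integral>x. h x \<partial>\<mu>) \<in> V}" and h: "h \<in> Cc E" "open V"
      by blast
    define k where "k x = (if x \<in> E then h x else 0)" for x
    have k: "k \<in> Cc0" unfolding k_def using Cc_extension[OF h(1)] .
    have hk: "(\<integral>x. h x \<partial>\<mu>) = (\<integral>x. k x \<partial>\<mu>)" if "\<mu> \<in> point_measures E" for \<mu>
      using radon_space[OF point_measures_radon[OF that]]
      by (intro Bochner_Integration.integral_cong) (auto simp: k_def)
    have "\<exists>W. open W \<and> \<psi> \<mu> \<in> W \<and> (\<forall>\<mu>'\<in>point_measures E. \<psi> \<mu>' \<in> W \<longrightarrow> \<mu>' \<in> S)" if "\<mu> \<in> S" for \<mu>
    proof -
      have \<mu>: "\<mu> \<in> point_measures E" "(\<integral>x. k x \<partial>\<mu>) \<in> V" using that hk by (auto simp: S)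
      then obtain e where e: "e > 0" "\<And>t. \<bar>t - (\<integral>x. k x \<partial>\<mu>)\<bar> < e \<Longrightarrow> t \<in> V"
        using h(2) unfolding open_dist dist_real_def by blast
      show ?thesis using local[OF k \<mu>(1) e(1)] e(2) hk by (auto simp: S)
    qed
    then obtain W where W: "\<And>\<mu>. \<mu> \<in> S \<Longrightarrow> open (W \<mu>)" "\<And>\<mu>. \<mu> \<in> S \<Longrightarrow> \<psi> \<mu> \<in> W \<mu>"
      "\<And>\<mu> \<mu>'. \<mu> \<in> S \<Longrightarrow> \<mu>' \<in> point_measures E \<Longrightarrow> \<psi> \<mu>' \<in> W \<mu> \<Longrightarrow> \<mu>' \<in> S"
      by metis
    have "S = {\<mu> \<in> point_measures E. \<psi> \<mu> \<in> (\<Union>\<mu>\<in>S. W \<mu>)}"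
      using W(2,3) by (auto simp: S)
    then show "\<exists>W. open W \<and> S = {\<mu> \<in> point_measures E. \<psi> \<mu> \<in> W}"
      using W(1) by (intro exI[of _ "\<Union>\<mu>\<in>S. W \<mu>"]) auto
  qed
  then show ?thesis
    using that[of \<phi>] F \<phi> unfolding \<psi>_def by blast
qed

end

section \<open>Laplace functionals\<close>

lemma borel_measurable_exp_uminus:
  "F \<in> borel_measurable M \<Longrightarrow> (\<lambda>\<omega>. exp (- F \<omega>) :: real) \<in> borel_measurable M"
  by measurable

context level_space
begin

lemma vague_integral_measurable:
  assumes "Y \<in> measurable M (borel_of (vague_topology E))" "h \<in> Cc0"
  shows "(\<lambda>\<omega>. \<integral>x. h x \<partial>Y \<omega>) \<in> borel_measurable M"
proof (rule borel_measurableI)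
  fix S :: "real set" assume "open S"
  have "{\<omega> \<in> space M. Y \<omega> \<in> {\<mu> \<in> point_measures E. (\<integral>x. h x \<partial>\<mu>) \<in> S}} \<in> sets M"
    by (intro measurable_borel_of_openin[OF assms(1)] openin_vague_integral assms(2) \<open>open S\<close>)
  moreover have "(\<lambda>\<omega>. \<integral>x. h x \<partial>Y \<omega>) -` S \<inter> space M =
      {\<omega> \<in> space M. Y \<omega> \<in> {\<mu> \<in> point_measures E. (\<integral>x. h x \<partial>\<mu>) \<in> S}}"
    using measurable_space[OF assms(1)] by (auto simp: topspace_vague)
  ultimately show "(\<lambda>\<omega>. \<integral>x. h x \<partial>Y \<omega>) -` S \<inter> space M \<in> sets M" by simp
qed

text \<open>By the pullback description every vaguely open set is an open condition on countably
  many integrals, so measurable integrals suffice even though the topology has uncountably many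
  generators.\<close>

lemma measurable_vague:
  assumes pm: "\<And>\<omega>. \<omega> \<in> space M \<Longrightarrow> Y \<omega> \<in> point_measures E"
    and meas: "\<And>h. h \<in> Cc0 \<Longrightarrow> (\<And>x. 0 \<le> h x) \<Longrightarrow> (\<lambda>\<omega>. \<integral>x. h x \<partial>Y \<omega>) \<in> borel_measurable M"
  shows "Y \<in> measurable M (borel_of (vague_topology E))"
proof (rule measurable_borel_of)
  fix U assume U: "openin (vague_topology E) U"
  obtain \<phi> :: "nat \<Rightarrow> 'a \<Rightarrow> real" where \<phi>: "\<And>j. \<phi> j \<in> Cc0" "\<And>j x. 0 \<le> \<phi> j x"
    "\<And>U. openin (vague_topology E) U \<Longrightarrow>
      \<exists>W. open W \<and> U = {\<mu> \<in> point_measures E. (\<lambda>j. exp (- (\<integral>x. \<phi> j x \<partial>\<mu>))) \<in> W}"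
    using vague_topology_pullback by blast
  obtain W where W: "open W" "U = {\<mu> \<in> point_measures E. (\<lambda>j. exp (- (\<integral>x. \<phi> j x \<partial>\<mu>))) \<in> W}"
    using \<phi>(3)[OF U] by blast
  have [measurable]: "(\<lambda>\<omega> j. exp (- (\<integral>x. \<phi> j x \<partial>Y \<omega>))) \<in> borel_measurable M"
    using meas[OF \<phi>(1,2)] by (intro measurable_coordinatewise_then_product borel_measurable_exp_uminus)
  have [measurable]: "W \<in> sets borel" using W(1) by simp
  have "{\<omega> \<in> space M. (\<lambda>j. exp (- (\<integral>x. \<phi> j x \<partial>Y \<omega>))) \<in> W} \<in> sets M" by measurable
  also have "{\<omega> \<in> space M. (\<lambda>j. exp (- (\<integral>x. \<phi> j x \<partial>Y \<omega>))) \<in> W} = {\<omega> \<in> space M. Y \<omega> \<in> U}"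
    using pm by (auto simp: W(2))
  finally show "{\<omega> \<in> space M. Y \<omega> \<in> U} \<in> sets M" .
qed (simp add: topspace_vague pm)

text \<open>\<open>\<psi>\<close> sends a random point measure to a random point of the cube. The
  moment with index list \<open>js\<close> is the Laplace functional at the sum of the
  \<open>\<phi> j\<close> over \<open>js\<close>, again a nonnegative test function.\<close>

lemma laplace_open_set_lower_bound:
  assumes M: "prob_space M" and P: "prob_space P"
    and Y: "\<And>n. Y n \<in> measurable M (borel_of (vague_topology E))"
    and Z: "Z \<in> measurable P (borel_of (vague_topology E))"
    and laplace: "\<And>h. h \<in> Cc0 \<Longrightarrow> (\<And>x. 0 \<le> h x) \<Longrightarrow>
      (\<lambda>n. \<integral>\<omega>. exp (- (\<integral>x. h x \<partial>Y n \<omega>)) \<partial>M) \<longlonglongrightarrow> (\<integral>\<omega>. exp (- (\<integral>x. h x \<partial>Z \<omega>)) \<partial>P)"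
    and U: "openin (vague_topology E) U" and e: "e > 0"
  shows "\<forall>\<^sub>F n in sequentially.
    measure P {\<omega> \<in> space P. Z \<omega> \<in> U} - e < measure M {\<omega> \<in> space M. Y n \<omega> \<in> U}"
proof -
  obtain \<phi> :: "nat \<Rightarrow> 'a \<Rightarrow> real" where \<phi>: "\<And>j. \<phi> j \<in> Cc0" "\<And>j x. 0 \<le> \<phi> j x"
    "\<And>U. openin (vague_topology E) U \<Longrightarrow>
      \<exists>W. open W \<and> U = {\<mu> \<in> point_measures E. (\<lambda>j. exp (- (\<integral>x. \<phi> j x \<partial>\<mu>))) \<in> W}"
    using vague_topology_pullback by blast
  define \<psi> where "\<psi> \<mu> = (\<lambda>j. exp (- (\<integral>x. \<phi> j x \<partial>\<mu>)))" for \<mu> :: "'a measure"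
  obtain W where W: "open W" "U = {\<mu> \<in> point_measures E. \<psi> \<mu> \<in> W}"
    using \<phi>(3)[OF U] unfolding \<psi>_def by blast
  have pm: "Y n \<omega> \<in> point_measures E" if "\<omega> \<in> space M" for n \<omega>
    using measurable_space[OF Y that] by (simp add: topspace_vague)
  have pmZ: "Z \<omega> \<in> point_measures E" if "\<omega> \<in> space P" for \<omega>
    using measurable_space[OF Z that] by (simp add: topspace_vague)
  have cube: "\<psi> \<mu> \<in> unit_cube" for \<mu>
    using \<phi>(2) by (auto simp: \<psi>_def intro!: Bochner_Integration.integral_nonneg)
  have sum_Cc0: "(\<lambda>x. \<Sum>j\<leftarrow>js. \<phi> j x) \<in> Cc0" for js
  proof (induction js)
    case Nil
    show ?case by (auto simp: Cc0_def intro: exI[of _ 1])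
  next
    case (Cons j js)
    then show ?case using Cc0_add[OF \<phi>(1)] by simp
  qed
  have prod_eq: "(\<Prod>j\<leftarrow>js. \<psi> \<mu> j) = exp (- (\<integral>x. (\<Sum>j\<leftarrow>js. \<phi> j x) \<partial>\<mu>))"
    if \<mu>: "\<mu> \<in> point_measures E" for js \<mu>
  proof (induction js)
    case (Cons j js)
    have "(\<integral>x. (\<Sum>j\<leftarrow>j # js. \<phi> j x) \<partial>\<mu>) = (\<integral>x. \<phi> j x \<partial>\<mu>) + (\<integral>x. (\<Sum>j\<leftarrow>js. \<phi> j x) \<partial>\<mu>)"
      using Cc0_integrable[OF point_measures_radon[OF \<mu>]] \<phi>(1) sum_Cc0
      by (subst Bochner_Integration.integral_add[symmetric]) auto
    then show ?case using Cons by (simp add: \<psi>_def mult_exp_exp)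
  qed simp
  have "\<forall>\<^sub>F n in sequentially.
    measure P {\<omega> \<in> space P. \<psi> (Z \<omega>) \<in> W} - e < measure M {\<omega> \<in> space M. \<psi> (Y n \<omega>) \<in> W}"
  proof (rule open_set_lower_bound_of_moments[OF M P])
    show "(\<lambda>\<omega>. \<psi> (Y n \<omega>)) \<in> borel_measurable M" for n
      unfolding \<psi>_def using vague_integral_measurable[OF Y \<phi>(1)]
      by (intro measurable_coordinatewise_then_product borel_measurable_exp_uminus)
    show "(\<lambda>\<omega>. \<psi> (Z \<omega>)) \<in> borel_measurable P"
      unfolding \<psi>_def using vague_integral_measurable[OF Z \<phi>(1)]
      by (intro measurable_coordinatewise_then_product borel_measurable_exp_uminus)
    fix js :: "nat list"
    have "(\<lambda>n. \<integral>\<omega>. exp (- (\<integral>x. (\<Sum>j\<leftarrow>js. \<phi> j x) \<partial>Y n \<omega>)) \<partial>M) \<longlonglongrightarrow>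
        (\<integral>\<omega>. exp (- (\<integral>x. (\<Sum>j\<leftarrow>js. \<phi> j x) \<partial>Z \<omega>)) \<partial>P)"
      using sum_Cc0 \<phi>(2) by (intro laplace) (auto intro!: sum_list_nonneg)
    moreover have "(\<integral>\<omega>. (\<Prod>j\<leftarrow>js. \<psi> (Y n \<omega>) j) \<partial>M) =
        (\<integral>\<omega>. exp (- (\<integral>x. (\<Sum>j\<leftarrow>js. \<phi> j x) \<partial>Y n \<omega>)) \<partial>M)" for n
      using prod_eq pm by (intro Bochner_Integration.integral_cong) auto
    moreover have "(\<integral>\<omega>. (\<Prod>j\<leftarrow>js. \<psi> (Z \<omega>) j) \<partial>P) =
        (\<integral>\<omega>. exp (- (\<integral>x. (\<Sum>j\<leftarrow>js. \<phi> j x) \<partial>Z \<omega>)) \<partial>P)"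
      using prod_eq pmZ by (intro Bochner_Integration.integral_cong) auto
    ultimately show "(\<lambda>n. \<integral>\<omega>. (\<Prod>j\<leftarrow>js. \<psi> (Y n \<omega>) j) \<partial>M) \<longlonglongrightarrow>
        (\<integral>\<omega>. (\<Prod>j\<leftarrow>js. \<psi> (Z \<omega>) j) \<partial>P)" by simp
  qed (use cube W e in auto)
  moreover have "{\<omega> \<in> space P. \<psi> (Z \<omega>) \<in> W} = {\<omega> \<in> space P. Z \<omega> \<in> U}"
    using pmZ W(2) by auto
  moreover have "{\<omega> \<in> space M. \<psi> (Y n \<omega>) \<in> W} = {\<omega> \<in> space M. Y n \<omega> \<in> U}" for n
    using pm W(2) by auto
  ultimately show ?thesis by simp
qed

text \<open>Constant sequences turn the lower bound into an inequality of probabilities; exchanging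
  the roles of \<open>Y\<close> and \<open>Z\<close> gives the converse.\<close>

lemma equal_in_distribution_of_laplace:
  assumes M: "prob_space M" and P: "prob_space P"
    and Y: "Y \<in> measurable M (borel_of (vague_topology E))"
    and Z: "Z \<in> measurable P (borel_of (vague_topology E))"
    and laplace: "\<And>h. h \<in> Cc0 \<Longrightarrow> (\<And>x. 0 \<le> h x) \<Longrightarrow>
      (\<integral>\<omega>. exp (- (\<integral>x. h x \<partial>Y \<omega>)) \<partial>M) = (\<integral>\<omega>. exp (- (\<integral>x. h x \<partial>Z \<omega>)) \<partial>P)"
  shows "equal_in_distribution (vague_topology E) M Y P Z"
proof (rule equal_in_distribution_of_open_sets[OF M P Y Z])
  fix U assume U: "openin (vague_topology E) U"
  let ?y = "measure M {\<omega> \<in> space M. Y \<omega> \<in> U}" and ?z = "measure P {\<omega> \<in> space P. Z \<omega> \<in> U}"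
  have "?z - e < ?y" if "e > 0" for e
    using laplace_open_set_lower_bound[OF M P Y Z _ U that] laplace by simp
  from this[of "?z - ?y"] have "?z \<le> ?y" by (cases "?z - ?y > 0") auto
  moreover have "?y - e < ?z" if "e > 0" for e
    using laplace_open_set_lower_bound[OF P M Z Y _ U that] laplace by simp
  from this[of "?y - ?z"] have "?y \<le> ?z" by (cases "?y - ?z > 0") auto
  ultimately show "?y = ?z" by simp
qed

end

section \<open>The Laplace functional of a Poisson process\<close>

lemma tendsto_of_dist_le:
  fixes u :: "nat \<Rightarrow> real"
  assumes "\<And>k. \<bar>u k - v\<bar> \<le> c k" "c \<longlonglongrightarrow> 0"
  shows "u \<longlonglongrightarrow> v"
proof -
  have "(\<lambda>k. u k - v) \<longlonglongrightarrow> 0"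
    by (rule Lim_null_comparison[OF _ assms(2)]) (simp add: assms(1))
  then show ?thesis by (rule LIM_zero_cancel)
qed

lemma poisson_count_laplace:
  assumes P: "prob_space P" and X: "X \<in> borel_measurable P" and l: "l \<ge> 0" and t: "t \<ge> 0"
    and law: "\<And>k::nat. measure P {\<omega> \<in> space P. X \<omega> = of_nat k} = exp (- l) * l ^ k / fact k"
  shows "AE \<omega> in P. X \<omega> < (\<infinity> :: ennreal)"
    and "(\<integral>\<omega>. exp (- (t * enn2real (X \<omega>))) \<partial>P) = exp (- (l * (1 - exp (- t))))"
proof -
  interpret prob_space P by fact
  note [measurable] = X
  define A where "A k = {\<omega> \<in> space P. X \<omega> = of_nat k}" for k :: nat
  have A[measurable]: "A k \<in> sets P" for k unfolding A_def by measurable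
  have disj: "disjoint_family A" by (auto simp: disjoint_family_on_def A_def)
  \<comment> \<open>Used twice: at \<open>s = 0\<close> it shows that the finite values exhaust the
    probability, at \<open>s = t\<close> it is the Laplace transform.\<close>
  have sums: "(\<lambda>k. exp (- s * real k) * (exp (- l) * l ^ k / fact k)) sums exp (- (l * (1 - exp (- s))))" for s
  proof -
    have "(\<lambda>k. exp (- l) * ((l * exp (- s)) ^ k / fact k)) sums (exp (- l) * exp (l * exp (- s)))"
      using exp_converges[of "l * exp (- s)"] by (intro sums_mult) (simp add: divide_inverse mult.commute)
    moreover have "(\<lambda>k. exp (- l) * ((l * exp (- s)) ^ k / fact k)) =
        (\<lambda>k. exp (- s * real k) * (exp (- l) * l ^ k / fact k))"
    proof
      fix k
      have "exp (- s) ^ k = exp (- s * real k)"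
        by (simp add: exp_of_nat_mult[symmetric] mult.commute)
      then show "exp (- l) * ((l * exp (- s)) ^ k / fact k) = exp (- s * real k) * (exp (- l) * l ^ k / fact k)"
        by (simp add: power_mult_distrib)
    qed
    moreover have "exp (- l) * exp (l * exp (- s)) = exp (- (l * (1 - exp (- s))))"
      by (simp add: mult_exp_exp algebra_simps)
    ultimately show ?thesis by (simp only:)
  qed
  have "prob (\<Union>k. A k) = (\<Sum>k. prob (A k))"
    using finite_measure_UNION[OF _ disj] A by (simp add: sums_iff image_subset_iff)
  also have "\<dots> = 1"
    using sums[of 0] law by (simp add: A_def sums_iff)
  finally have AE: "AE \<omega> in P. \<omega> \<in> (\<Union>k. A k)"
    by (intro AE_prob_1)
  then show "AE \<omega> in P. X \<omega> < \<infinity>"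
    by eventually_elim (auto simp: A_def of_nat_less_top)
  have "(\<integral>\<^sup>+\<omega>. ennreal (exp (- (t * enn2real (X \<omega>)))) \<partial>P) =
      (\<integral>\<^sup>+\<omega>. (\<Sum>k. ennreal (exp (- t * real k)) * indicator (A k) \<omega>) \<partial>P)"
  proof (rule nn_integral_cong_AE, use AE in eventually_elim)
    fix \<omega> assume "\<omega> \<in> (\<Union>k. A k)"
    then obtain k where k: "\<omega> \<in> A k" by blast
    have "(\<Sum>j. ennreal (exp (- t * real j)) * indicator (A j) \<omega>) =
        (\<Sum>j\<in>{k}. ennreal (exp (- t * real j)) * indicator (A j) \<omega>)"
      using k by (intro suminf_finite) (auto simp: A_def)
    also have "\<dots> = ennreal (exp (- (t * enn2real (X \<omega>))))"
      using k by (auto simp: A_def ennreal_of_nat_eq_real_of_nat)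
    finally show "ennreal (exp (- (t * enn2real (X \<omega>)))) =
      (\<Sum>k. ennreal (exp (- t * real k)) * indicator (A k) \<omega>)" by simp
  qed
  also have "\<dots> = (\<Sum>k. \<integral>\<^sup>+\<omega>. ennreal (exp (- t * real k)) * indicator (A k) \<omega> \<partial>P)"
    by (rule nn_integral_suminf) measurable
  also have "\<dots> = (\<Sum>k. ennreal (exp (- t * real k) * (exp (- l) * l ^ k / fact k)))"
    using l by (intro suminf_cong)
      (simp add: nn_integral_cmult_indicator emeasure_eq_measure A_def law flip: ennreal_mult')
  also have "\<dots> = ennreal (exp (- (l * (1 - exp (- t)))))"
    using l by (intro suminf_ennreal_eq sums) auto
  finally show "(\<integral>\<omega>. exp (- (t * enn2real (X \<omega>))) \<partial>P) = exp (- (l * (1 - exp (- t))))"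
    by (subst integral_eq_nn_integral) auto
qed

lemma poisson_process_laplace_simple:
  assumes pp: "poisson_process P E \<nu> N" and J: "finite (J :: nat set)"
    and B: "\<And>j. j \<in> J \<Longrightarrow> B j \<in> sets \<nu>" "\<And>j. j \<in> J \<Longrightarrow> emeasure \<nu> (B j) < \<infinity>" "disjoint_family_on B J"
    and t: "\<And>j. j \<in> J \<Longrightarrow> t j \<ge> 0"
  shows "(\<integral>\<omega>. exp (- (\<Sum>j\<in>J. t j * measure (N \<omega>) (B j))) \<partial>P) =
    exp (- (\<Sum>j\<in>J. measure \<nu> (B j) * (1 - exp (- t j))))"
proof -
  interpret prob_space P using pp by (simp add: poisson_process_def)
  have indep: "indep_vars (\<lambda>_. borel) (\<lambda>j \<omega>. emeasure (N \<omega>) (B j)) J"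
    using pp J B by (auto simp: poisson_process_def)
  then have meas[measurable]: "j \<in> J \<Longrightarrow> (\<lambda>\<omega>. emeasure (N \<omega>) (B j)) \<in> borel_measurable P" for j
    by (auto simp: indep_vars_def)
  have "indep_vars (\<lambda>_. borel) (\<lambda>j \<omega>. exp (- (t j * enn2real (emeasure (N \<omega>) (B j))))) J"
    by (rule indep_vars_compose2[OF indep]) measurable
  note indep_exp = indep_vars_lebesgue_integral[OF J this]
  have int: "integrable P (\<lambda>\<omega>. exp (- (t j * enn2real (emeasure (N \<omega>) (B j)))))" if "j \<in> J" for j
    using meas[OF that] t[OF that] by (intro integrable_const_bound[of _ 1] AE_I2) auto
  have "(\<integral>\<omega>. exp (- (\<Sum>j\<in>J. t j * measure (N \<omega>) (B j))) \<partial>P) =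
      (\<integral>\<omega>. (\<Prod>j\<in>J. exp (- (t j * enn2real (emeasure (N \<omega>) (B j))))) \<partial>P)"
    using J by (simp add: measure_def exp_sum flip: sum_negf)
  also have "\<dots> = (\<Prod>j\<in>J. \<integral>\<omega>. exp (- (t j * enn2real (emeasure (N \<omega>) (B j)))) \<partial>P)"
    using indep_exp int by simp
  also have "\<dots> = (\<Prod>j\<in>J. exp (- (measure \<nu> (B j) * (1 - exp (- t j)))))"
  proof (rule prod.cong[OF refl])
    fix j assume j: "j \<in> J"
    show "(\<integral>\<omega>. exp (- (t j * enn2real (emeasure (N \<omega>) (B j)))) \<partial>P) =
        exp (- (measure \<nu> (B j) * (1 - exp (- t j))))"
      using pp B(1,2)[OF j] t[OF j] meas[OF j]
      by (intro poisson_count_laplace(2) prob_space_axioms) (auto simp: poisson_process_def)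
  qed
  also have "\<dots> = exp (- (\<Sum>j\<in>J. measure \<nu> (B j) * (1 - exp (- t j))))"
    using J by (simp add: exp_sum flip: sum_negf)
  finally show ?thesis .
qed

text \<open>\<open>g\<close> is rounded down to multiples of \<open>1 / (k + 1)\<close>, which
  reduces to finitely many disjoint sets. The rounding error lives on the set \<open>G\<close> where
  \<open>g\<close> is nonzero; the intensity of \<open>G\<close> is finite, hence so is its count
  almost surely. Measurability of \<open>g\<close> is assumed instead of continuity, so that the
  lemma serves both test functions and the function \<open>- ln G\<close> of arrival times in
  \<open>series_laplace\<close>.\<close>

lemma poisson_process_laplace:
  fixes g :: "'a::topological_space \<Rightarrow> real"
  assumes pp: "poisson_process P E \<nu> N"
    and sets: "\<And>\<omega>. \<omega> \<in> space P \<Longrightarrow> sets (N \<omega>) = sets \<nu>"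
    and g: "g \<in> borel_measurable \<nu>" "\<And>x. x \<in> space \<nu> \<Longrightarrow> 0 \<le> g x" "\<And>x. x \<in> space \<nu> \<Longrightarrow> g x \<le> b"
    and fin: "emeasure \<nu> {x \<in> space \<nu>. g x \<noteq> 0} < \<infinity>"
    and meas: "(\<lambda>\<omega>. \<integral>x. g x \<partial>N \<omega>) \<in> borel_measurable P"
  shows "(\<integral>\<omega>. exp (- (\<integral>x. g x \<partial>N \<omega>)) \<partial>P) = exp (- (\<integral>x. 1 - exp (- g x) \<partial>\<nu>))"
proof -
  interpret prob_space P using pp by (simp add: poisson_process_def)
  define G where "G = {x \<in> space \<nu>. g x \<noteq> 0}"
  note [measurable] = g(1)
  have G[measurable]: "G \<in> sets \<nu>" unfolding G_def by measurable
  define B where "B k j = {x \<in> G. \<lfloor>real (Suc k) * g x\<rfloor> = int j}" for k j :: nat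
  have B[measurable]: "B k j \<in> sets \<nu>" for k j
  proof -
    have "B k j = {x \<in> space \<nu>. g x \<noteq> 0 \<and> \<lfloor>real (Suc k) * g x\<rfloor> = int j}" by (auto simp: B_def G_def)
    also have "\<dots> \<in> sets \<nu>" by measurable
    finally show ?thesis .
  qed
  define J where "J k = {..nat \<lfloor>real (Suc k) * b\<rfloor>}" for k
  have disj: "disjoint_family_on (B k) (J k)" for k by (auto simp: disjoint_family_on_def B_def)
  have BG: "B k j \<subseteq> G" for k j by (auto simp: B_def)
  define gk where "gk k x = (\<Sum>j\<in>J k. real j / real (Suc k) * indicator (B k j) x)" for k x
  have gk: "gk k x = (if x \<in> G then real (nat \<lfloor>real (Suc k) * g x\<rfloor>) / real (Suc k) else 0)"
    if x: "x \<in> space \<nu>" for k x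
  proof (cases "x \<in> G")
    case True
    define i where "i = nat \<lfloor>real (Suc k) * g x\<rfloor>"
    have nn: "0 \<le> \<lfloor>real (Suc k) * g x\<rfloor>" using g(2)[OF x] by simp
    have "i \<in> J k" unfolding i_def J_def using g(3)[OF x]
      by (auto intro!: nat_mono floor_mono mult_left_mono)
    have "gk k x = (\<Sum>j\<in>J k. if j = i then real i / real (Suc k) else 0)"
      unfolding gk_def using True nn by (intro sum.cong) (auto simp: B_def i_def indicator_def)
    also have "\<dots> = real i / real (Suc k)" using \<open>i \<in> J k\<close> by (simp add: J_def)
    finally show ?thesis using True by (simp add: i_def)
  next
    case False
    then have "indicator (B k j) x = (0 :: real)" for j
      using BG[of k j] by (auto simp: indicator_def)
    then show ?thesis using False by (simp add: gk_def)
  qed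
  have gk_close: "\<bar>gk k x - g x\<bar> \<le> 1 / real (Suc k) * indicator G x" if x: "x \<in> space \<nu>" for k x
  proof (cases "x \<in> G")
    case True
    have nn: "0 \<le> \<lfloor>real (Suc k) * g x\<rfloor>" using g(2)[OF x] by simp
    have "\<bar>real (nat \<lfloor>real (Suc k) * g x\<rfloor>) - real (Suc k) * g x\<bar> \<le> 1"
      using nn by (simp add: of_nat_nat) linarith
    then have "\<bar>real (nat \<lfloor>real (Suc k) * g x\<rfloor>) - real (Suc k) * g x\<bar> / real (Suc k) \<le> 1 / real (Suc k)"
      by (intro divide_right_mono) auto
    moreover have "gk k x - g x = (real (nat \<lfloor>real (Suc k) * g x\<rfloor>) - real (Suc k) * g x) / real (Suc k)"
      using True x by (simp add: gk diff_divide_distrib)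
    ultimately show ?thesis using True by (simp add: abs_divide)
  next
    case False
    then show ?thesis using x by (simp add: gk G_def)
  qed
  have gk_nonneg: "0 \<le> gk k x" for k x by (auto simp: gk_def intro!: sum_nonneg)
  have eq_gk: "(\<integral>x. gk k x \<partial>\<mu>) = (\<Sum>j\<in>J k. real j / real (Suc k) * measure \<mu> (B k j))"
    and lim_gk: "(\<lambda>k. \<integral>x. gk k x \<partial>\<mu>) \<longlonglongrightarrow> (\<integral>x. g x \<partial>\<mu>)"
    if \<mu>: "sets \<mu> = sets \<nu>" "emeasure \<mu> G < \<infinity>" for \<mu> k
  proof -
    have sp: "space \<mu> = space \<nu>" using sets_eq_imp_space_eq[OF \<mu>(1)] .
    have gm: "g \<in> borel_measurable \<mu>" using g(1) measurable_cong_sets[OF \<mu>(1) refl] by blast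
    have Bm: "B k j \<in> sets \<mu>" and Gm: "G \<in> sets \<mu>" for k j using B G \<mu>(1) by auto
    have Bfin: "emeasure \<mu> (B k j) < \<infinity>" for k j
      using emeasure_mono[OF BG Gm] \<mu>(2) by (meson order.strict_trans1)
    have ig: "integrable \<mu> g"
      using gm Gm \<mu>(2) g(2,3) sp
      by (intro integrableI_bounded_set[where A = G and B = b] AE_I2) (auto simp: G_def)
    have igk: "integrable \<mu> (gk k)" for k
      unfolding gk_def using Bm Bfin by auto
    show "(\<integral>x. gk k x \<partial>\<mu>) = (\<Sum>j\<in>J k. real j / real (Suc k) * measure \<mu> (B k j))"
      unfolding gk_def using Bm Bfin by (subst Bochner_Integration.integral_sum) auto
    have "\<bar>(\<integral>x. gk k x \<partial>\<mu>) - (\<integral>x. g x \<partial>\<mu>)\<bar> \<le> 1 / real (Suc k) * measure \<mu> G" for k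
    proof -
      have "\<bar>(\<integral>x. gk k x \<partial>\<mu>) - (\<integral>x. g x \<partial>\<mu>)\<bar> = \<bar>\<integral>x. gk k x - g x \<partial>\<mu>\<bar>"
        using ig igk by simp
      also have "\<dots> \<le> (\<integral>x. \<bar>gk k x - g x\<bar> \<partial>\<mu>)" by (rule integral_abs_bound)
      also have "\<dots> \<le> (\<integral>x. 1 / real (Suc k) * indicator G x \<partial>\<mu>)"
        using ig igk Gm \<mu>(2) gk_close sp by (intro integral_mono) auto
      finally show ?thesis using Gm by simp
    qed
    moreover have "(\<lambda>k. 1 / real (Suc k) * measure \<mu> G) \<longlonglongrightarrow> 0"
      using tendsto_mult_left_zero[OF LIMSEQ_Suc[OF lim_1_over_n]] by simp
    ultimately show "(\<lambda>k. \<integral>x. gk k x \<partial>\<mu>) \<longlonglongrightarrow> (\<integral>x. g x \<partial>\<mu>)"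
      by (rule tendsto_of_dist_le)
  qed
  \<comment> \<open>Independence of a family includes measurability of its members; a family with
    one index isolates the count of \<open>A\<close>.\<close>
  have Nmeas: "(\<lambda>\<omega>. emeasure (N \<omega>) A) \<in> borel_measurable P" if "A \<in> sets \<nu>" for A
  proof -
    have "indep_vars (\<lambda>_. borel) (\<lambda>j \<omega>. emeasure (N \<omega>) ((\<lambda>_. A) j)) {0::nat}"
      using pp that by (auto simp: poisson_process_def disjoint_family_on_def)
    then show ?thesis by (auto simp: indep_vars_def)
  qed
  have Nfin: "AE \<omega> in P. emeasure (N \<omega>) G < \<infinity>"
    using pp Nmeas[OF G] G fin unfolding G_def[symmetric]
    by (intro poisson_count_laplace(1)[where l = "measure \<nu> G" and t = 0] prob_space_axioms) (auto simp: poisson_process_def)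
  have step: "(\<integral>\<omega>. exp (- (\<Sum>j\<in>J k. real j / real (Suc k) * measure (N \<omega>) (B k j))) \<partial>P) =
      exp (- (\<integral>x. 1 - exp (- gk k x) \<partial>\<nu>))" for k
  proof -
    have Bfin: "emeasure \<nu> (B k j) < \<infinity>" for j
      using emeasure_mono[OF BG G] fin unfolding G_def[symmetric] by (meson order.strict_trans1)
    have "(\<integral>\<omega>. exp (- (\<Sum>j\<in>J k. real j / real (Suc k) * measure (N \<omega>) (B k j))) \<partial>P) =
        exp (- (\<Sum>j\<in>J k. measure \<nu> (B k j) * (1 - exp (- (real j / real (Suc k))))))"
      using Bfin disj by (intro poisson_process_laplace_simple[OF pp]) (auto simp: J_def)
    also have "(\<Sum>j\<in>J k. measure \<nu> (B k j) * (1 - exp (- (real j / real (Suc k))))) =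
        (\<integral>x. (\<Sum>j\<in>J k. (1 - exp (- (real j / real (Suc k)))) * indicator (B k j) x) \<partial>\<nu>)"
      using Bfin by (subst Bochner_Integration.integral_sum) (auto simp: mult.commute)
    also have "\<dots> = (\<integral>x. 1 - exp (- gk k x) \<partial>\<nu>)"
    proof (rule Bochner_Integration.integral_cong[OF refl])
      fix x assume x: "x \<in> space \<nu>"
      show "(\<Sum>j\<in>J k. (1 - exp (- (real j / real (Suc k)))) * indicator (B k j) x) = 1 - exp (- gk k x)"
      proof (cases "\<exists>i\<in>J k. x \<in> B k i")
        case True
        then obtain i where i: "i \<in> J k" "x \<in> B k i" by blast
        have ind: "indicator (B k j) x = (if j = i then 1 else (0::real))" if "j \<in> J k" for j
          using i(2) by (auto simp: B_def indicator_def)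
        have sum_ind: "(\<Sum>j\<in>J k. c j * indicator (B k j) x) = c i" for c :: "nat \<Rightarrow> real"
        proof -
          have "(\<Sum>j\<in>J k. c j * indicator (B k j) x) = (\<Sum>j\<in>J k. if j = i then c i else 0)"
            by (intro sum.cong) (auto simp: ind)
          then show ?thesis using i(1) by (simp add: J_def)
        qed
        show ?thesis
          unfolding gk_def sum_ind[of "\<lambda>j. 1 - exp (- (real j / real (Suc k)))"]
            sum_ind[of "\<lambda>j. real j / real (Suc k)"] ..
      next
        case False
        then show ?thesis by (auto simp: gk_def intro!: sum.neutral)
      qed
    qed
    finally show ?thesis .
  qed
  have rhs: "(\<lambda>k. exp (- (\<integral>x. 1 - exp (- gk k x) \<partial>\<nu>))) \<longlonglongrightarrow> exp (- (\<integral>x. 1 - exp (- g x) \<partial>\<nu>))"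
  proof (intro tendsto_intros integral_dominated_convergence[where w = "\<lambda>x. indicator G x"])
    show "integrable \<nu> (\<lambda>x. indicator G x :: real)" using fin G by (simp add: G_def)
    show "AE x in \<nu>. (\<lambda>k. 1 - exp (- gk k x)) \<longlonglongrightarrow> 1 - exp (- g x)"
    proof (rule AE_I2)
      fix x assume x: "x \<in> space \<nu>"
      have "(\<lambda>k. 1 / real (Suc k) * indicator G x) \<longlonglongrightarrow> 0"
        using tendsto_mult_left_zero[OF LIMSEQ_Suc[OF lim_1_over_n]] by simp
      then have "(\<lambda>k. gk k x) \<longlonglongrightarrow> g x"
        using gk_close[OF x]
        by (rule tendsto_of_dist_le[rotated])
      then show "(\<lambda>k. 1 - exp (- gk k x)) \<longlonglongrightarrow> 1 - exp (- g x)" by (intro tendsto_intros)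
    qed
    show "AE x in \<nu>. norm (1 - exp (- gk k x)) \<le> indicator G x" for k
      using gk_nonneg by (intro AE_I2) (auto simp: gk indicator_def)
  qed (unfold gk_def, measurable)
  have lhs: "(\<lambda>k. \<integral>\<omega>. exp (- (\<Sum>j\<in>J k. real j / real (Suc k) * measure (N \<omega>) (B k j))) \<partial>P) \<longlonglongrightarrow>
      (\<integral>\<omega>. exp (- (\<integral>x. g x \<partial>N \<omega>)) \<partial>P)"
  proof (intro integral_dominated_convergence[where w = "\<lambda>_. 1"])
    show "(\<lambda>\<omega>. exp (- (\<Sum>j\<in>J k. real j / real (Suc k) * measure (N \<omega>) (B k j)))) \<in> borel_measurable P" for k
      unfolding measure_def using Nmeas[OF B] by measurable
    show "AE \<omega> in P. (\<lambda>k. exp (- (\<Sum>j\<in>J k. real j / real (Suc k) * measure (N \<omega>) (B k j))))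
        \<longlonglongrightarrow> exp (- (\<integral>x. g x \<partial>N \<omega>))"
      using Nfin AE_space
    proof eventually_elim
      case (elim \<omega>)
      then show ?case
        using lim_gk[OF sets[OF elim(2)] elim(1)] eq_gk[OF sets[OF elim(2)] elim(1)]
        by (intro tendsto_intros) simp
    qed
    show "AE \<omega> in P. norm (exp (- (\<Sum>j\<in>J k. real j / real (Suc k) * measure (N \<omega>) (B k j)))) \<le> 1" for k
      by (intro AE_I2) (auto intro!: sum_nonneg)
  qed (use meas in auto)
  show ?thesis by (rule LIMSEQ_unique[OF lhs[unfolded step] rhs])
qed

section \<open>Radon measures and counting measures\<close>

lemma scale_measure_eq_density:
  "scale_measure r M = density M (\<lambda>_. r)"
  by (rule measure_eqI) (auto simp: emeasure_density nn_integral_cmult_indicator)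

lemma integral_scale_measure:
  fixes h :: "'a \<Rightarrow> real"
  assumes "h \<in> borel_measurable M" "r \<ge> 0"
  shows "(\<integral>x. h x \<partial>scale_measure (ennreal r) M) = r * (\<integral>x. h x \<partial>M)"
  unfolding scale_measure_eq_density using assms by (subst integral_density) auto

lemma space_counting[simp]: "space (counting_measure E I x) = E"
  and sets_counting: "sets (counting_measure E I x) = sets (restrict_space borel E)"
  by (auto simp: counting_measure_def space_restrict_space)

lemma counting_map_measurable:
  "x \<in> measurable (count_space {i \<in> I. x i \<in> E}) (restrict_space borel E)"
  by (auto simp: space_restrict_space)

lemma emeasure_counting:
  assumes "A \<in> sets (restrict_space borel E)"
  shows "emeasure (counting_measure E I x) A = emeasure (count_space UNIV) {i \<in> I. x i \<in> A}"
proof -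
  have AE: "A \<subseteq> E" using sets.sets_into_space[OF assms] by (simp add: space_restrict_space)
  have "emeasure (counting_measure E I x) A =
      emeasure (count_space {i \<in> I. x i \<in> E}) (x -` A \<inter> {i \<in> I. x i \<in> E})"
    unfolding counting_measure_def
    using assms counting_map_measurable[of x I] by (subst emeasure_distr) auto
  also have "x -` A \<inter> {i \<in> I. x i \<in> E} = {i \<in> I. x i \<in> A}" using AE by auto
  also have "emeasure (count_space {i \<in> I. x i \<in> E}) {i \<in> I. x i \<in> A} =
      emeasure (count_space UNIV) {i \<in> I. x i \<in> A}"
    by (subst (1 2) emeasure_count_space) (use AE in auto)
  finally show ?thesis .
qed

lemma integral_counting_measure:
  fixes h :: "'a::topological_space \<Rightarrow> real"
  assumes h: "h \<in> borel_measurable (restrict_space borel E)"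
    and J: "finite J" "J \<subseteq> I" "\<And>i. i \<in> I \<Longrightarrow> x i \<in> E \<Longrightarrow> h (x i) \<noteq> 0 \<Longrightarrow> i \<in> J"
      "\<And>i. i \<in> J \<Longrightarrow> x i \<notin> E \<Longrightarrow> h (x i) = 0"
  shows "(\<integral>y. h y \<partial>counting_measure E I x) = (\<Sum>i\<in>J. h (x i))"
proof -
  have sub: "{i \<in> {i \<in> I. x i \<in> E}. h (x i) \<noteq> 0} \<subseteq> J" using J by auto
  have "(\<integral>y. h y \<partial>counting_measure E I x) = (\<integral>i. h (x i) \<partial>count_space {i \<in> I. x i \<in> E})"
    unfolding counting_measure_def by (rule integral_distr[OF counting_map_measurable h])
  also have "\<dots> = (\<Sum>i | i \<in> {i \<in> I. x i \<in> E} \<and> h (x i) \<noteq> 0. h (x i))"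
    using finite_subset[OF sub J(1)] by (intro lebesgue_integral_count_space_finite_support) auto
  also have "\<dots> = (\<Sum>i\<in>J. h (x i))"
    using sub J by (intro sum.mono_neutral_left) auto
  finally show ?thesis .
qed

context level_space
begin

text \<open>The distance to the complement is taken after \<open>\<Psi>\<close>; by compactness the
  image of \<open>- U\<close> is closed, and injectivity keeps points of \<open>U\<close> off it.
  The factor \<open>bump\<close>, equal to 1 on \<open>U\<close>, supplies membership in
  \<open>Cc0\<close>. The case \<open>U = UNIV\<close> is separate because the distance to the empty
  set is 0 by convention.\<close>

lemma open_indicator_approx:
  assumes U: "open U" "r > 0" "\<And>x. x \<in> U \<Longrightarrow> ennreal r \<le> f x"
  obtains h :: "nat \<Rightarrow> 'a \<Rightarrow> real"
  where "\<And>k. h k \<in> Cc0" "\<And>k x. 0 \<le> h k x" "\<And>k x. h k x \<le> indicator U x"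
    "\<And>x. (\<lambda>k. h k x) \<longlonglongrightarrow> indicator U x"
proof (cases "U = UNIV")
  case True
  have "bump (r / 2) r x = 1" for x using U True by (intro bump_eq_1) auto
  moreover have "bump (r / 2) r \<in> Cc0" using U(2) by (intro bump_Cc0) auto
  ultimately show ?thesis using True by (intro that[of "\<lambda>_. bump (r / 2) r"]) auto
next
  case False
  define C where "C = \<Psi> ` (- U)"
  have "compact (- U)" using U(1) compact_Int_closed[OF compact_space, of "- U"] by (simp add: closed_Compl)
  then have C: "closed C" "C \<noteq> {}"
    using False Psi_cont unfolding C_def
    by (auto intro!: compact_imp_closed compact_continuous_image intro: continuous_on_subset)
  define h where "h k x = min 1 (real k * infdist (\<Psi> x) C) * bump (r / 2) r x" for k :: nat and x
  have zero: "h k x = 0" if "x \<notin> U" for k x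
    using that by (simp add: h_def C_def)
  have h01: "0 \<le> h k x" "h k x \<le> 1" for k x
    using bump_nonneg[of "r / 2" r x] bump_le_1[of "r / 2" r x]
    by (auto simp: h_def infdist_nonneg intro!: mult_le_one)
  have cont: "continuous_on UNIV (\<lambda>x. min 1 (real k * infdist (\<Psi> x) C))" for k
    using Psi_cont by (intro continuous_intros)
  show ?thesis
  proof (rule that[of h])
    show "h k \<in> Cc0" for k
      unfolding h_def[abs_def] using U(2) by (intro Cc0_mult cont bump_Cc0) auto
    show "0 \<le> h k x" "h k x \<le> indicator U x" for k x
      using h01 zero by (auto simp: indicator_def)
    show "(\<lambda>k. h k x) \<longlonglongrightarrow> indicator U x" for x
    proof (cases "x \<in> U")
      case True
      then have "\<Psi> x \<notin> C" using Psi_inj by (auto simp: C_def dest: injD)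
      then have d: "infdist (\<Psi> x) C > 0"
        using C by (metis in_closed_iff_infdist_zero infdist_nonneg order_less_le)
      obtain k0 :: nat where "1 < real k0 * infdist (\<Psi> x) C"
        using reals_Archimedean3[OF d] by blast
      then have "1 < real k * infdist (\<Psi> x) C" if "k \<ge> k0" for k
        using that d by (smt (verit) mult_right_mono of_nat_le_iff)
      moreover have "bump (r / 2) r x = 1" using U True by (intro bump_eq_1) auto
      ultimately have "\<forall>\<^sub>F k in sequentially. h k x = 1"
        unfolding h_def eventually_sequentially by (intro exI[of _ k0]) auto
      then show ?thesis using True by (simp add: tendsto_eventually)
    qed (simp add: zero)
  qed
qed

lemma E_level:
  assumes "x \<in> E"
  shows "\<exists>m::nat. ennreal (1 / (real m + 1)) < f x"
proof -
  obtain r where r: "r > 0" "ennreal r \<le> f x"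
    using compact_subset_level[of "{x}"] assms by auto
  obtain m :: nat where "1 / (real m + 1) < r"
    using r(1) by (metis add.commute nat_approx_posE of_nat_Suc)
  then have "ennreal (1 / (real m + 1)) < ennreal r" by (intro ennreal_lessI r)
  then show ?thesis using r(2) by (meson less_le_trans)
qed

lemma E_eq_levels: "(\<Union>m::nat. {x. f x > ennreal (1 / (real m + 1))}) = E"
proof
  show "E \<subseteq> (\<Union>m::nat. {x. f x > ennreal (1 / (real m + 1))})"
    using E_level by blast
qed (auto simp: not_less_zero)

lemma sets_restrict_E: "A \<in> sets (restrict_space borel E) \<longleftrightarrow> A \<in> sets borel \<and> A \<subseteq> E"
  by (subst sets_restrict_space_iff) auto

lemma level_set_subset_E:
  assumes "r > 0" "\<forall>x\<in>U. ennreal r \<le> f x"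
  shows "U \<subseteq> E"
proof
  fix x assume "x \<in> U"
  then have "ennreal r \<le> f x" using assms by blast
  moreover have "0 < ennreal r" using assms by simp
  ultimately show "x \<in> E" by (metis (mono_tags, lifting) ComplI leD mem_Collect_eq)
qed

lemma level_generator:
  "{x. f x > ennreal (1 / (real m + 1))} \<in> {U. open U \<and> (\<exists>r>0. \<forall>x\<in>U. ennreal r \<le> f x)}"
proof -
  have "\<forall>x\<in>{x. f x > ennreal (1 / (real m + 1))}. ennreal (1 / (real m + 1)) \<le> f x"
    by (auto intro: less_imp_le)
  moreover have "0 < 1 / (real m + 1)" by simp
  ultimately show ?thesis using open_f_greater by blast
qed

text \<open>Generating sets are kept at positive level because there every Radon measure is finite
  and indicators are limits of test functions. Every open subset of \<open>E\<close> is the union of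
  its intersections with \<open>{f > 1 / (m + 1)}\<close>.\<close>

lemma sets_restrict_borel_E:
  "sets (restrict_space borel E) = sigma_sets E {U. open U \<and> (\<exists>r>0. \<forall>x\<in>U. ennreal r \<le> f x)}"
  (is "_ = sigma_sets E ?G")
proof
  show "sigma_sets E ?G \<subseteq> sets (restrict_space borel E)"
  proof (rule sets.sigma_sets_subset')
    show "?G \<subseteq> sets (restrict_space borel E)"
      using level_set_subset_E by (auto simp del: Compl_iff simp: sets_restrict_E)
    show "E \<in> sets (restrict_space borel E)"
      by (simp add: sets_restrict_E)
  qed
  have "sets (restrict_space borel E) = (\<inter>) E ` sigma_sets UNIV {S. open S}"
    by (simp add: sets_restrict_space borel_def)
  also have "\<dots> = sigma_sets E ((\<inter>) E ` {S. open S})"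
    by (rule sigma_sets_Int) (use open_E in auto)
  also have "\<dots> \<subseteq> sigma_sets E ?G"
  proof (rule sigma_sets_mono)
    show "(\<inter>) E ` {S. open S} \<subseteq> sigma_sets E ?G"
    proof
      fix V assume "V \<in> (\<inter>) E ` {S. open S}"
      then obtain S where S: "open S" "V = E \<inter> S" by auto
      have V: "V = (\<Union>m::nat. S \<inter> {x. f x > ennreal (1 / (real m + 1))})"
        unfolding S(2) E_eq_levels[symmetric] by blast
      have "S \<inter> {x. f x > ennreal (1 / (real m + 1))} \<in> ?G" for m :: nat
        using level_generator[of m] S(1) by blast
      then show "V \<in> sigma_sets E ?G"
        unfolding V by (intro sigma_sets.Union sigma_sets.Basic)
    qed
  qed
  finally show "sets (restrict_space borel E) \<subseteq> sigma_sets E ?G" .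
qed

text \<open>Dominated convergence along \<open>open_indicator_approx\<close> passes from test
  functions to the open sets at positive level, which form an intersection-stable generator.\<close>

lemma radon_measure_eqI:
  assumes \<mu>: "radon_measure_on E \<mu>" and \<nu>: "radon_measure_on E \<nu>"
    and eq: "\<And>h. h \<in> Cc0 \<Longrightarrow> (\<And>x. 0 \<le> h x) \<Longrightarrow> (\<integral>x. h x \<partial>\<mu>) = (\<integral>x. h x \<partial>\<nu>)"
  shows "\<mu> = \<nu>"
proof (rule measure_eqI_generator_eq[where E = "{U. open U \<and> (\<exists>r>0. \<forall>x\<in>U. ennreal r \<le> f x)}"
      and \<Omega> = E and A = "\<lambda>m. {x. f x > ennreal (1 / (real m + 1))}"])
  show "Int_stable {U. open U \<and> (\<exists>r>0. \<forall>x\<in>U. ennreal r \<le> f x)}"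
    by (auto simp: Int_stable_def)
  show "{U. open U \<and> (\<exists>r>0. \<forall>x\<in>U. ennreal r \<le> f x)} \<subseteq> Pow E"
    using level_set_subset_E by blast
  show "sets \<mu> = sigma_sets E {U. open U \<and> (\<exists>r>0. \<forall>x\<in>U. ennreal r \<le> f x)}"
    "sets \<nu> = sigma_sets E {U. open U \<and> (\<exists>r>0. \<forall>x\<in>U. ennreal r \<le> f x)}"
    using radon_sets[OF \<mu>] radon_sets[OF \<nu>] sets_restrict_borel_E by auto
  show "range (\<lambda>m. {x. f x > ennreal (1 / (real m + 1))}) \<subseteq> {U. open U \<and> (\<exists>r>0. \<forall>x\<in>U. ennreal r \<le> f x)}"
    using level_generator by blast
  show "(\<Union>m. {x. f x > ennreal (1 / (real m + 1))}) = E" by (rule E_eq_levels)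
  have fin: "emeasure \<mu>' U < \<infinity>" "U \<in> sets \<mu>'"
    if \<mu>': "radon_measure_on E \<mu>'" and U: "open U" "r > 0" "\<forall>x\<in>U. ennreal r \<le> f x" for \<mu>' U r
  proof -
    have "U \<subseteq> {x. f x \<ge> ennreal r}" using U by auto
    then show "emeasure \<mu>' U < \<infinity>"
      using radon_level_finite[OF \<mu>' U(2)] sets_radon_level[OF \<mu>' U(2)] emeasure_mono
      by (meson order.strict_trans1)
    show "U \<in> sets \<mu>'"
      using U level_set_subset_E[OF U(2,3)] by (intro sets_radon[OF \<mu>']) auto
  qed
  show "emeasure \<mu> {x. f x > ennreal (1 / (real m + 1))} \<noteq> \<infinity>" for m
    using fin(1)[OF \<mu> open_f_greater, of "1 / (real m + 1)" "ennreal (1 / (real m + 1))"]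
    by (simp add: less_imp_le less_top)
  fix U assume "U \<in> {U. open U \<and> (\<exists>r>0. \<forall>x\<in>U. ennreal r \<le> f x)}"
  then obtain r where U: "open U" "r > 0" "\<forall>x\<in>U. ennreal r \<le> f x" by blast
  obtain h :: "nat \<Rightarrow> 'a \<Rightarrow> real"
    where h: "\<And>k. h k \<in> Cc0" "\<And>k x. 0 \<le> h k x" "\<And>k x. h k x \<le> indicator U x"
    "\<And>x. (\<lambda>k. h k x) \<longlonglongrightarrow> indicator U x"
    using open_indicator_approx[OF U(1,2)] U(3) by blast
  have lim: "(\<lambda>k. \<integral>x. h k x \<partial>\<mu>') \<longlonglongrightarrow> measure \<mu>' U" if \<mu>': "radon_measure_on E \<mu>'" for \<mu>'
  proof -
    note Um = fin[OF \<mu>' U]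
    have "(\<lambda>k. \<integral>x. h k x \<partial>\<mu>') \<longlonglongrightarrow> (\<integral>x. indicator U x \<partial>\<mu>')"
    proof (rule integral_dominated_convergence[where w = "indicator U"])
      show "h k \<in> borel_measurable \<mu>'" for k
        using radon_measurable[OF \<mu>' Cc0_measurable[OF h(1)]] .
    qed (use Um h in auto)
    then show ?thesis using Um by simp
  qed
  have "measure \<mu> U = measure \<nu> U"
    using LIMSEQ_unique[OF lim[OF \<mu>]] lim[OF \<nu>] eq[OF h(1,2)] by simp
  then show "emeasure \<mu> U = emeasure \<nu> U"
    using fin(1)[OF \<mu> U] fin(1)[OF \<nu> U] by (simp add: emeasure_eq_ennreal_measure less_top)
qed

lemma counting_point_measure:
  fixes I :: "nat set"
  assumes "\<And>r. r > 0 \<Longrightarrow> finite {i \<in> I. ennreal r \<le> f (x i)}"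
  shows "counting_measure E I x \<in> point_measures E"
proof -
  have "emeasure (counting_measure E I x) K < \<infinity>" if K: "compact K" "K \<subseteq> E" for K
  proof -
    obtain r where r: "r > 0" "\<And>y. y \<in> K \<Longrightarrow> ennreal r \<le> f y" using compact_subset_level[OF K] by blast
    have "finite {i \<in> I. x i \<in> K}"
      by (rule finite_subset[OF _ assms[OF r(1)]]) (use r(2) in auto)
    moreover have "K \<in> sets (restrict_space borel E)"
      using K compact_imp_closed[OF K(1)] by (simp add: sets_restrict_E)
    ultimately show ?thesis by (simp add: emeasure_counting of_nat_less_top)
  qed
  then show ?thesis
    by (auto simp: point_measures_def radon_measure_on_def sets_counting)
qed

lemma integral_counting:
  assumes h: "h \<in> Cc0" and J: "finite J" "J \<subseteq> I" "\<And>i. i \<in> I \<Longrightarrow> h (x i) \<noteq> 0 \<Longrightarrow> i \<in> J"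
  shows "(\<integral>y. h y \<partial>counting_measure E I x) = (\<Sum>i\<in>J. h (x i))"
  using J Cc0_zero[OF h]
  by (intro integral_counting_measure measurable_restrict_space1 Cc0_measurable h) auto

end

section \<open>Products over independent copies and their exponential limit\<close>

lemma (in prob_space) iid_power_expectation:
  assumes indep: "indep_vars (\<lambda>_. N) X {1..}" and X0: "X0 \<in> measurable M0 N"
    and copies: "\<And>i. i \<ge> (1::nat) \<Longrightarrow> distr M N (X i) = distr M0 N X0"
    and g: "g \<in> borel_measurable N" "\<And>x. \<bar>g x\<bar> \<le> (b :: real)"
  shows "(\<integral>\<omega>. (\<Prod>i\<in>{1..n}. g (X i \<omega>)) \<partial>M) = (\<integral>\<omega>. g (X0 \<omega>) \<partial>M0) ^ n"
proof -
  have Xm: "X i \<in> measurable M N" if "i \<ge> 1" for i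
    using indep that by (auto simp: indep_vars_def)
  have "indep_vars (\<lambda>_. borel) (\<lambda>i \<omega>. g (X i \<omega>)) {1..n}"
    using indep_vars_compose2[OF indep_vars_subset[OF indep], of "{1..n}" "\<lambda>_. g" "\<lambda>_. borel"] g(1) by auto
  moreover have "integrable M (\<lambda>\<omega>. g (X i \<omega>))" if "i \<in> {1..n}" for i
    using Xm[of i] that g by (intro integrable_const_bound[of _ b] AE_I2) auto
  ultimately have "(\<integral>\<omega>. (\<Prod>i\<in>{1..n}. g (X i \<omega>)) \<partial>M) = (\<Prod>i\<in>{1..n}. \<integral>\<omega>. g (X i \<omega>) \<partial>M)"
    by (intro indep_vars_lebesgue_integral) auto
  also have "\<dots> = (\<Prod>i\<in>{1..n}. \<integral>\<omega>. g (X0 \<omega>) \<partial>M0)"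
  proof (rule prod.cong[OF refl])
    fix i assume "i \<in> {1..n}"
    then have i: "i \<ge> 1" by simp
    have "(\<integral>\<omega>. g (X i \<omega>) \<partial>M) = (\<integral>x. g x \<partial>distr M N (X i))"
      using Xm[OF i] g(1) by (simp add: integral_distr)
    also have "\<dots> = (\<integral>x. g x \<partial>distr M0 N X0)" by (simp add: copies[OF i])
    also have "\<dots> = (\<integral>\<omega>. g (X0 \<omega>) \<partial>M0)" using X0 g(1) by (simp add: integral_distr)
    finally show "(\<integral>\<omega>. g (X i \<omega>) \<partial>M) = (\<integral>\<omega>. g (X0 \<omega>) \<partial>M0)" .
  qed
  finally show ?thesis by simp
qed

text \<open>Comparison with \<open>(1 - l / n) ^ n\<close>: powers of two numbers of modulus at most
  1 differ by at most \<open>n\<close> times the difference of the bases, here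
  \<open>\<bar>x n - l\<bar>\<close>.\<close>

lemma tendsto_one_minus_over_n_power:
  fixes x :: "nat \<Rightarrow> real"
  assumes x: "x \<longlonglongrightarrow> l" and le: "\<And>n. n \<ge> 1 \<Longrightarrow> 0 \<le> x n \<and> x n \<le> real n"
  shows "(\<lambda>n. (1 - x n / real n) ^ n) \<longlonglongrightarrow> exp (- l)"
proof -
  have l: "0 \<le> l" using x le by (intro LIMSEQ_le_const[OF x]) auto
  have "(\<lambda>n. (1 + (- l) / real n) ^ n) \<longlonglongrightarrow> exp (- l)"
    by (rule tendsto_exp_limit_sequentially)
  moreover have "(\<lambda>n. (1 - x n / real n) ^ n - (1 + (- l) / real n) ^ n) \<longlonglongrightarrow> 0"
  proof (rule Lim_null_comparison)
    have "(\<lambda>n. \<bar>x n - l\<bar>) \<longlonglongrightarrow> \<bar>l - l\<bar>" by (intro tendsto_intros x)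
    then show "(\<lambda>n. \<bar>x n - l\<bar>) \<longlonglongrightarrow> 0" by simp
    \<comment> \<open>From \<open>n0\<close> on, \<open>1 - l / n\<close> lies between 0 and 1, as
      the power estimate requires.\<close>
    obtain n0 :: nat where n0: "l \<le> real n0" using real_arch_simple by blast
    have "norm ((1 - x n / real n) ^ n - (1 + (- l) / real n) ^ n) \<le> \<bar>x n - l\<bar>" if n: "n \<ge> max 1 n0" for n
    proof -
      have npos: "real n > 0" "l \<le> real n" using n n0 by auto
      have "norm ((1 - x n / real n) ^ n - (1 + (- l) / real n) ^ n) \<le>
          real n * norm ((1 - x n / real n) - (1 + (- l) / real n))"
        using le[of n] n npos l by (intro norm_power_diff) (auto simp: abs_le_iff field_simps)
      also have "(1 - x n / real n) - (1 + (- l) / real n) = (l - x n) / real n"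
        by (simp add: diff_divide_distrib)
      also have "real n * norm ((l - x n) / real n) = \<bar>x n - l\<bar>"
        using npos by (simp add: abs_minus_commute)
      finally show ?thesis .
    qed
    then show "\<forall>\<^sub>F n in sequentially. norm ((1 - x n / real n) ^ n - (1 + (- l) / real n) ^ n) \<le> \<bar>x n - l\<bar>"
      by (auto simp: eventually_sequentially intro!: exI[of _ "max 1 n0"])
  qed
  ultimately show ?thesis
    using tendsto_add[of "\<lambda>n. (1 + (- l) / real n) ^ n"] by fastforce
qed

section \<open>The extended Euclidean space\<close>

text \<open>The injection \<open>\<Psi>\<close> for \<open>ereal ^ 'd\<close>. Each coordinate
  \<open>t\<close> is recorded by \<open>1 / (1 + t)\<close> for its positive part and the same for
  its negative part; both are needed because \<open>e2ennreal\<close> maps all negative numbers to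
  0. The infinite values go to 0.\<close>

definition ereal_coordinates :: "ereal ^ 'd \<Rightarrow> (real ^ 'd) \<times> (real ^ 'd)" where
  "ereal_coordinates x = (\<chi> i. enn2real (inverse (1 + e2ennreal (x $ i))),
     \<chi> i. enn2real (inverse (1 + e2ennreal (- (x $ i)))))"

lemma inverse_one_plus_ennreal: "inverse (1 + a :: ennreal) < top"
  by (simp add: less_top[symmetric])

lemma continuous_on_enn2real_inverse:
  assumes "continuous_on S (a :: 'x::topological_space \<Rightarrow> ennreal)"
  shows "continuous_on S (\<lambda>x. enn2real (inverse (1 + a x)))"
proof -
  have c: "continuous_on S (\<lambda>x. inverse (1 + a x))"
    using assms by (intro continuous_on_inverse_ennreal continuous_on_add_ennreal continuous_on_const)
  show ?thesis
    unfolding continuous_on_def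
  proof
    fix x assume "x \<in> S"
    then have "((\<lambda>x. inverse (1 + a x)) \<longlongrightarrow> ennreal (enn2real (inverse (1 + a x)))) (at x within S)"
      using c inverse_one_plus_ennreal[of "a x"] by (simp add: continuous_on_def ennreal_enn2real)
    then show "((\<lambda>x. enn2real (inverse (1 + a x))) \<longlongrightarrow> enn2real (inverse (1 + a x))) (at x within S)"
      by (rule tendsto_enn2real) simp
  qed
qed

lemma enn2real_inverse_inject:
  assumes "enn2real (inverse (1 + a)) = enn2real (inverse (1 + b))"
  shows "a = (b :: ennreal)"
proof -
  have *: "inverse (1 + a) = ennreal (if a = top then 0 else inverse (1 + enn2real a))" for a :: ennreal
  proof (cases a)
    case (real r)
    then have e: "1 + a = ennreal (1 + r)" by (simp add: ennreal_plus)
    have "inverse (1 + a) = ennreal (inverse (1 + r))"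
      unfolding e using real by (intro inverse_ennreal) auto
    then show ?thesis using real by simp
  qed simp
  have pos: "0 < inverse (1 + enn2real x)" for x
    by (simp add: add_pos_nonneg)
  show ?thesis
    using assms pos[of a] pos[of b] unfolding *
    by (cases a; cases b) (auto split: if_splits)
qed

lemma e2ennreal_inject:
  assumes "e2ennreal x = e2ennreal y" "e2ennreal (- x) = e2ennreal (- y)"
  shows "x = y"
proof -
  have "r = s" if "ennreal r = ennreal s" "ennreal (- r) = ennreal (- s)" for r s
    using that by (cases "0 \<le> r"; cases "0 \<le> s") (auto simp: ennreal_neg ennreal_eq_0_iff eq_commute[of "0 :: ennreal"])
  then show ?thesis using assms by (cases x; cases y) (auto simp: e2ennreal_neg)
qed

lemma inj_ereal_coordinates: "inj (ereal_coordinates :: ereal ^ 'd \<Rightarrow> _)"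
proof (rule injI)
  fix x y :: "ereal ^ 'd" assume eq: "ereal_coordinates x = ereal_coordinates y"
  have "x $ i = y $ i" for i
  proof (rule e2ennreal_inject; rule enn2real_inverse_inject)
    show "enn2real (inverse (1 + e2ennreal (x $ i))) = enn2real (inverse (1 + e2ennreal (y $ i)))"
      using eq by (simp add: ereal_coordinates_def vec_eq_iff)
    show "enn2real (inverse (1 + e2ennreal (- (x $ i)))) = enn2real (inverse (1 + e2ennreal (- (y $ i))))"
      using eq by (simp add: ereal_coordinates_def vec_eq_iff)
  qed
  then show "x = y" by (simp add: vec_eq_iff)
qed

lemma continuous_on_ereal_coordinates: "continuous_on UNIV (ereal_coordinates :: ereal ^ 'd \<Rightarrow> _)"
proof -
  have 1: "continuous_on UNIV (\<lambda>x :: ereal ^ 'd. e2ennreal (x $ i))" for i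
    by (rule continuous_on_compose2[OF continuous_on_e2ennreal[of UNIV]])
      (auto intro: continuous_on_component continuous_on_id)
  have 2: "continuous_on UNIV (\<lambda>x :: ereal ^ 'd. e2ennreal (- (x $ i)))" for i
    by (rule continuous_on_compose2[OF continuous_on_e2ennreal[of UNIV]])
      (auto simp: continuous_on_def intro!: tendsto_uminus_ereal tendsto_vec_nth tendsto_ident_at)
  show ?thesis
    unfolding ereal_coordinates_def[abs_def]
    by (intro continuous_on_Pair continuous_on_vec_lambda continuous_on_enn2real_inverse 1 2)
qed

lemma compact_UNIV_ereal_vec: "compact (UNIV :: (ereal ^ 'd) set)"
proof -
  have "compact (PiE (UNIV :: 'd set) (\<lambda>_. UNIV :: ereal set))"
    by (intro compact_PiE_UNIV compact_UNIV)
  then have "compact (UNIV :: ('d \<Rightarrow> ereal) set)" by simp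
  moreover have "continuous_on UNIV (\<lambda>g :: 'd \<Rightarrow> ereal. \<chi> i. g i)"
    by (intro continuous_on_vec_lambda continuous_on_product_coordinates)
  ultimately have "compact (range (\<lambda>g :: 'd \<Rightarrow> ereal. \<chi> i. g i))"
    using compact_continuous_image by blast
  moreover have "range (\<lambda>g :: 'd \<Rightarrow> ereal. \<chi> i. g i) = UNIV"
  proof -
    have "x \<in> range (\<lambda>g :: 'd \<Rightarrow> ereal. \<chi> i. g i)" for x
      by (rule range_eqI[of _ _ "vec_nth x"]) simp
    then show ?thesis by blast
  qed
  ultimately show ?thesis by simp
qed

lemma of_to_ereal_vec[simp]: "of_ereal_vec (to_ereal_vec x) = x"
  by (simp add: of_ereal_vec_def to_ereal_vec_def vec_eq_iff)

lemma to_of_ereal_vec: "x \<in> range to_ereal_vec \<Longrightarrow> to_ereal_vec (of_ereal_vec x) = x"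
  by auto

lemma to_ereal_vec_scale: "to_ereal_vec (l *\<^sub>R x) = ereal l *s to_ereal_vec x"
  by (simp add: to_ereal_vec_def vec_eq_iff)

lemma continuous_on_to_ereal_vec: "continuous_on UNIV to_ereal_vec"
  unfolding to_ereal_vec_def[abs_def]
  by (intro continuous_on_vec_lambda continuous_on_ereal continuous_on_component continuous_on_id)

lemma to_ereal_vec_measurable[measurable]: "to_ereal_vec \<in> borel_measurable borel"
  by (rule borel_measurable_continuous_onI[OF continuous_on_to_ereal_vec])

lemma ereal_vec_nth_measurable[measurable]:
  "(\<lambda>x :: ereal ^ 'd. x $ i) \<in> borel_measurable borel"
  by (intro borel_measurable_continuous_onI continuous_on_component continuous_on_id)

lemma of_ereal_vec_measurable[measurable]: "(of_ereal_vec :: ereal ^ 'd \<Rightarrow> _) \<in> borel_measurable borel"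
proof (subst borel_measurable_euclidean_space, intro ballI)
  fix b :: "real ^ 'd" assume "b \<in> Basis"
  then obtain i where "b = axis i 1" by (auto simp: Basis_vec_def)
  then have "(\<lambda>x :: ereal ^ 'd. of_ereal_vec x \<bullet> b) = (\<lambda>x. real_of_ereal (x $ i))"
    by (simp add: of_ereal_vec_def inner_axis)
  then show "(\<lambda>x :: ereal ^ 'd. of_ereal_vec x \<bullet> b) \<in> borel_measurable borel" by simp
qed

lemma range_to_ereal_vec: "range to_ereal_vec = {x. \<forall>i. \<bar>x $ i\<bar> \<noteq> \<infinity>}"
proof
  show "{x. \<forall>i. \<bar>x $ i\<bar> \<noteq> \<infinity>} \<subseteq> range to_ereal_vec"
  proof
    fix x :: "ereal ^ 'd" assume "x \<in> {x. \<forall>i. \<bar>x $ i\<bar> \<noteq> \<infinity>}"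
    then have "x = to_ereal_vec (of_ereal_vec x)"
      by (simp add: to_ereal_vec_def of_ereal_vec_def vec_eq_iff ereal_real')
    then show "x \<in> range to_ereal_vec" by blast
  qed
qed (auto simp: to_ereal_vec_def)

lemma range_to_ereal_vec_borel[measurable]: "range (to_ereal_vec :: real ^ 'd \<Rightarrow> _) \<in> sets borel"
proof -
  have "{x \<in> space (borel :: (ereal ^ 'd) measure). \<forall>i. \<bar>x $ i\<bar> \<noteq> \<infinity>} \<in> sets borel"
    by measurable
  then show ?thesis by (simp add: range_to_ereal_vec)
qed

text \<open>Real neighbourhoods stay open in the extended space, so they can carry test functions;
  this is used in \<open>series_in_neighbourhood\<close>.\<close>

lemma open_to_ereal_vec_image:
  assumes "open (U :: (real ^ 'd) set)"
  shows "open (to_ereal_vec ` U)"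
  unfolding open_vec_def
proof (intro ballI)
  fix x assume "x \<in> to_ereal_vec ` U"
  then obtain u where u: "u \<in> U" "x = to_ereal_vec u" by blast
  then obtain A where A: "\<And>i. open (A i)" "\<And>i. u $ i \<in> A i" "\<And>y. (\<forall>i. y $ i \<in> A i) \<Longrightarrow> y \<in> U"
    using assms unfolding open_vec_def by metis
  have "y \<in> to_ereal_vec ` U" if y: "\<forall>i. y $ i \<in> ereal ` A i" for y
  proof -
    have "\<bar>y $ i\<bar> \<noteq> \<infinity>" for i using y by (metis imageE abs_ereal.simps(1) PInfty_neq_ereal(1))
    then have "y \<in> range to_ereal_vec" by (simp add: range_to_ereal_vec)
    then obtain z where z: "y = to_ereal_vec z" by blast
    then have "z \<in> U" using y by (intro A(3)) (auto simp: to_ereal_vec_def)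
    then show ?thesis using z by blast
  qed
  then show "\<exists>S. (\<forall>i. open (S i) \<and> x $ i \<in> S i) \<and> (\<forall>y. (\<forall>i. y $ i \<in> S i) \<longrightarrow> y \<in> to_ereal_vec ` U)"
    using A(1,2) u(2) by (intro exI[of _ "\<lambda>i. ereal ` A i"]) (auto simp: open_ereal to_ereal_vec_def)
qed

text \<open>Joint continuity, which together with compactness gives uniformity in \<open>x\<close>
  when the factor varies. Factors are kept positive, since at factor 0 continuity fails at infinite
  coordinates.\<close>

lemma continuous_on_ereal_scale:
  "continuous_on ({0<..} \<times> UNIV) (\<lambda>(l, x :: ereal ^ 'd). ereal l *s x)"
proof -
  have "continuous_on ({0<..} \<times> UNIV) (\<lambda>p :: real \<times> (ereal ^ 'd). ereal (fst p) * (snd p $ i))" for i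
    unfolding continuous_on_def
  proof
    fix p :: "real \<times> (ereal ^ 'd)" assume "p \<in> {0<..} \<times> UNIV"
    then have "fst p > 0" by auto
    then show "((\<lambda>p. ereal (fst p) * (snd p $ i)) \<longlongrightarrow> ereal (fst p) * (snd p $ i)) (at p within {0<..} \<times> UNIV)"
      by (intro tendsto_mult_ereal tendsto_vec_nth tendsto_snd tendsto_fst tendsto_ereal tendsto_ident_at) auto
  qed
  then have "continuous_on ({0<..} \<times> UNIV) (\<lambda>p :: real \<times> (ereal ^ 'd). \<chi> i. ereal (fst p) * (snd p $ i))"
    by (rule continuous_on_vec_lambda)
  then show ?thesis by (simp add: case_prod_beta vector_scalar_mult_def)
qed

lemma continuous_on_ereal_scale_left:
  assumes "l > 0"
  shows "continuous_on UNIV (\<lambda>x :: ereal ^ 'd. ereal l *s x)"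
proof -
  have "continuous_on UNIV (\<lambda>x :: ereal ^ 'd. case (l, x) of (l, x) \<Rightarrow> ereal l *s x)"
    by (rule continuous_on_compose2[OF continuous_on_ereal_scale])
      (use assms in \<open>auto intro!: continuous_on_Pair continuous_on_const continuous_on_id\<close>)
  then show ?thesis by simp
qed

lemma ereal_scale_scale:
  "ereal l *s (ereal m *s x) = ereal (l * m) *s (x :: ereal ^ 'd)"
  by (simp add: vec_eq_iff mult.assoc[symmetric])

lemma ereal_scale_one: "ereal 1 *s (x :: ereal ^ 'd) = x"
  by (simp add: vec_eq_iff one_ereal_def[symmetric])

section \<open>Homogeneity of the limit measure\<close>

locale regularly_varying =
  fixes f :: "ereal ^ 'd \<Rightarrow> ennreal" and \<alpha> :: real and a :: "nat \<Rightarrow> real"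
    and \<nu> :: "(ereal ^ 'd) measure" and M\<^sub>0 :: "'v measure" and X\<^sub>0 :: "'v \<Rightarrow> real ^ 'd"
  assumes f_continuous: "continuous_on UNIV f"
    and f_hom: "homogeneous f"
    and f_fin: "\<And>x. f (to_ereal_vec x) < \<infinity>"
    and rv: "RV M\<^sub>0 X\<^sub>0 \<alpha> a {x. f x = 0} \<nu>"
begin

sublocale level_space f ereal_coordinates
  by unfold_locales
    (rule compact_UNIV_ereal_vec f_continuous continuous_on_ereal_coordinates inj_ereal_coordinates)+

lemma f_scale: "l > 0 \<Longrightarrow> f (ereal l *s x) = ennreal l * f x"
  using f_hom by (auto simp: homogeneous_def)

lemma prob_M0: "prob_space M\<^sub>0" and X0_measurable[measurable]: "X\<^sub>0 \<in> borel_measurable M\<^sub>0"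
  and alpha_pos: "\<alpha> > 0" and radon: "radon_measure_on E \<nu>" and nu_E: "emeasure \<nu> E \<noteq> 0"
  and nu_infinite_part: "emeasure \<nu> (E - range to_ereal_vec) = 0"
  and a_pos: "n \<ge> 1 \<Longrightarrow> a n > 0"
  and a_rv: "l > 0 \<Longrightarrow> (\<lambda>n. a (nat \<lfloor>l * real n\<rfloor>) / a n) \<longlonglongrightarrow> l powr (1 / \<alpha>)"
  using rv by (auto simp: RV_def regularly_varying_seq_def)

lemma space_nu: "space \<nu> = E"
  using radon by (rule radon_space)

definition scaled :: "nat \<Rightarrow> real ^ 'd \<Rightarrow> ereal ^ 'd" where
  "scaled n x = to_ereal_vec ((1 / a n) *\<^sub>R x)"

lemma continuous_on_scaled: "continuous_on UNIV (scaled n)"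
  unfolding scaled_def[abs_def]
  by (rule continuous_on_compose2[OF continuous_on_to_ereal_vec]) (auto intro!: continuous_intros)

lemma scaled_measurable[measurable]: "scaled n \<in> borel_measurable borel"
  by (rule borel_measurable_continuous_onI[OF continuous_on_scaled])

lemma vague_limit:
  assumes h: "h \<in> Cc0"
  shows "(\<lambda>n. real n * (\<integral>\<omega>. h (scaled n (X\<^sub>0 \<omega>)) \<partial>M\<^sub>0)) \<longlonglongrightarrow> (\<integral>x. h x \<partial>\<nu>)"
proof -
  have hm[measurable]: "h \<in> borel_measurable borel" by (rule Cc0_measurable[OF h])
  have "(\<integral>x. h x \<partial>scale_measure (of_nat n)
      (restrict_space (distr M\<^sub>0 borel (\<lambda>\<omega>. to_ereal_vec ((1 / a n) *\<^sub>R X\<^sub>0 \<omega>))) E)) =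
      real n * (\<integral>\<omega>. h (scaled n (X\<^sub>0 \<omega>)) \<partial>M\<^sub>0)" (is "?L = _") for n
  proof -
    have "?L = real n * (\<integral>x. h x \<partial>restrict_space (distr M\<^sub>0 borel (\<lambda>\<omega>. scaled n (X\<^sub>0 \<omega>))) E)"
      unfolding scaled_def ennreal_of_nat_eq_real_of_nat
      by (intro integral_scale_measure measurable_restrict_space1) auto
    also have "(\<integral>x. h x \<partial>restrict_space (distr M\<^sub>0 borel (\<lambda>\<omega>. scaled n (X\<^sub>0 \<omega>))) E) =
        (\<integral>x. indicator E x *\<^sub>R h x \<partial>distr M\<^sub>0 borel (\<lambda>\<omega>. scaled n (X\<^sub>0 \<omega>)))"
      by (rule integral_restrict_space) simp
    also have "\<dots> = (\<integral>x. h x \<partial>distr M\<^sub>0 borel (\<lambda>\<omega>. scaled n (X\<^sub>0 \<omega>)))"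
      using Cc0_zero[OF h] by (intro Bochner_Integration.integral_cong) (auto simp: indicator_def)
    also have "\<dots> = (\<integral>\<omega>. h (scaled n (X\<^sub>0 \<omega>)) \<partial>M\<^sub>0)"
      by (rule integral_distr) measurable
    finally show ?thesis .
  qed
  then show ?thesis
    using rv Cc0_subset_Cc[OF h] unfolding RV_def vaguely_converges_def by auto
qed

lemma Cc0_scale:
  assumes h: "h \<in> Cc0" and r: "r > 0"
  shows "(\<lambda>x. h (ereal r *s x)) \<in> Cc0"
proof -
  obtain s where s: "s > 0" "\<And>x. h x \<noteq> 0 \<Longrightarrow> ennreal s \<le> f x" and hc: "continuous_on UNIV h"
    using h by (auto simp: Cc0_def)
  have "continuous_on UNIV (\<lambda>x. h (ereal r *s x))"
    by (rule continuous_on_compose2[OF hc continuous_on_ereal_scale_left[OF r]]) simp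
  moreover have "ennreal (s / r) \<le> f x" if "h (ereal r *s x) \<noteq> 0" for x
  proof -
    have "ennreal s \<le> ennreal r * f x" using s(2)[OF that] r by (simp add: f_scale)
    then have "ennreal (1 / r) * ennreal s \<le> ennreal (1 / r) * (ennreal r * f x)"
      by (rule mult_left_mono) simp
    also have "\<dots> = f x"
      using r by (simp add: mult.assoc[symmetric] ennreal_mult''[symmetric])
    finally show ?thesis using r s(1) by (simp add: ennreal_mult''[symmetric])
  qed
  ultimately show ?thesis using s(1) r by (auto simp: Cc0_def intro!: exI[of _ "s / r"])
qed

text \<open>A uniform bound on the effect of changing the scale could not be integrated over
  infinite mass. The error is therefore dominated by a multiple of one test function
  \<open>\<eta>\<close> whose integrals converge.\<close>

lemma scale_uniformly_close:
  assumes h: "h \<in> Cc0" and r: "r > 0"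
  obtains \<eta> where "\<eta> \<in> Cc0" "\<And>x. 0 \<le> \<eta> x"
    "\<And>e. e > 0 \<Longrightarrow> \<exists>d>0. \<forall>l. \<bar>l - r\<bar> < d \<longrightarrow> (\<forall>x. \<bar>h (ereal l *s x) - h (ereal r *s x)\<bar> \<le> e * \<eta> x)"
proof -
  obtain s where s: "s > 0" "\<And>x. h x \<noteq> 0 \<Longrightarrow> ennreal s \<le> f x" and hc: "continuous_on UNIV h"
    using h by (auto simp: Cc0_def)
  \<comment> \<open>If \<open>h\<close> is nonzero at \<open>l\<close> times \<open>x\<close> with
    \<open>l < 2 * r\<close>, then \<open>s \<le> l * f x\<close>, hence
    \<open>f x \<ge> s / (2 * r)\<close>; this is the level at which \<open>\<eta>\<close> has
    reached 1.\<close>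
  define \<eta> where "\<eta> = bump (s / (4 * r)) (s / (2 * r))"
  have rs: "0 < s / (4 * r)" "s / (4 * r) < s / (2 * r)" using r s by (auto simp: field_simps)
  have one: "\<eta> x = 1" if "h (ereal l *s x) \<noteq> 0" "0 < l" "l < 2 * r" for l x
    unfolding \<eta>_def
  proof (rule bump_eq_1[OF rs])
    have "ennreal s \<le> ennreal l * f x" using s(2)[OF that(1)] that(2) by (simp add: f_scale)
    also have "\<dots> \<le> ennreal (2 * r) * f x" using that(3) by (intro mult_right_mono ennreal_leI) auto
    finally have "ennreal (1 / (2 * r)) * ennreal s \<le> ennreal (1 / (2 * r)) * (ennreal (2 * r) * f x)"
      by (rule mult_left_mono) simp
    also have "\<dots> = f x"
      using r by (simp add: mult.assoc[symmetric] ennreal_mult''[symmetric])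
    finally show "ennreal (s / (2 * r)) \<le> f x" using r s(1) by (simp add: ennreal_mult''[symmetric])
  qed
  have "\<exists>d>0. \<forall>l. \<bar>l - r\<bar> < d \<longrightarrow> (\<forall>x. \<bar>h (ereal l *s x) - h (ereal r *s x)\<bar> \<le> e * \<eta> x)" if e: "e > 0" for e
  proof -
    define F where "F p = h (case p of (l, x) \<Rightarrow> ereal l *s x)" for p :: "real \<times> (ereal ^ 'd)"
    have F: "continuous_on ({0<..} \<times> UNIV) F"
      unfolding F_def[abs_def]
      by (rule continuous_on_compose2[OF hc continuous_on_ereal_scale]) simp
    obtain V where V: "r \<in> V" "open V"
      "\<forall>l\<in>V \<inter> {0<..}. \<forall>x\<in>UNIV. dist (F (l, x)) (F (r, x)) \<le> e"
      by (rule continuous_on_prod_compactE[OF F compact_space _ e, of r]) (use r in auto)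
    obtain d0 where d0: "d0 > 0" "\<And>l. \<bar>l - r\<bar> < d0 \<Longrightarrow> l \<in> V"
      using V(1,2) unfolding open_dist dist_real_def by blast
    have "\<bar>h (ereal l *s x) - h (ereal r *s x)\<bar> \<le> e * \<eta> x" if l: "\<bar>l - r\<bar> < min d0 r" for l x
    proof (cases "h (ereal l *s x) = 0 \<and> h (ereal r *s x) = 0")
      case True
      then show ?thesis using e bump_nonneg by (simp add: \<eta>_def)
    next
      case False
      have lr: "0 < l" "l < 2 * r" using l by auto
      then have "\<eta> x = 1" using False one[of l x] one[of r x] r by auto
      have "dist (F (l, x)) (F (r, x)) \<le> e" using V(3) d0(2)[of l] l lr by auto
      then show ?thesis using \<open>\<eta> x = 1\<close> by (simp add: dist_real_def F_def)
    qed
    then show ?thesis using d0(1) r by (intro exI[of _ "min d0 r"]) auto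
  qed
  then show ?thesis
    using bump_Cc0[OF rs] bump_nonneg by (intro that[of \<eta>]) (auto simp: \<eta>_def)
qed

lemma floor_ratio_tendsto:
  assumes "l > 0"
  shows "(\<lambda>n. real (nat \<lfloor>l * real n\<rfloor>) / real n) \<longlonglongrightarrow> l"
\<comment> \<open>At \<open>n = 0\<close> the quotient is 0 by convention, at distance
  \<open>l\<close> from the limit.\<close>
proof (rule tendsto_of_dist_le[where c = "\<lambda>n. if n = 0 then l else 1 / real n"])
  fix n :: nat
  show "\<bar>real (nat \<lfloor>l * real n\<rfloor>) / real n - l\<bar> \<le> (if n = 0 then l else 1 / real n)"
  proof (cases "n = 0")
    case False
    have "real (nat \<lfloor>l * real n\<rfloor>) = of_int \<lfloor>l * real n\<rfloor>" using assms by (simp add: of_nat_nat)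
    then have "\<bar>real (nat \<lfloor>l * real n\<rfloor>) - l * real n\<bar> \<le> 1" by linarith
    then have "\<bar>real (nat \<lfloor>l * real n\<rfloor>) - l * real n\<bar> / real n \<le> 1 / real n"
      by (intro divide_right_mono) auto
    moreover have "real (nat \<lfloor>l * real n\<rfloor>) / real n - l = (real (nat \<lfloor>l * real n\<rfloor>) - l * real n) / real n"
      using False by (simp add: diff_divide_distrib)
    ultimately show ?thesis using False by (simp add: abs_divide)
  qed (use assms in simp)
next
  have "\<forall>\<^sub>F n in sequentially. 1 / real n = (if n = 0 then l else 1 / real n)"
    using eventually_gt_at_top[of 0] by eventually_elim auto
  then show "(\<lambda>n. if n = 0 then l else 1 / real n) \<longlonglongrightarrow> 0"
    by (rule Lim_transform_eventually[OF lim_1_over_n])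
qed

lemma filterlim_floor_mult:
  assumes "l > 0"
  shows "filterlim (\<lambda>n. nat \<lfloor>l * real n\<rfloor>) sequentially sequentially"
  unfolding filterlim_at_top
proof
  fix m :: nat
  obtain n0 :: nat where n0: "real m / l < real n0" using reals_Archimedean2 by blast
  have "m \<le> nat \<lfloor>l * real n\<rfloor>" if "n \<ge> n0" for n
  proof -
    have "real m / l \<le> real n" using n0 that by (meson less_le_trans less_imp_le of_nat_le_iff)
    then have "real m \<le> l * real n" using assms by (simp add: field_simps)
    then show ?thesis by (simp add: le_nat_floor)
  qed
  then show "\<forall>\<^sub>F n in sequentially. m \<le> nat \<lfloor>l * real n\<rfloor>" by (auto simp: eventually_sequentially)
qed

text \<open>Along \<open>m = \<lfloor>l n\<rfloor>\<close> the normalisations satisfy \<open>a m / a n \<rightarrow> l\<^sup>1\<^sup>/\<^sup>\<alpha>\<close>, so the vague limit \<open>\<nu>\<close> of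
  \<open>n P(X / a n \<in> \<cdot>)\<close> is also the image of \<open>\<nu> / l\<close> under scaling by \<open>l\<^sup>1\<^sup>/\<^sup>\<alpha>\<close>.\<close>

lemma integral_homogeneous:
  assumes h: "h \<in> Cc0" and l: "l > 0"
  shows "(\<integral>x. h x \<partial>\<nu>) = (1 / l) * (\<integral>x. h (ereal (l powr (1 / \<alpha>)) *s x) \<partial>\<nu>)"
proof -
  define r where "r = l powr (1 / \<alpha>)"
  have r: "r > 0" using l by (simp add: r_def)
  define m where "m n = nat \<lfloor>l * real n\<rfloor>" for n
  have m_lim: "filterlim m sequentially sequentially"
    unfolding m_def[abs_def] by (rule filterlim_floor_mult[OF l])
  define \<rho> where "\<rho> n = a (m n) / a n" for n
  have \<rho>_lim: "\<rho> \<longlonglongrightarrow> r" unfolding \<rho>_def m_def r_def by (rule a_rv[OF l])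
  interpret M0: prob_space M\<^sub>0 by (rule prob_M0)
  have int: "integrable M\<^sub>0 (\<lambda>\<omega>. g (ereal k *s scaled n (X\<^sub>0 \<omega>)))" if g: "g \<in> Cc0" and k: "k > 0" for g k n
  proof -
    have gk: "(\<lambda>x. g (ereal k *s x)) \<in> Cc0" by (rule Cc0_scale[OF g k])
    obtain B where B: "\<And>x. \<bar>g (ereal k *s x)\<bar> \<le> B" using Cc0_bounded[OF gk] by blast
    have "(\<lambda>\<omega>. (\<lambda>x. g (ereal k *s x)) (scaled n (X\<^sub>0 \<omega>))) \<in> borel_measurable M\<^sub>0"
      by (rule measurable_compose[OF _ Cc0_measurable[OF gk]]) measurable
    then show ?thesis using B by (intro M0.integrable_const_bound[of _ B] AE_I2) auto
  qed
  define h' where "h' x = h (ereal r *s x)" for x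
  have h': "h' \<in> Cc0" unfolding h'_def[abs_def] by (rule Cc0_scale[OF h r])
  define I where "I g n = (\<integral>\<omega>. g (scaled n (X\<^sub>0 \<omega>)) \<partial>M\<^sub>0)" for g :: "ereal ^ 'd \<Rightarrow> real" and n
  \<comment> \<open>Writing \<open>n\<close> as \<open>m n\<close> divided by \<open>m n / n\<close>
    produces the factor \<open>1 / l\<close>.\<close>
  have sub: "(\<lambda>n. real n * I g (m n)) \<longlonglongrightarrow> (1 / l) * (\<integral>x. g x \<partial>\<nu>)" if g: "g \<in> Cc0" for g
  proof -
    have "(\<lambda>n. real (m n) * I g (m n)) \<longlonglongrightarrow> (\<integral>x. g x \<partial>\<nu>)"
      using filterlim_compose[OF vague_limit[OF g] m_lim] by (simp add: I_def)
    moreover have "(\<lambda>n. 1 / (real (m n) / real n)) \<longlonglongrightarrow> 1 / l"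
      using floor_ratio_tendsto[OF l] l unfolding m_def by (intro tendsto_intros) auto
    ultimately have "(\<lambda>n. 1 / (real (m n) / real n) * (real (m n) * I g (m n))) \<longlonglongrightarrow> (1 / l) * (\<integral>x. g x \<partial>\<nu>)"
      by (intro tendsto_mult)
    moreover have "\<forall>\<^sub>F n in sequentially. m n \<ge> 1"
      using m_lim by (simp add: filterlim_at_top)
    then have "\<forall>\<^sub>F n in sequentially. 1 / (real (m n) / real n) * (real (m n) * I g (m n)) = real n * I g (m n)"
      by eventually_elim (auto simp: field_simps)
    ultimately show ?thesis by (rule Lim_transform_eventually)
  qed
  obtain \<eta> where \<eta>: "\<eta> \<in> Cc0" "\<And>x. 0 \<le> \<eta> x"
    "\<And>e. e > 0 \<Longrightarrow> \<exists>d>0. \<forall>l. \<bar>l - r\<bar> < d \<longrightarrow> (\<forall>x. \<bar>h (ereal l *s x) - h (ereal r *s x)\<bar> \<le> e * \<eta> x)"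
    using scale_uniformly_close[OF h r] by blast
  \<comment> \<open>\<open>scaled n\<close> is \<open>\<rho> n\<close> times
    \<open>scaled (m n)\<close>. Replacing \<open>\<rho> n\<close> by its limit \<open>r\<close>
    costs at most \<open>e * \<eta>\<close>, and the scaled expectations of \<open>\<eta>\<close>
    converge as well.\<close>
  have diff: "\<bar>(\<integral>x. h x \<partial>\<nu>) - (1 / l) * (\<integral>x. h' x \<partial>\<nu>)\<bar> \<le> e * ((1 / l) * (\<integral>x. \<eta> x \<partial>\<nu>))" if e: "e > 0" for e
  proof -
    obtain d where d: "d > 0" "\<And>l x. \<bar>l - r\<bar> < d \<Longrightarrow> \<bar>h (ereal l *s x) - h (ereal r *s x)\<bar> \<le> e * \<eta> x"
      using \<eta>(3)[OF e] by blast
    have "\<forall>\<^sub>F n in sequentially. \<bar>\<rho> n - r\<bar> < d \<and> m n \<ge> 1 \<and> n \<ge> 1"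
      using tendstoD[OF \<rho>_lim d(1)] m_lim eventually_ge_at_top[of 1]
      by (simp add: dist_real_def filterlim_at_top eventually_conj_iff)
    then have "\<forall>\<^sub>F n in sequentially.
        \<bar>real n * I h n - real n * I h' (m n)\<bar> \<le> e * (real n * I \<eta> (m n))"
    proof eventually_elim
      case (elim n)
      have pos: "\<rho> n > 0" using a_pos elim by (simp add: \<rho>_def)
      have sc: "scaled n x = ereal (\<rho> n) *s scaled (m n) x" for x
      proof -
        have "(1 / a n) *\<^sub>R x = \<rho> n *\<^sub>R ((1 / a (m n)) *\<^sub>R x)"
          using a_pos[of n] a_pos[of "m n"] elim by (simp add: \<rho>_def)
        then show ?thesis unfolding scaled_def by (metis to_ereal_vec_scale)
      qed
      have i1: "integrable M\<^sub>0 (\<lambda>\<omega>. h (ereal (\<rho> n) *s scaled (m n) (X\<^sub>0 \<omega>)))" by (rule int[OF h pos])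
      have i2: "integrable M\<^sub>0 (\<lambda>\<omega>. h' (scaled (m n) (X\<^sub>0 \<omega>)))" unfolding h'_def by (rule int[OF h r])
      have i3: "integrable M\<^sub>0 (\<lambda>\<omega>. \<eta> (scaled (m n) (X\<^sub>0 \<omega>)))" using int[OF \<eta>(1), of 1] by (simp add: ereal_scale_one flip: one_ereal_def)
      have "\<bar>I h n - I h' (m n)\<bar> =
          \<bar>\<integral>\<omega>. h (ereal (\<rho> n) *s scaled (m n) (X\<^sub>0 \<omega>)) - h' (scaled (m n) (X\<^sub>0 \<omega>)) \<partial>M\<^sub>0\<bar>"
        using i1 i2 by (simp add: I_def sc)
      also have "\<dots> \<le> (\<integral>\<omega>. \<bar>h (ereal (\<rho> n) *s scaled (m n) (X\<^sub>0 \<omega>)) - h' (scaled (m n) (X\<^sub>0 \<omega>))\<bar> \<partial>M\<^sub>0)"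
        by (rule integral_abs_bound)
      also have "\<dots> \<le> (\<integral>\<omega>. e * \<eta> (scaled (m n) (X\<^sub>0 \<omega>)) \<partial>M\<^sub>0)"
        using i1 i2 i3 d(2)[of "\<rho> n"] elim by (intro integral_mono) (auto simp: h'_def)
      also have "\<dots> = e * I \<eta> (m n)" by (simp add: I_def)
      finally have "real n * \<bar>I h n - I h' (m n)\<bar> \<le> real n * (e * I \<eta> (m n))"
        by (rule mult_left_mono) simp
      then show ?case by (simp add: abs_mult right_diff_distrib[symmetric] mult.left_commute)
    qed
    moreover have "(\<lambda>n. \<bar>real n * I h n - real n * I h' (m n)\<bar>) \<longlonglongrightarrow> \<bar>(\<integral>x. h x \<partial>\<nu>) - (1 / l) * (\<integral>x. h' x \<partial>\<nu>)\<bar>"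
      using vague_limit[OF h, folded I_def] sub[OF h'] by (rule tendsto_rabs[OF tendsto_diff])
    moreover have "(\<lambda>n. e * (real n * I \<eta> (m n))) \<longlonglongrightarrow> e * ((1 / l) * (\<integral>x. \<eta> x \<partial>\<nu>))"
      using sub[OF \<eta>(1)] by (rule tendsto_mult_left)
    ultimately show ?thesis
      using tendsto_le[OF sequentially_bot] by blast
  qed
  define K where "K = (1 / l) * (\<integral>x. \<eta> x \<partial>\<nu>)"
  have K: "K \<ge> 0" unfolding K_def using l \<eta>(2) by (intro mult_nonneg_nonneg Bochner_Integration.integral_nonneg) auto
  have "\<bar>(\<integral>x. h x \<partial>\<nu>) - (1 / l) * (\<integral>x. h' x \<partial>\<nu>)\<bar> \<le> 0 + e" if e: "e > 0" for e
  proof -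
    \<comment> \<open>\<open>K\<close> may be 0, hence the divisor \<open>K + 1\<close>.\<close>
    have "e / (K + 1) * K \<le> e" using K e by (simp add: field_simps)
    then show ?thesis using diff[of "e / (K + 1)"] K e by (simp add: K_def)
  qed
  then have "\<bar>(\<integral>x. h x \<partial>\<nu>) - (1 / l) * (\<integral>x. h' x \<partial>\<nu>)\<bar> \<le> 0" by (rule field_le_epsilon)
  then show ?thesis by (simp add: h'_def r_def)
qed

end

section \<open>Polar decomposition of the limit measure\<close>

context regularly_varying
begin

lemma E_scale: "r > 0 \<Longrightarrow> ereal r *s x \<in> E \<longleftrightarrow> x \<in> E"
  by (simp add: f_scale)

lemma scale_measurable:
  assumes "r > 0"
  shows "(\<lambda>x. ereal r *s x) \<in> measurable \<nu> (restrict_space borel E)"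
proof (rule measurable_restrict_space2)
  show "(\<lambda>x. ereal r *s x) \<in> space \<nu> \<rightarrow> E" using E_scale[OF assms] by (auto simp: space_nu)
  show "(\<lambda>x. ereal r *s x) \<in> borel_measurable \<nu>"
    by (intro radon_measurable[OF radon] borel_measurable_continuous_onI continuous_on_ereal_scale_left assms)
qed

text \<open>\<open>\<kappa>\<close> is \<open>r powr (- \<alpha>)\<close> times the image of
  \<open>\<nu>\<close> under scaling by \<open>r\<close>. The two Radon measures have the same
  integrals of test functions by \<open>integral_homogeneous\<close> with
  \<open>l = r powr \<alpha>\<close>, so they coincide.\<close>

lemma nu_homogeneous:
  assumes r: "r > 0" and A: "A \<in> sets \<nu>"
  shows "emeasure \<nu> A = ennreal (r powr (- \<alpha>)) * emeasure \<nu> {x \<in> E. ereal r *s x \<in> A}"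
proof -
  define l where "l = r powr \<alpha>"
  have l: "l > 0" "l powr (1 / \<alpha>) = r" "1 / l = r powr (- \<alpha>)"
    using r alpha_pos by (auto simp: l_def powr_powr powr_minus_divide)
  note m = scale_measurable[OF r]
  define \<kappa> where "\<kappa> = scale_measure (ennreal (1 / l)) (distr \<nu> (restrict_space borel E) (\<lambda>x. ereal r *s x))"
  have em: "emeasure \<kappa> B = ennreal (1 / l) * emeasure \<nu> {x \<in> E. ereal r *s x \<in> B}" if "B \<in> sets \<nu>" for B
  proof -
    have "B \<in> sets (restrict_space borel E)" using that radon_sets[OF radon] by simp
    then have "emeasure \<kappa> B = ennreal (1 / l) * emeasure \<nu> ((\<lambda>x. ereal r *s x) -` B \<inter> space \<nu>)"
      unfolding \<kappa>_def using m by (simp add: emeasure_distr)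
    also have "(\<lambda>x. ereal r *s x) -` B \<inter> space \<nu> = {x \<in> E. ereal r *s x \<in> B}" by (auto simp: space_nu)
    finally show ?thesis .
  qed
  have radon\<kappa>: "radon_measure_on E \<kappa>"
    unfolding radon_measure_on_def
  proof (intro conjI allI impI)
    show "sets \<kappa> = sets (restrict_space borel E)" by (simp add: \<kappa>_def)
    fix K assume K: "compact K \<and> K \<subseteq> E"
    then obtain s where s: "s > 0" "\<And>x. x \<in> K \<Longrightarrow> ennreal s \<le> f x" using compact_subset_level by blast
    have Ks: "K \<in> sets \<nu>" using K compact_imp_closed[of K] by (intro sets_radon[OF radon]) auto
    \<comment> \<open>The preimage of a compact set stays at positive level, which makes
      \<open>\<kappa>\<close> a Radon measure.\<close>
    have "{x \<in> E. ereal r *s x \<in> K} \<subseteq> {x. ennreal (s / r) \<le> f x}"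
    proof
      fix x assume "x \<in> {x \<in> E. ereal r *s x \<in> K}"
      then have "ennreal s \<le> ennreal r * f x" using s(2)[of "ereal r *s x"] r by (simp add: f_scale)
      then have "ennreal (1 / r) * ennreal s \<le> ennreal (1 / r) * (ennreal r * f x)"
        by (rule mult_left_mono) simp
      also have "\<dots> = f x"
        using r by (simp add: mult.assoc[symmetric] ennreal_mult''[symmetric])
      finally show "x \<in> {x. ennreal (s / r) \<le> f x}" using r s(1) by (simp add: ennreal_mult''[symmetric])
    qed
    then have "emeasure \<nu> {x \<in> E. ereal r *s x \<in> K} \<le> emeasure \<nu> {x. ennreal (s / r) \<le> f x}"
      using s r by (intro emeasure_mono sets_radon_level[OF radon]) auto
    also have "\<dots> < \<infinity>" using s r by (intro radon_level_finite[OF radon]) auto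
    finally have "emeasure \<nu> {x \<in> E. ereal r *s x \<in> K} < \<infinity>" .
    then show "emeasure \<kappa> K < \<infinity>"
      unfolding em[OF Ks] by (simp add: ennreal_mult_less_top)
  qed
  have "\<nu> = \<kappa>"
  proof (rule radon_measure_eqI[OF radon radon\<kappa>])
    fix h :: "ereal ^ 'd \<Rightarrow> real" assume h: "h \<in> Cc0"
    have hm: "h \<in> borel_measurable (restrict_space borel E)"
      by (rule measurable_restrict_space1[OF Cc0_measurable[OF h]])
    have "(\<integral>x. h x \<partial>\<kappa>) = (1 / l) * (\<integral>x. h x \<partial>distr \<nu> (restrict_space borel E) (\<lambda>x. ereal r *s x))"
      unfolding \<kappa>_def using hm l(1) by (intro integral_scale_measure) auto
    also have "(\<integral>x. h x \<partial>distr \<nu> (restrict_space borel E) (\<lambda>x. ereal r *s x)) = (\<integral>x. h (ereal r *s x) \<partial>\<nu>)"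
      by (rule integral_distr[OF m hm])
    finally show "(\<integral>x. h x \<partial>\<nu>) = (\<integral>x. h x \<partial>\<kappa>)"
      using integral_homogeneous[OF h l(1)] by (simp add: l(2))
  qed
  then show ?thesis using em[OF A] by (simp add: l(3))
qed

definition finite_part :: "(ereal ^ 'd) set" where "finite_part = range to_ereal_vec"

text \<open>Meaningful on \<open>finite_part\<close>, where \<open>f\<close> is finite; elsewhere
  infinite values become 0. \<open>\<nu>\<close> gives the rest of \<open>E\<close> no mass.\<close>

definition radius :: "ereal ^ 'd \<Rightarrow> real" where "radius x = enn2real (f x)"

definition direction :: "ereal ^ 'd \<Rightarrow> real ^ 'd" where
  "direction x = (1 / radius x) *\<^sub>R of_ereal_vec x"

definition mass :: real where "mass = measure \<nu> {x. f x > 1}"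

definition angular :: "(real ^ 'd) measure" where
  "angular = scale_measure (ennreal (1 / mass)) (spectral_measure f \<nu>)"

lemma finite_part_borel[measurable]: "finite_part \<in> sets borel"
  unfolding finite_part_def by measurable

lemma radius_measurable[measurable]: "radius \<in> borel_measurable borel"
  unfolding radius_def[abs_def] by measurable

lemma direction_measurable[measurable]: "direction \<in> borel_measurable borel"
  unfolding direction_def[abs_def] by measurable

lemma f_eq_radius: "x \<in> finite_part \<Longrightarrow> f x = ennreal (radius x)"
  using f_fin by (auto simp: finite_part_def radius_def)

lemma radius_pos: "x \<in> finite_part \<Longrightarrow> x \<in> E \<Longrightarrow> radius x > 0"
  using f_eq_radius[of x] by (metis (mono_tags, lifting) ComplD ennreal_neg linorder_not_le mem_Collect_eq)

lemma finite_part_scale: "r > 0 \<Longrightarrow> ereal r *s x \<in> finite_part \<longleftrightarrow> x \<in> finite_part"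
proof
  assume r: "r > 0" and "ereal r *s x \<in> finite_part"
  then obtain u where "ereal r *s x = to_ereal_vec u" by (auto simp: finite_part_def)
  then have "ereal (1 / r) *s (ereal r *s x) = to_ereal_vec ((1 / r) *\<^sub>R u)"
    by (simp add: to_ereal_vec_scale)
  then have "x = to_ereal_vec ((1 / r) *\<^sub>R u)"
    using r unfolding ereal_scale_scale by (simp add: ereal_scale_one flip: one_ereal_def)
  then show "x \<in> finite_part" by (simp add: finite_part_def)
qed (auto simp: finite_part_def simp flip: to_ereal_vec_scale)

lemma radius_scale: "r > 0 \<Longrightarrow> radius (ereal r *s x) = r * radius x"
  by (simp add: radius_def f_scale enn2real_mult)

lemma direction_scale:
  assumes "r > 0" "x \<in> finite_part"
  shows "direction (ereal r *s x) = direction x"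
proof -
  obtain u where u: "x = to_ereal_vec u" using assms(2) by (auto simp: finite_part_def)
  have "of_ereal_vec (ereal r *s x) = r *\<^sub>R of_ereal_vec x"
    unfolding u by (metis of_to_ereal_vec to_ereal_vec_scale)
  then show ?thesis using assms(1) by (simp add: direction_def radius_scale)
qed

lemma direction_sphere: "x \<in> finite_part \<Longrightarrow> x \<in> E \<Longrightarrow> direction x \<in> unit_sphere f"
proof -
  assume x: "x \<in> finite_part" "x \<in> E"
  note rp = radius_pos[OF x]
  have "f (to_ereal_vec (direction x)) = f (ereal (1 / radius x) *s x)"
    using x(1) by (simp add: direction_def to_ereal_vec_scale to_of_ereal_vec finite_part_def)
  also have "\<dots> = ennreal (1 / radius x) * ennreal (radius x)"
    using rp by (simp add: f_scale f_eq_radius[OF x(1)])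
  also have "\<dots> = 1" using rp by (simp add: ennreal_mult''[symmetric])
  finally show ?thesis by (simp add: unit_sphere_def)
qed

lemma polar_inverse: "x \<in> finite_part \<Longrightarrow> x \<in> E \<Longrightarrow> to_ereal_vec (radius x *\<^sub>R direction x) = x"
  using radius_pos[of x] by (simp add: direction_def to_of_ereal_vec finite_part_def)

lemma unit_sphere_borel[measurable]: "unit_sphere f \<in> sets borel"
proof -
  have "{x \<in> space borel. f (to_ereal_vec x) = 1} \<in> sets borel" by measurable
  then show ?thesis by (simp add: unit_sphere_def)
qed

lemma space_spectral: "space (spectral_measure f \<nu>) = unit_sphere f"
  and sets_spectral: "sets (spectral_measure f \<nu>) = sets (restrict_space borel (unit_sphere f))"
  by (auto simp: spectral_measure_def space_restrict_space)

lemma f_greater_one_subset: "{x. f x > 1} \<subseteq> E"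
  by (auto simp: zero_less_iff_neq_zero)

lemma sets_nu_E: "A \<in> sets borel \<Longrightarrow> A \<subseteq> E \<Longrightarrow> A \<in> sets \<nu>"
  by (rule sets_radon[OF radon])

lemma sets_polar:
  assumes "B \<in> sets (restrict_space borel (unit_sphere f))" "A \<in> sets borel"
  shows "{x \<in> E \<inter> finite_part. radius x \<in> A \<and> direction x \<in> B} \<in> sets \<nu>"
proof (rule sets_nu_E)
  have [measurable]: "B \<in> sets borel" "A \<in> sets borel"
    using assms by (auto simp: sets_restrict_space)
  have "{x \<in> space borel. x \<in> E \<and> x \<in> finite_part \<and> radius x \<in> A \<and> direction x \<in> B} \<in> sets borel"
    by measurable
  then show "{x \<in> E \<inter> finite_part. radius x \<in> A \<and> direction x \<in> B} \<in> sets borel" by simp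
qed auto

lemma emeasure_spectral:
  assumes B: "B \<in> sets (restrict_space borel (unit_sphere f))"
  shows "emeasure (spectral_measure f \<nu>) B = emeasure \<nu> {x \<in> E \<inter> finite_part. radius x > 1 \<and> direction x \<in> B}"
proof -
  define W where "W = {x \<in> finite_part. f x > 1}"
  have WE: "W \<subseteq> E" using f_greater_one_subset by (auto simp: W_def)
  have "{x \<in> space borel. x \<in> finite_part \<and> f x > 1} \<in> sets borel" by measurable
  then have Wm: "W \<in> sets \<nu>" using WE by (intro sets_nu_E) (simp_all add: W_def)
  have dir: "direction \<in> measurable (restrict_space \<nu> W) (restrict_space borel (unit_sphere f))"
  proof (rule measurable_restrict_space2)
    show "direction \<in> space (restrict_space \<nu> W) \<rightarrow> unit_sphere f"
      using direction_sphere WE by (auto simp: space_restrict_space W_def)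
    show "direction \<in> borel_measurable (restrict_space \<nu> W)"
      by (intro measurable_restrict_space1 radon_measurable[OF radon] direction_measurable)
  qed
  have "spectral_measure f \<nu> = distr (restrict_space \<nu> W) (restrict_space borel (unit_sphere f)) direction"
    unfolding spectral_measure_def W_def finite_part_def direction_def[abs_def] radius_def ..
  then have "emeasure (spectral_measure f \<nu>) B =
      emeasure (restrict_space \<nu> W) (direction -` B \<inter> space (restrict_space \<nu> W))"
    using dir B by (simp add: emeasure_distr)
  also have "\<dots> = emeasure \<nu> (direction -` B \<inter> space (restrict_space \<nu> W))"
    using Wm by (intro emeasure_restrict_space) (auto simp: space_restrict_space)
  also have "direction -` B \<inter> space (restrict_space \<nu> W) = {x \<in> E \<inter> finite_part. radius x > 1 \<and> direction x \<in> B}"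
  proof -
    have "f x > 1 \<longleftrightarrow> radius x > 1" if "x \<in> finite_part" for x
      using f_eq_radius[OF that] by (simp add: ennreal_less_iff flip: ennreal_1)
    then show ?thesis using WE by (auto simp: space_restrict_space space_nu W_def)
  qed
  finally show ?thesis .
qed

lemma emeasure_finite_part:
  assumes "A \<in> sets \<nu>"
  shows "emeasure \<nu> (A \<inter> finite_part) = emeasure \<nu> A"
proof -
  have AE: "A \<subseteq> E" using sets.sets_into_space[OF assms] by (simp add: space_nu)
  have N: "E - finite_part \<in> sets \<nu>" by (intro sets_nu_E) auto
  have "emeasure \<nu> (E - finite_part) = 0"
    using nu_infinite_part by (simp add: finite_part_def)
  then have "emeasure \<nu> (A - (E - finite_part)) = emeasure \<nu> A"
    using assms N by (intro emeasure_Diff_null_set) (auto simp: null_sets_def)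
  moreover have "A - (E - finite_part) = A \<inter> finite_part" using AE by auto
  ultimately show ?thesis by simp
qed

lemma emeasure_f_greater_one: "emeasure \<nu> {x. f x > 1} = ennreal mass"
proof -
  have "{x. f x > 1} \<subseteq> {x. ennreal 1 \<le> f x}" by (auto intro: less_imp_le)
  then have "emeasure \<nu> {x. f x > 1} < \<infinity>"
    using radon_level_finite[OF radon, of 1] sets_radon_level[OF radon, of 1] emeasure_mono
    by (metis order.strict_trans1 zero_less_one)
  then show ?thesis by (simp add: mass_def emeasure_eq_ennreal_measure less_top)
qed

lemma emeasure_spectral_sphere: "emeasure (spectral_measure f \<nu>) (unit_sphere f) = ennreal mass"
proof -
  have top: "unit_sphere f \<in> sets (restrict_space borel (unit_sphere f))"
    using sets.top[of "restrict_space borel (unit_sphere f)"] by (simp add: space_restrict_space)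
  have "{x \<in> E \<inter> finite_part. radius x > 1 \<and> direction x \<in> unit_sphere f} = {x. f x > 1} \<inter> finite_part"
  proof -
    have "f x > 1 \<longleftrightarrow> radius x > 1" if "x \<in> finite_part" for x
      using f_eq_radius[OF that] by (simp add: ennreal_less_iff flip: ennreal_1)
    then show ?thesis using direction_sphere f_greater_one_subset by auto
  qed
  then show ?thesis
    using emeasure_spectral[OF top] emeasure_finite_part[of "{x. f x > 1}"] emeasure_f_greater_one
      sets_nu_E[OF borel_open[OF open_f_greater] f_greater_one_subset] by simp
qed

text \<open>Scaling by \<open>r\<close> carries \<open>{radius > 1}\<close> onto
  \<open>{radius > r}\<close> and leaves directions alone, so homogeneity factors the
  measure.\<close>

lemma emeasure_nu_polar_tail:
  assumes r: "r > 0" and B: "B \<in> sets (restrict_space borel (unit_sphere f))"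
  shows "emeasure \<nu> {x \<in> E \<inter> finite_part. radius x > r \<and> direction x \<in> B} =
    ennreal (r powr (- \<alpha>)) * emeasure (spectral_measure f \<nu>) B"
proof -
  have "{x \<in> E. ereal r *s x \<in> {x \<in> E \<inter> finite_part. radius x > r \<and> direction x \<in> B}} =
      {x \<in> E \<inter> finite_part. radius x > 1 \<and> direction x \<in> B}"
    using r E_scale[OF r] finite_part_scale[OF r] radius_scale[OF r] direction_scale[OF r] by auto
  then show ?thesis
    using nu_homogeneous[OF r, of "{x \<in> E \<inter> finite_part. radius x > r \<and> direction x \<in> B}"]
      sets_polar[OF B, of "{r<..}"] emeasure_spectral[OF B] by simp
qed

text \<open>If \<open>{f > 1}\<close> were null, homogeneity would make every level set
  \<open>{f > 1 / (m + 1)}\<close> null. These exhaust \<open>E\<close>, against the nontriviality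
  of \<open>\<nu>\<close>.\<close>

lemma mass_pos: "mass > 0"
proof (rule ccontr)
  assume "\<not> mass > 0"
  then have m0: "ennreal mass = 0" by (simp add: ennreal_neg)
  have "emeasure \<nu> {x. f x > ennreal (1 / (real m + 1))} = 0" for m
  proof -
    define r where "r = 1 / (real m + 1)"
    have r: "r > 0" by (simp add: r_def)
    have sub: "{x. f x > ennreal r} \<subseteq> E" by (auto simp: not_less_zero)
    have s: "{x. f x > ennreal r} \<in> sets \<nu>"
      using sub open_f_greater by (intro sets_nu_E) auto
    have "{x \<in> E. ereal r *s x \<in> {x. f x > ennreal r}} \<subseteq> {x. f x > 1}"
    proof
      fix x assume "x \<in> {x \<in> E. ereal r *s x \<in> {x. f x > ennreal r}}"
      then have less: "ennreal r * 1 < ennreal r * f x" using r by (simp add: f_scale)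
      show "x \<in> {x. f x > 1}"
      proof (rule ccontr)
        assume "x \<notin> {x. f x > 1}"
        then have "f x \<le> 1" by simp
        then have "ennreal r * f x \<le> ennreal r * 1" by (rule mult_left_mono) simp
        then show False using less by simp
      qed
    qed
    moreover have "{x. f x > 1} \<in> sets \<nu>"
      by (rule sets_nu_E[OF borel_open[OF open_f_greater] f_greater_one_subset])
    ultimately have "emeasure \<nu> {x \<in> E. ereal r *s x \<in> {x. f x > ennreal r}} \<le> emeasure \<nu> {x. f x > 1}"
      by (rule emeasure_mono)
    then have "emeasure \<nu> {x \<in> E. ereal r *s x \<in> {x. f x > ennreal r}} = 0"
      unfolding emeasure_f_greater_one m0 by simp
    then show ?thesis using nu_homogeneous[OF r s] by (simp add: r_def)
  qed
  moreover have "{x. f x > ennreal (1 / (real m + 1))} \<in> sets \<nu>" for m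
    using open_f_greater by (intro sets_nu_E) (auto simp: not_less_zero)
  ultimately have "emeasure \<nu> (\<Union>m. {x. f x > ennreal (1 / (real m + 1))}) = 0"
    by (intro emeasure_UN_eq_0) auto
  then show False using nu_E by (simp only: E_eq_levels)
qed

lemma space_angular[simp]: "space angular = unit_sphere f"
  and sets_angular: "sets angular = sets (restrict_space borel (unit_sphere f))"
  by (simp_all add: angular_def space_scale_measure space_spectral sets_spectral)

lemma emeasure_angular:
  "emeasure angular B = ennreal (1 / mass) * emeasure (spectral_measure f \<nu>) B"
  by (simp add: angular_def)

lemma prob_angular: "prob_space angular"
proof
  show "emeasure angular (space angular) = 1"
    using mass_pos by (simp add: emeasure_angular emeasure_spectral_sphere ennreal_mult''[symmetric])
qed

text \<open>\<open>arrival\<close> maps a point to the time \<open>t\<close> at which \<open>c\<^sup>1\<^sup>/\<^sup>\<alpha> t\<^sup>-\<^sup>1\<^sup>/\<^sup>\<alpha>\<close> equals its radius.\<close>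

definition arrival :: "ereal ^ 'd \<Rightarrow> real" where "arrival x = mass * radius x powr (- \<alpha>)"

definition polar_point :: "real \<Rightarrow> real ^ 'd \<Rightarrow> ereal ^ 'd" where
  "polar_point t \<theta> = to_ereal_vec ((mass powr (1 / \<alpha>) * t powr (- 1 / \<alpha>)) *\<^sub>R \<theta>)"

lemma arrival_measurable[measurable]: "arrival \<in> borel_measurable borel"
  unfolding arrival_def[abs_def] by measurable

lemma arrival_pos: "x \<in> finite_part \<Longrightarrow> x \<in> E \<Longrightarrow> arrival x > 0"
  using radius_pos[of x] mass_pos by (simp add: arrival_def)

lemma polar_point_arrival:
  assumes "x \<in> finite_part" "x \<in> E"
  shows "polar_point (arrival x) (direction x) = x"
proof -
  have "(mass * radius x powr (- \<alpha>)) powr (- 1 / \<alpha>) = mass powr (- 1 / \<alpha>) * radius x"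
    using mass_pos radius_pos[OF assms] alpha_pos by (simp add: powr_mult powr_powr)
  moreover have "mass powr (1 / \<alpha>) * mass powr (- 1 / \<alpha>) = 1"
    using mass_pos by (simp flip: powr_add)
  ultimately show ?thesis
    using polar_inverse[OF assms] by (simp add: polar_point_def arrival_def mult.assoc[symmetric])
qed

lemma arrival_less_iff:
  assumes "x \<in> finite_part" "x \<in> E" "s > 0"
  shows "arrival x < s \<longleftrightarrow> (mass / s) powr (1 / \<alpha>) < radius x"
proof -
  note rp = radius_pos[OF assms(1,2)]
  have "arrival x < s \<longleftrightarrow> mass / s < radius x powr \<alpha>"
    using rp assms(3) by (simp add: arrival_def powr_minus field_simps)
  also have "\<dots> \<longleftrightarrow> (mass / s) powr (1 / \<alpha>) < (radius x powr \<alpha>) powr (1 / \<alpha>)"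
    using powr_less_mono2[of "1 / \<alpha>" "mass / s" "radius x powr \<alpha>"]
      powr_mono2[of "1 / \<alpha>" "radius x powr \<alpha>" "mass / s"] alpha_pos
      divide_nonneg_pos[OF less_imp_le[OF mass_pos] assms(3)]
    by (auto simp: not_less[symmetric])
  also have "(radius x powr \<alpha>) powr (1 / \<alpha>) = radius x"
    using rp alpha_pos by (simp add: powr_powr)
  finally show ?thesis .
qed

text \<open>In the variable \<open>arrival\<close> the power tail becomes linear:
  \<open>arrival x < s\<close> means \<open>radius x > r\<close> with
  \<open>r = (mass / s) powr (1 / \<alpha>)\<close>, and then
  \<open>r powr (- \<alpha>) = s / mass\<close>. The divisor \<open>mass\<close> normalises the
  spectral measure.\<close>

lemma emeasure_nu_arrival_less:
  assumes s: "s > 0" and B: "B \<in> sets angular"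
  shows "emeasure \<nu> {x \<in> E \<inter> finite_part. arrival x < s \<and> direction x \<in> B} = ennreal s * emeasure angular B"
proof -
  define r where "r = (mass / s) powr (1 / \<alpha>)"
  have r: "r > 0" using mass_pos s by (simp add: r_def)
  have "{x \<in> E \<inter> finite_part. arrival x < s \<and> direction x \<in> B} =
      {x \<in> E \<inter> finite_part. radius x > r \<and> direction x \<in> B}"
    using arrival_less_iff s by (auto simp: r_def)
  moreover have "r powr (- \<alpha>) = s * (1 / mass)"
    using mass_pos s alpha_pos by (simp add: r_def powr_powr powr_minus)
  ultimately show ?thesis
    using emeasure_nu_polar_tail[OF r B[unfolded sets_angular]] s mass_pos
    by (simp add: emeasure_angular ennreal_mult'' mult.assoc[symmetric] del: times_divide_eq_right)
qed

text \<open>For fixed \<open>B\<close> both sides are measures in \<open>A\<close>. They agree and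
  are finite on the half-lines \<open>{..<s}\<close>, an intersection-stable generator; arrivals are
  positive, so half-lines unbounded to the left cost nothing.\<close>

lemma emeasure_nu_arrival:
  assumes B: "B \<in> sets angular" and A: "A \<in> sets borel"
  shows "emeasure \<nu> {x \<in> E \<inter> finite_part. arrival x \<in> A \<and> direction x \<in> B} =
    emeasure lborel (A \<inter> {0<..}) * emeasure angular B"
proof -
  interpret angular: prob_space angular by (rule prob_angular)
  define W where "W = {x \<in> E \<inter> finite_part. direction x \<in> B}"
  have W: "W \<in> sets \<nu>" using sets_polar[OF B[unfolded sets_angular], of UNIV] by (simp add: W_def)
  define \<kappa>1 where "\<kappa>1 = distr (restrict_space \<nu> W) borel arrival"
  define \<kappa>2 where "\<kappa>2 = scale_measure (emeasure angular B) (distr (restrict_space lborel {0<..}) borel (\<lambda>t :: real. t))"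
  have am: "arrival \<in> borel_measurable (restrict_space \<nu> W)"
    by (intro measurable_restrict_space1 radon_measurable[OF radon] arrival_measurable)
  have idm: "(\<lambda>t. t) \<in> measurable (restrict_space lborel {0<..}) (borel :: real measure)"
    by (rule measurable_restrict_space1) simp
  have e1: "emeasure \<kappa>1 A = emeasure \<nu> {x \<in> E \<inter> finite_part. arrival x \<in> A \<and> direction x \<in> B}" if "A \<in> sets borel" for A
  proof -
    have "emeasure \<kappa>1 A = emeasure (restrict_space \<nu> W) (arrival -` A \<inter> space (restrict_space \<nu> W))"
      unfolding \<kappa>1_def using am that by (rule emeasure_distr)
    also have "\<dots> = emeasure \<nu> (arrival -` A \<inter> space (restrict_space \<nu> W))"
      using W by (intro emeasure_restrict_space) (auto simp: space_restrict_space)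
    also have "arrival -` A \<inter> space (restrict_space \<nu> W) = {x \<in> E \<inter> finite_part. arrival x \<in> A \<and> direction x \<in> B}"
      by (auto simp: space_restrict_space space_nu W_def)
    finally show ?thesis .
  qed
  have e2: "emeasure \<kappa>2 A = emeasure lborel (A \<inter> {0<..}) * emeasure angular B" if "A \<in> sets borel" for A
  proof -
    have "emeasure \<kappa>2 A = emeasure angular B * emeasure (restrict_space lborel {0<..}) (A \<inter> {0<..})"
      unfolding \<kappa>2_def using that idm by (simp add: emeasure_distr space_restrict_space)
    also have "emeasure (restrict_space lborel {0<..}) (A \<inter> {0<..}) = emeasure lborel (A \<inter> {0<..})"
      by (intro emeasure_restrict_space) auto
    finally show ?thesis by (simp add: mult.commute)
  qed
  have less: "emeasure \<kappa>1 {..<s} = ennreal (max 0 s) * emeasure angular B \<and>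
      emeasure \<kappa>2 {..<s} = ennreal (max 0 s) * emeasure angular B" for s
  proof (cases "s > 0")
    case True
    have "{..<s} \<inter> {0<..} = {0<..<s}" by auto
    then show ?thesis using emeasure_nu_arrival_less[OF True B] True by (simp add: e1 e2)
  next
    case False
    then have z: "{x \<in> E \<inter> finite_part. arrival x \<in> {..<s} \<and> direction x \<in> B} = {}" "{..<s} \<inter> {0<..} = {}"
      using arrival_pos by fastforce+
    show ?thesis
      using e1[of "{..<s}"] e2[of "{..<s}"] False unfolding z by (simp add: max_def)
  qed
  have "\<kappa>1 = \<kappa>2"
  proof (rule measure_eqI_generator_eq[where E = "range lessThan" and \<Omega> = UNIV and A = "\<lambda>i. {..<real i}"])
    have "{..<a} \<inter> {..<b} = {..<min a b}" for a b :: real by auto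
    then show "Int_stable (range (lessThan :: real \<Rightarrow> _))" by (auto simp: Int_stable_def)
    show "sets \<kappa>1 = sigma_sets UNIV (range lessThan)" "sets \<kappa>2 = sigma_sets UNIV (range lessThan)"
      by (simp_all add: \<kappa>1_def \<kappa>2_def borel_Iio)
    show "emeasure \<kappa>1 {..<real i} \<noteq> \<infinity>" for i
      using less[of "real i"] angular.emeasure_finite by (simp add: ennreal_mult_eq_top_iff)
    show "(\<Union>i. {..<real i}) = UNIV" using reals_Archimedean2 by auto
  qed (use less in auto)
  then show ?thesis using e1[OF A] e2[OF A] by simp
qed

lemma polar_point_measurable:
  "(\<lambda>(t, \<theta>). polar_point t \<theta>) \<in> borel_measurable (restrict_space lborel {0<..} \<Otimes>\<^sub>M angular)"
proof -
  have 1[measurable]: "(\<lambda>t. t) \<in> borel_measurable (restrict_space lborel {0 :: real<..})"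
    by (rule measurable_restrict_space1) simp
  have "(\<lambda>\<theta>. \<theta>) \<in> borel_measurable (restrict_space borel (unit_sphere f))"
    by (rule measurable_restrict_space1) simp
  then have 2[measurable]: "(\<lambda>\<theta>. \<theta>) \<in> borel_measurable angular"
    using measurable_cong_sets[OF sets_angular refl] by blast
  have [measurable]: "(\<lambda>p. fst p) \<in> borel_measurable (restrict_space lborel {0 :: real<..} \<Otimes>\<^sub>M angular)"
    by (rule measurable_compose[OF measurable_fst 1])
  have [measurable]: "(\<lambda>p. snd p) \<in> borel_measurable (restrict_space lborel {0 :: real<..} \<Otimes>\<^sub>M angular)"
    by (rule measurable_compose[OF measurable_snd 2])
  show ?thesis unfolding polar_point_def case_prod_beta by measurable
qed

lemma sigma_finite_arrival: "sigma_finite_measure (restrict_space lborel {0 :: real<..})"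
  by (intro sigma_finite_measure_restrict_space sigma_finite_lborel) auto

text \<open>On \<open>E \<inter> finite_part\<close> the map to arrival and direction pushes
  \<open>\<nu>\<close> forward to the product of Lebesgue measure and \<open>angular\<close>;
  \<open>polar_point\<close> undoes this map, and Tonelli splits the integral.\<close>

lemma nn_integral_polar:
  assumes g: "g \<in> borel_measurable borel"
  shows "(\<integral>\<^sup>+x. g x \<partial>\<nu>) = (\<integral>\<^sup>+t. \<integral>\<^sup>+\<theta>. g (polar_point t \<theta>) \<partial>angular \<partial>restrict_space lborel {0<..})"
proof -
  interpret angular: prob_space angular by (rule prob_angular)
  let ?L = "restrict_space lborel {0 :: real<..}"
  let ?R = "restrict_space \<nu> (E \<inter> finite_part)"
  have fp: "E \<inter> finite_part \<in> sets \<nu>" by (intro sets_nu_E) auto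
  have fpm: "E \<inter> finite_part \<inter> space \<nu> \<in> sets \<nu>" using fp by auto
  have am: "arrival \<in> measurable ?R ?L"
  proof -
    have "arrival \<in> measurable ?R (restrict_space borel {0<..})"
    proof (rule measurable_restrict_space2)
      show "arrival \<in> space ?R \<rightarrow> {0<..}" using arrival_pos by (auto simp: space_restrict_space)
      show "arrival \<in> borel_measurable ?R"
        by (intro measurable_restrict_space1 radon_measurable[OF radon] arrival_measurable)
    qed
    moreover have "sets (restrict_space borel {0<..}) = sets ?L" by (simp add: sets_restrict_space)
    ultimately show ?thesis using measurable_cong_sets[OF refl] by blast
  qed
  have dm: "direction \<in> measurable ?R angular"
  proof -
    have "direction \<in> measurable ?R (restrict_space borel (unit_sphere f))"
    proof (rule measurable_restrict_space2)
      show "direction \<in> space ?R \<rightarrow> unit_sphere f" using direction_sphere by (auto simp: space_restrict_space)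
      show "direction \<in> borel_measurable ?R"
        by (intro measurable_restrict_space1 radon_measurable[OF radon] direction_measurable)
    qed
    then show ?thesis using measurable_cong_sets[OF refl sets_angular] by blast
  qed
  have pm: "(\<lambda>x. (arrival x, direction x)) \<in> measurable ?R (?L \<Otimes>\<^sub>M angular)"
    using am dm by (rule measurable_Pair)
  have eq: "?L \<Otimes>\<^sub>M angular = distr ?R (?L \<Otimes>\<^sub>M angular) (\<lambda>x. (arrival x, direction x))"
  proof (rule pair_measure_eqI[OF sigma_finite_arrival angular.sigma_finite_measure_axioms])
    fix A B assume A: "A \<in> sets ?L" and B: "B \<in> sets angular"
    have A': "A \<in> sets borel" "A \<subseteq> {0<..}" using A by (auto simp: sets_restrict_space)
    have "emeasure (distr ?R (?L \<Otimes>\<^sub>M angular) (\<lambda>x. (arrival x, direction x))) (A \<times> B) =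
        emeasure ?R ((\<lambda>x. (arrival x, direction x)) -` (A \<times> B) \<inter> space ?R)"
      using pm A B by (intro emeasure_distr) auto
    also have "\<dots> = emeasure \<nu> ((\<lambda>x. (arrival x, direction x)) -` (A \<times> B) \<inter> space ?R)"
      using fpm by (intro emeasure_restrict_space) (auto simp: space_restrict_space)
    also have "(\<lambda>x. (arrival x, direction x)) -` (A \<times> B) \<inter> space ?R =
        {x \<in> E \<inter> finite_part. arrival x \<in> A \<and> direction x \<in> B}"
      by (auto simp: space_restrict_space space_nu)
    also have "emeasure \<nu> \<dots> = emeasure lborel (A \<inter> {0<..}) * emeasure angular B"
      by (rule emeasure_nu_arrival[OF B A'(1)])
    also have "emeasure lborel (A \<inter> {0<..}) = emeasure ?L A"
      using A' by (subst emeasure_restrict_space) (auto simp: Int_absorb2)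
    finally show "emeasure ?L A * emeasure angular B =
        emeasure (distr ?R (?L \<Otimes>\<^sub>M angular) (\<lambda>x. (arrival x, direction x))) (A \<times> B)" by simp
  qed simp
  have gp: "(\<lambda>p. g (case p of (t, \<theta>) \<Rightarrow> polar_point t \<theta>)) \<in> borel_measurable (?L \<Otimes>\<^sub>M angular)"
    by (rule measurable_compose[OF polar_point_measurable g])
  have "(\<integral>\<^sup>+x. g x \<partial>\<nu>) = (\<integral>\<^sup>+x. g x * indicator (E \<inter> finite_part) x \<partial>\<nu>)"
  proof (rule nn_integral_cong_AE)
    have "E - finite_part \<in> null_sets \<nu>"
      using nu_infinite_part by (auto simp: null_sets_def finite_part_def[symmetric] intro!: sets_nu_E)
    from AE_not_in[OF this] AE_space
    show "AE x in \<nu>. g x = g x * indicator (E \<inter> finite_part) x"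
      by eventually_elim (auto simp: space_nu indicator_def)
  qed
  also have "\<dots> = (\<integral>\<^sup>+x. g x \<partial>?R)"
    using fpm by (simp add: nn_integral_restrict_space)
  also have "\<dots> = (\<integral>\<^sup>+x. g (polar_point (arrival x) (direction x)) \<partial>?R)"
    by (intro nn_integral_cong) (simp add: space_restrict_space polar_point_arrival)
  also have "\<dots> = (\<integral>\<^sup>+p. g (case p of (t, \<theta>) \<Rightarrow> polar_point t \<theta>) \<partial>distr ?R (?L \<Otimes>\<^sub>M angular) (\<lambda>x. (arrival x, direction x)))"
    using pm gp by (simp add: nn_integral_distr)
  also have "\<dots> = (\<integral>\<^sup>+p. g (case p of (t, \<theta>) \<Rightarrow> polar_point t \<theta>) \<partial>(?L \<Otimes>\<^sub>M angular))"
    by (simp flip: eq)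
  also have "\<dots> = (\<integral>\<^sup>+t. \<integral>\<^sup>+\<theta>. g (polar_point t \<theta>) \<partial>angular \<partial>?L)"
    using angular.nn_integral_fst[OF gp] by simp
  finally show ?thesis .
qed

end

section \<open>Convergence of the sample\<close>

context regularly_varying
begin

text \<open>The exponent of the Poisson process \<open>\<nu>\<close> equals that of a unit rate
  process on the half-line, with the average of \<open>exp (- h)\<close> over directions in place of
  \<open>exp (- h)\<close>. This averaged function returns as \<open>G\<close> in
  \<open>series_laplace\<close>.\<close>

lemma laplace_exponent_polar:
  assumes h: "h \<in> Cc0" "\<And>x. 0 \<le> h x"
  shows "(\<integral>t. 1 - (\<integral>\<theta>. exp (- h (polar_point t \<theta>)) \<partial>angular) \<partial>restrict_space lborel {0<..}) =
    (\<integral>x. 1 - exp (- h x) \<partial>\<nu>)"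
    and "(\<lambda>t. \<integral>\<theta>. exp (- h (polar_point t \<theta>)) \<partial>angular) \<in> borel_measurable (restrict_space lborel {0<..})"
proof -
  interpret angular: prob_space angular by (rule prob_angular)
  let ?L = "restrict_space lborel {0 :: real<..}"
  define H where "H x = 1 - exp (- h x)" for x
  have H: "0 \<le> H x" "H x \<le> 1" for x using h(2) by (auto simp: H_def)
  have hm[measurable]: "h \<in> borel_measurable borel" by (rule Cc0_measurable[OF h(1)])
  have Hm[measurable]: "H \<in> borel_measurable borel" unfolding H_def[abs_def] by measurable
  have pp: "(\<lambda>p. h (case p of (t, \<theta>) \<Rightarrow> polar_point t \<theta>)) \<in> borel_measurable (?L \<Otimes>\<^sub>M angular)"
    by (rule measurable_compose[OF polar_point_measurable hm])
  then have "(\<lambda>p. exp (- h (case p of (t, \<theta>) \<Rightarrow> polar_point t \<theta>))) \<in> borel_measurable (?L \<Otimes>\<^sub>M angular)"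
    by (rule borel_measurable_exp_uminus)
  then have "(\<lambda>(t, \<theta>). exp (- h (polar_point t \<theta>))) \<in> borel_measurable (?L \<Otimes>\<^sub>M angular)"
    by (simp add: case_prod_beta)
  then show gm: "(\<lambda>t. \<integral>\<theta>. exp (- h (polar_point t \<theta>)) \<partial>angular) \<in> borel_measurable ?L"
    by (rule angular.borel_measurable_lebesgue_integral)
  have sec: "(\<lambda>\<theta>. polar_point t \<theta>) \<in> borel_measurable angular" if "t > 0" for t
    using measurable_Pair2[OF polar_point_measurable, of t] that by (simp add: space_restrict_space)
  have inner: "ennreal (1 - (\<integral>\<theta>. exp (- h (polar_point t \<theta>)) \<partial>angular)) =
      (\<integral>\<^sup>+\<theta>. ennreal (H (polar_point t \<theta>)) \<partial>angular)" if t: "t > 0" for t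
  proof -
    note [measurable] = sec[OF t]
    have i1: "integrable angular (\<lambda>\<theta>. exp (- h (polar_point t \<theta>)))"
      using h(2) by (intro angular.integrable_const_bound[of _ 1] AE_I2) auto
    then have "1 - (\<integral>\<theta>. exp (- h (polar_point t \<theta>)) \<partial>angular) = (\<integral>\<theta>. H (polar_point t \<theta>) \<partial>angular)"
      using angular.prob_space by (simp add: H_def)
    moreover have "integrable angular (\<lambda>\<theta>. H (polar_point t \<theta>))"
      using H by (intro angular.integrable_const_bound[of _ 1] AE_I2) auto
    ultimately show ?thesis using H by (simp add: nn_integral_eq_integral)
  qed
  have nonneg: "0 \<le> 1 - (\<integral>\<theta>. exp (- h (polar_point t \<theta>)) \<partial>angular)" for t
  proof -
    have "(\<integral>\<theta>. exp (- h (polar_point t \<theta>)) \<partial>angular) \<le> 1"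
    \<comment> \<open>The bound is stated for every real \<open>t\<close>; a non-integrable
      integrand would have integral 0 by convention.\<close>
    proof (cases "integrable angular (\<lambda>\<theta>. exp (- h (polar_point t \<theta>)))")
      case True
      then have "(\<integral>\<theta>. exp (- h (polar_point t \<theta>)) \<partial>angular) \<le> (\<integral>\<theta>. 1 \<partial>angular)"
        using h(2) by (intro integral_mono) auto
      then show ?thesis using angular.prob_space by simp
    qed (simp add: not_integrable_integral_eq)
    then show ?thesis by simp
  qed
  have "(\<integral>t. 1 - (\<integral>\<theta>. exp (- h (polar_point t \<theta>)) \<partial>angular) \<partial>?L) =
      enn2real (\<integral>\<^sup>+t. ennreal (1 - (\<integral>\<theta>. exp (- h (polar_point t \<theta>)) \<partial>angular)) \<partial>?L)"
    using gm nonneg by (intro integral_eq_nn_integral AE_I2) auto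
  also have "(\<integral>\<^sup>+t. ennreal (1 - (\<integral>\<theta>. exp (- h (polar_point t \<theta>)) \<partial>angular)) \<partial>?L) =
      (\<integral>\<^sup>+t. \<integral>\<^sup>+\<theta>. ennreal (H (polar_point t \<theta>)) \<partial>angular \<partial>?L)"
    by (intro nn_integral_cong inner) (simp add: space_restrict_space)
  also have "\<dots> = (\<integral>\<^sup>+x. ennreal (H x) \<partial>\<nu>)"
    by (rule nn_integral_polar[symmetric]) measurable
  also have "enn2real \<dots> = (\<integral>x. H x \<partial>\<nu>)"
    using H radon_measurable[OF radon Hm] by (intro integral_eq_nn_integral[symmetric] AE_I2) auto
  finally show "(\<integral>t. 1 - (\<integral>\<theta>. exp (- h (polar_point t \<theta>)) \<partial>angular) \<partial>?L) = (\<integral>x. 1 - exp (- h x) \<partial>\<nu>)"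
    by (simp add: H_def)
qed

lemma poisson_laplace:
  assumes N: "poisson_process P E \<nu> N" and h: "h \<in> Cc0" "\<And>x. 0 \<le> h x"
  shows "(\<integral>\<omega>. exp (- (\<integral>x. h x \<partial>N \<omega>)) \<partial>P) = exp (- (\<integral>x. 1 - exp (- h x) \<partial>\<nu>))"
proof -
  have Nm: "N \<in> measurable P (borel_of (vague_topology E))" using N by (simp add: poisson_process_def)
  obtain b where b: "\<And>x. \<bar>h x\<bar> \<le> b" using Cc0_bounded[OF h(1)] by blast
  obtain r where r: "r > 0" "\<And>x. h x \<noteq> 0 \<Longrightarrow> ennreal r \<le> f x" using h(1) by (auto simp: Cc0_def)
  show ?thesis
  proof (rule poisson_process_laplace[OF N])
    show "sets (N \<omega>) = sets \<nu>" if "\<omega> \<in> space P" for \<omega>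
      using measurable_space[OF Nm that] radon_sets[OF point_measures_radon] radon_sets[OF radon]
      by (simp add: topspace_vague)
    show "h \<in> borel_measurable \<nu>" by (rule radon_measurable[OF radon Cc0_measurable[OF h(1)]])
    show "h x \<le> b" for x using b[of x] by simp
    have "emeasure \<nu> {x \<in> space \<nu>. h x \<noteq> 0} \<le> emeasure \<nu> {x. ennreal r \<le> f x}"
      using r by (intro emeasure_mono sets_radon_level[OF radon]) auto
    also have "\<dots> < \<infinity>" using r by (intro radon_level_finite[OF radon]) auto
    finally show "emeasure \<nu> {x \<in> space \<nu>. h x \<noteq> 0} < \<infinity>" .
    show "(\<lambda>\<omega>. \<integral>x. h x \<partial>N \<omega>) \<in> borel_measurable P" by (rule vague_integral_measurable[OF Nm h(1)])
  qed (rule h(2))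
qed

definition sample :: "(nat \<Rightarrow> 'w \<Rightarrow> real ^ 'd) \<Rightarrow> nat \<Rightarrow> 'w \<Rightarrow> (ereal ^ 'd) measure" where
  "sample X n \<omega> = counting_measure E {1..n} (\<lambda>i. scaled n (X i \<omega>))"

lemma sample_integral:
  "h \<in> Cc0 \<Longrightarrow> (\<integral>x. h x \<partial>sample X n \<omega>) = (\<Sum>i\<in>{1..n}. h (scaled n (X i \<omega>)))"
  unfolding sample_def by (intro integral_counting) auto

lemma sample_measurable:
  assumes X: "\<And>i. i \<ge> 1 \<Longrightarrow> X i \<in> borel_measurable M"
  shows "sample X n \<in> measurable M (borel_of (vague_topology E))"
proof (rule measurable_vague)
  show "sample X n \<omega> \<in> point_measures E" for \<omega>
    unfolding sample_def by (intro counting_point_measure) auto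
  fix h :: "ereal ^ 'd \<Rightarrow> real" assume h: "h \<in> Cc0"
  have "(\<lambda>\<omega>. h (scaled n (X i \<omega>))) \<in> borel_measurable M" if "i \<in> {1..n}" for i
    using that by (intro measurable_compose[OF measurable_compose[OF X scaled_measurable] Cc0_measurable[OF h]]) auto
  then show "(\<lambda>\<omega>. \<integral>x. h x \<partial>sample X n \<omega>) \<in> borel_measurable M"
    unfolding sample_integral[OF h] by (rule borel_measurable_sum)
qed

lemma sample_laplace:
  assumes M: "prob_space M" and indep: "prob_space.indep_vars M (\<lambda>_. borel) X {1..}"
    and copies: "\<And>i. i \<ge> 1 \<Longrightarrow> distr M borel (X i) = distr M\<^sub>0 borel X\<^sub>0"
    and h: "h \<in> Cc0" "\<And>x. 0 \<le> h x"
  shows "(\<lambda>n. \<integral>\<omega>. exp (- (\<integral>x. h x \<partial>sample X n \<omega>)) \<partial>M) \<longlonglongrightarrow> exp (- (\<integral>x. 1 - exp (- h x) \<partial>\<nu>))"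
proof -
  interpret M: prob_space M by fact
  interpret M0: prob_space M\<^sub>0 by (rule prob_M0)
  note [measurable] = Cc0_measurable[OF h(1)]
  \<comment> \<open>Since it vanishes with \<open>h\<close>, \<open>1 - exp (- h)\<close> is again a
    test function, and regular variation can be applied to it.\<close>
  have H: "(\<lambda>x. 1 - exp (- h x)) \<in> Cc0"
    by (rule Cc0_compose[OF h(1)]) (auto intro!: continuous_intros)
  define y where "y n = real n * (\<integral>\<omega>. 1 - exp (- h (scaled n (X\<^sub>0 \<omega>))) \<partial>M\<^sub>0)" for n
  have lim: "y \<longlonglongrightarrow> (\<integral>x. 1 - exp (- h x) \<partial>\<nu>)" unfolding y_def by (rule vague_limit[OF H])
  have int: "integrable M\<^sub>0 (\<lambda>\<omega>. exp (- h (scaled n (X\<^sub>0 \<omega>))))" for n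
    using h(2) by (intro M0.integrable_const_bound[of _ 1] AE_I2) auto
  have "(\<integral>\<omega>. exp (- (\<integral>x. h x \<partial>sample X n \<omega>)) \<partial>M) = (1 - y n / real n) ^ n" for n
  proof -
    have "(\<integral>\<omega>. exp (- (\<integral>x. h x \<partial>sample X n \<omega>)) \<partial>M) =
        (\<integral>\<omega>. (\<Prod>i\<in>{1..n}. exp (- h (scaled n (X i \<omega>)))) \<partial>M)"
      by (simp add: sample_integral[OF h(1)] exp_sum flip: sum_negf)
    also have "\<dots> = (\<integral>\<omega>. exp (- h (scaled n (X\<^sub>0 \<omega>))) \<partial>M\<^sub>0) ^ n"
      using h(2) by (intro M.iid_power_expectation[OF indep _ copies, where g = "\<lambda>x. exp (- h (scaled n x))" and b = 1]) auto
    also have "\<dots> = (1 - y n / real n) ^ n"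
      using int by (cases "n = 0") (simp_all add: y_def M0.prob_space)
    finally show ?thesis .
  qed
  moreover have "0 \<le> y n \<and> y n \<le> real n" for n
  proof -
    have "0 \<le> (\<integral>\<omega>. 1 - exp (- h (scaled n (X\<^sub>0 \<omega>))) \<partial>M\<^sub>0)"
      using h(2) by (intro Bochner_Integration.integral_nonneg) auto
    moreover have "(\<integral>\<omega>. 1 - exp (- h (scaled n (X\<^sub>0 \<omega>))) \<partial>M\<^sub>0) \<le> (\<integral>\<omega>. 1 \<partial>M\<^sub>0)"
      using int by (intro integral_mono) auto
    ultimately show ?thesis by (simp add: y_def M0.prob_space mult_left_le)
  qed
  ultimately show ?thesis using tendsto_one_minus_over_n_power[OF lim] by simp
qed

theorem sample_converges_to_poisson:
  assumes M: "prob_space M" and indep: "prob_space.indep_vars M (\<lambda>_. borel) X {1..}"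
    and copies: "\<And>i. i \<ge> 1 \<Longrightarrow> distr M borel (X i) = distr M\<^sub>0 borel X\<^sub>0"
    and N: "poisson_process P E \<nu> N"
  shows "converges_in_distribution (vague_topology E) M (sample X) P N"
proof -
  interpret M: prob_space M by fact
  have P: "prob_space P" and Nm: "N \<in> measurable P (borel_of (vague_topology E))"
    using N by (auto simp: poisson_process_def)
  have Xm: "X i \<in> borel_measurable M" if "i \<ge> 1" for i
    using indep that by (auto simp: M.indep_vars_def)
  note Sm = sample_measurable[OF Xm]
  show ?thesis
    by (intro converges_in_distribution_of_open_sets M P Sm Nm laplace_open_set_lower_bound)
      (simp_all add: poisson_laplace[OF N] sample_laplace[OF M indep copies])
qed

end

section \<open>Arrival times with independent marks\<close>

lemma arrivals_point_measure:
  assumes "standard_poisson_arrivals Q \<Gamma>" "\<omega> \<in> space Q"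
  shows "counting_measure {0<..} {1..} (\<lambda>k. \<Gamma> k \<omega>) \<in> point_measures {0 :: real<..}"
proof -
  have "(\<lambda>\<omega>. counting_measure {0<..} {1..} (\<lambda>k. \<Gamma> k \<omega>)) \<in> measurable Q (borel_of (vague_topology {0 :: real<..}))"
    using assms(1) by (simp add: standard_poisson_arrivals_def poisson_process_def)
  from measurable_space[OF this assms(2)] show ?thesis by (simp add: topspace_vague)
qed

lemma arrivals_strict_mono:
  assumes "standard_poisson_arrivals Q \<Gamma>" "\<omega> \<in> space Q" "1 \<le> i" "i < j"
  shows "\<Gamma> i \<omega> < \<Gamma> j \<omega>"
  using assms(4,3)
proof (induction rule: less_Suc_induct)
  case (1 i)
  then show ?case using assms(1,2) by (auto simp: standard_poisson_arrivals_def)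
next
  case (2 i j k)
  then show ?case by force
qed

lemma arrivals_pos:
  assumes "standard_poisson_arrivals Q \<Gamma>" "\<omega> \<in> space Q" "1 \<le> i"
  shows "0 < \<Gamma> i \<omega>"
proof -
  have "0 < \<Gamma> 1 \<omega>" using assms by (auto simp: standard_poisson_arrivals_def)
  then show ?thesis using arrivals_strict_mono[OF assms(1,2), of 1 i] assms(3) by (cases "i = 1") auto
qed

lemma finite_of_count_space_finite:
  "emeasure (count_space UNIV) A < \<infinity> \<Longrightarrow> finite A"
  by (cases "finite A") (auto simp: emeasure_count_space)

text \<open>A point measure on the open half-line may be infinite near 0, so local finiteness is
  used on the compact interval from the first arrival to \<open>b\<close>, which contains every
  arrival up to \<open>b\<close>.\<close>

lemma arrivals_finite:
  assumes "standard_poisson_arrivals Q \<Gamma>" "\<omega> \<in> space Q"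
  shows "finite {k \<in> {1..}. \<Gamma> k \<omega> \<le> b}"
proof -
  define K where "K = {\<Gamma> 1 \<omega>..b}"
  have pos: "0 < \<Gamma> 1 \<omega>" using arrivals_pos[OF assms] by simp
  have K: "compact K" "K \<subseteq> {0<..}" using pos by (auto simp: K_def)
  have "K \<in> sets (restrict_space borel {0<..})" using K by (subst sets_restrict_space_iff) (auto simp: K_def)
  moreover have "emeasure (counting_measure {0<..} {1..} (\<lambda>k. \<Gamma> k \<omega>)) K < \<infinity>"
    using arrivals_point_measure[OF assms] K unfolding point_measures_def radon_measure_on_def by blast
  ultimately have "emeasure (count_space UNIV) {k \<in> {1..}. \<Gamma> k \<omega> \<in> K} < \<infinity>"
    by (simp add: emeasure_counting)
  then have "finite {k \<in> {1..}. \<Gamma> k \<omega> \<in> K}" by (rule finite_of_count_space_finite)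
  moreover have "\<Gamma> 1 \<omega> \<le> \<Gamma> k \<omega>" if "k \<ge> 1" for k
    using arrivals_strict_mono[OF assms, of 1 k] that by (cases "k = 1") auto
  then have "{k \<in> {1..}. \<Gamma> k \<omega> \<le> b} \<subseteq> {k \<in> {1..}. \<Gamma> k \<omega> \<in> K}" by (auto simp: K_def)
  ultimately show ?thesis by (rule rev_finite_subset)
qed

text \<open>\<open>standard_poisson_arrivals\<close> constrains the counting process; single arrival
  times are recovered from it. Because the times increase strictly, the \<open>k\<close>-th one is
  at most \<open>t\<close> exactly if \<open>{0<..t}\<close> contains at least \<open>k\<close> of
  them.\<close>

lemma arrivals_measurable:
  assumes std: "standard_poisson_arrivals Q \<Gamma>" and k: "1 \<le> k"
  shows "\<Gamma> k \<in> borel_measurable Q"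
proof (rule borel_measurableI_le)
  fix t :: real
  define N where "N \<omega> = counting_measure {0 :: real<..} {1..} (\<lambda>k. \<Gamma> k \<omega>)" for \<omega>
  have pp: "poisson_process Q {0<..} (restrict_space lborel {0<..}) N"
    using std unfolding standard_poisson_arrivals_def N_def[abs_def] by blast
  interpret prob_space Q using pp by (simp add: poisson_process_def)
  show "{\<omega> \<in> space Q. \<Gamma> k \<omega> \<le> t} \<in> sets Q"
  proof (cases "t > 0")
    case False
    then have "{\<omega> \<in> space Q. \<Gamma> k \<omega> \<le> t} = {}" using arrivals_pos[OF std _ k] by force
    then show ?thesis by (metis sets.empty_sets)
  next
    case True
    have S: "{0<..t} \<in> sets (restrict_space borel {0<..})" by (subst sets_restrict_space_iff) auto
    have S': "{0<..t} \<in> sets (restrict_space lborel {0<..})" by (subst sets_restrict_space_iff) auto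
    have "indep_vars (\<lambda>_. borel) (\<lambda>j \<omega>. emeasure (N \<omega>) ((\<lambda>_. {0<..t}) j)) {0::nat}"
      using pp S' by (auto simp: poisson_process_def disjoint_family_on_def)
    then have [measurable]: "(\<lambda>\<omega>. emeasure (N \<omega>) {0<..t}) \<in> borel_measurable Q"
      by (auto simp: indep_vars_def)
    have "\<Gamma> k \<omega> \<le> t \<longleftrightarrow> of_nat k \<le> emeasure (N \<omega>) {0<..t}" if \<omega>: "\<omega> \<in> space Q" for \<omega>
    proof -
      define A where "A = {i \<in> {1..}. \<Gamma> i \<omega> \<in> {0<..t}}"
      have A: "A = {i \<in> {1..}. \<Gamma> i \<omega> \<le> t}" using arrivals_pos[OF std \<omega>] by (auto simp: A_def)
      have fin: "finite A" unfolding A by (rule arrivals_finite[OF std \<omega>])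
      have "emeasure (N \<omega>) {0<..t} = of_nat (card A)"
        using fin unfolding N_def emeasure_counting[OF S] A_def[symmetric] by (simp add: emeasure_count_space)
      moreover have "\<Gamma> k \<omega> \<le> t \<longleftrightarrow> k \<le> card A"
      proof
        assume *: "\<Gamma> k \<omega> \<le> t"
        have "{1..k} \<subseteq> A"
        proof
          fix i assume i: "i \<in> {1..k}"
          then have "\<Gamma> i \<omega> \<le> \<Gamma> k \<omega>" using arrivals_strict_mono[OF std \<omega>, of i k] by (cases "i = k") auto
          then show "i \<in> A" using i * by (auto simp: A)
        qed
        from card_mono[OF fin this] show "k \<le> card A" by simp
      next
        assume *: "k \<le> card A"
        show "\<Gamma> k \<omega> \<le> t"
        proof (rule ccontr)
          assume n: "\<not> \<Gamma> k \<omega> \<le> t"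
          have "A \<subseteq> {1..<k}"
          proof
            fix i assume i: "i \<in> A"
            have "\<not> k \<le> i"
            proof
              assume "k \<le> i"
              then have "\<Gamma> k \<omega> \<le> \<Gamma> i \<omega>" using arrivals_strict_mono[OF std \<omega> k, of i] by (cases "i = k") auto
              then show False using n i by (auto simp: A)
            qed
            then show "i \<in> {1..<k}" using i by (auto simp: A)
          qed
          then have "card A \<le> card {1..<k}" by (intro card_mono) auto
          then show False using * k by simp
        qed
      qed
      ultimately show ?thesis by simp
    qed
    then have "{\<omega> \<in> space Q. \<Gamma> k \<omega> \<le> t} = {\<omega> \<in> space Q. of_nat k \<le> emeasure (N \<omega>) {0<..t}}" by auto
    also have "\<dots> \<in> sets Q" by measurable
    finally show ?thesis .
  qed
qed

lemma arrivals_measurable_restrict: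
  assumes std: "standard_poisson_arrivals Q \<Gamma>" and k: "1 \<le> k"
  shows "\<Gamma> k \<in> measurable Q (restrict_space lborel {0<..})"
proof -
  have "\<Gamma> k \<in> measurable Q (restrict_space borel {0<..})"
    using arrivals_measurable[OF std k] arrivals_pos[OF std _ k]
    by (intro measurable_restrict_space2) auto
  moreover have "sets (restrict_space borel {0<..}) = sets (restrict_space lborel {0 :: real<..})"
    by (simp add: sets_restrict_space)
  ultimately show ?thesis using measurable_cong_sets[OF refl] by blast
qed

lemma arrivals_partial_sums_tendsto:
  assumes std: "standard_poisson_arrivals Q \<Gamma>" and \<omega>: "\<omega> \<in> space Q"
    and g: "g \<in> borel_measurable (restrict_space lborel {0<..})" "\<And>t. t > t0 \<Longrightarrow> g t = (0 :: real)"
  shows "(\<lambda>K. \<Sum>k\<in>{1..K}. g (\<Gamma> k \<omega>)) \<longlonglongrightarrow> (\<integral>t. g t \<partial>counting_measure {0<..} {1..} (\<lambda>k. \<Gamma> k \<omega>))"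
proof -
  have "finite {k \<in> {1..}. \<Gamma> k \<omega> \<le> t0}" by (rule arrivals_finite[OF std \<omega>])
  then obtain K0 where K0: "\<And>k. k \<ge> 1 \<Longrightarrow> \<Gamma> k \<omega> \<le> t0 \<Longrightarrow> k \<le> K0"
    unfolding finite_nat_set_iff_bounded_le by auto
  have "sets (restrict_space borel {0<..}) = sets (restrict_space lborel {0 :: real<..})"
    by (simp add: sets_restrict_space)
  then have gm: "g \<in> borel_measurable (restrict_space borel {0<..})"
    using g(1) measurable_cong_sets[OF _ refl] by blast
  have "(\<integral>t. g t \<partial>counting_measure {0<..} {1..} (\<lambda>k. \<Gamma> k \<omega>)) = (\<Sum>k\<in>{1..K}. g (\<Gamma> k \<omega>))" if "K \<ge> K0" for K
  proof (rule integral_counting_measure[OF gm])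
    fix i assume "i \<in> {1..}" "g (\<Gamma> i \<omega>) \<noteq> 0"
    then show "i \<in> {1..K}" using g(2)[of "\<Gamma> i \<omega>"] K0[of i] that by force
  qed (use arrivals_pos[OF std \<omega>] in auto)
  then show ?thesis
    by (intro tendsto_eventually) (auto simp: eventually_sequentially intro!: exI[of _ K0])
qed

text \<open>Independence of the generated sigma-algebras gives the product formula on rectangles,
  hence a product law, and Tonelli applies. The form matches the independence clause of
  \<open>marked_poisson_arrivals\<close>, with whole sequences as \<open>X\<close> and
  \<open>Y\<close>.\<close>

lemma (in prob_space) indep_set_nn_integral:
  assumes X: "X \<in> measurable M S" and Y: "Y \<in> measurable M T"
    and ind: "indep_set (sets (vimage_algebra (space M) X S)) (sets (vimage_algebra (space M) Y T))"
    and g: "g \<in> borel_measurable (S \<Otimes>\<^sub>M T)"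
  shows "(\<integral>\<^sup>+\<omega>. g (X \<omega>, Y \<omega>) \<partial>M) = (\<integral>\<^sup>+\<omega>. \<integral>\<^sup>+\<omega>'. g (X \<omega>, Y \<omega>') \<partial>M \<partial>M)"
proof -
  interpret Y: prob_space "distr M T Y" by (rule prob_space_distr[OF Y])
  have XY: "(\<lambda>x. (X x, Y x)) \<in> measurable M (S \<Otimes>\<^sub>M T)" using X Y by (rule measurable_Pair)
  interpret X: prob_space "distr M S X" by (rule prob_space_distr[OF X])
  have eq: "distr M S X \<Otimes>\<^sub>M distr M T Y = distr M (S \<Otimes>\<^sub>M T) (\<lambda>x. (X x, Y x))"
  proof (rule pair_measure_eqI[OF X.sigma_finite_measure_axioms Y.sigma_finite_measure_axioms])
    fix A B assume AB: "A \<in> sets (distr M S X)" "B \<in> sets (distr M T Y)"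
    have "emeasure (distr M (S \<Otimes>\<^sub>M T) (\<lambda>x. (X x, Y x))) (A \<times> B) =
        emeasure M ((\<lambda>x. (X x, Y x)) -` (A \<times> B) \<inter> space M)"
      using XY AB by (intro emeasure_distr) auto
    also have "(\<lambda>x. (X x, Y x)) -` (A \<times> B) \<inter> space M = (X -` A \<inter> space M) \<inter> (Y -` B \<inter> space M)"
      by auto
    also have "emeasure M \<dots> = emeasure M (X -` A \<inter> space M) * emeasure M (Y -` B \<inter> space M)"
      using indep_setD[OF ind, of "X -` A \<inter> space M" "Y -` B \<inter> space M"] AB
      by (simp add: emeasure_eq_measure in_vimage_algebra ennreal_mult')
    finally show "emeasure (distr M S X) A * emeasure (distr M T Y) B =
        emeasure (distr M (S \<Otimes>\<^sub>M T) (\<lambda>x. (X x, Y x))) (A \<times> B)"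
      using X Y AB by (simp add: emeasure_distr)
  qed simp
  have g': "g \<in> borel_measurable (distr M S X \<Otimes>\<^sub>M distr M T Y)"
    unfolding eq using g by simp
  have "(\<integral>\<^sup>+\<omega>. g (X \<omega>, Y \<omega>) \<partial>M) = (\<integral>\<^sup>+p. g p \<partial>distr M (S \<Otimes>\<^sub>M T) (\<lambda>x. (X x, Y x)))"
    using XY g by (simp add: nn_integral_distr)
  also have "\<dots> = (\<integral>\<^sup>+x. \<integral>\<^sup>+y. g (x, y) \<partial>distr M T Y \<partial>distr M S X)"
    unfolding eq[symmetric] by (rule Y.nn_integral_fst[OF g', symmetric])
  also have "\<dots> = (\<integral>\<^sup>+\<omega>. \<integral>\<^sup>+y. g (X \<omega>, y) \<partial>distr M T Y \<partial>M)"
    using Y.borel_measurable_nn_integral_fst[OF g'] X by (simp add: nn_integral_distr)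
  also have "\<dots> = (\<integral>\<^sup>+\<omega>. \<integral>\<^sup>+\<omega>'. g (X \<omega>, Y \<omega>') \<partial>M \<partial>M)"
  proof (rule nn_integral_cong)
    fix \<omega> assume "\<omega> \<in> space M"
    then have "X \<omega> \<in> space S" by (rule measurable_space[OF X])
    then have "(\<lambda>y. g (X \<omega>, y)) \<in> borel_measurable T" using measurable_Pair2[OF g] by simp
    then show "(\<integral>\<^sup>+y. g (X \<omega>, y) \<partial>distr M T Y) = (\<integral>\<^sup>+\<omega>'. g (X \<omega>, Y \<omega>') \<partial>M)"
      using Y by (simp add: nn_integral_distr)
  qed
  finally show ?thesis .
qed

section \<open>The point process of the marked series\<close>

locale marked_series = regularly_varying f \<alpha> a \<nu> M\<^sub>0 X\<^sub>0
  for f :: "ereal ^ 'd \<Rightarrow> ennreal" and \<alpha> a \<nu> and M\<^sub>0 :: "'v measure" and X\<^sub>0 +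
  fixes Q :: "'q measure" and \<Gamma> :: "nat \<Rightarrow> 'q \<Rightarrow> real" and \<Theta> :: "nat \<Rightarrow> 'q \<Rightarrow> real ^ 'd"
  assumes marked: "marked_poisson_arrivals Q \<Gamma> angular \<Theta>"
begin

lemma prob_Q: "prob_space Q" and std: "standard_poisson_arrivals Q \<Gamma>"
  and indep_marks: "prob_space.indep_vars Q (\<lambda>_. angular) \<Theta> {1..}"
  and distr_marks: "k \<ge> 1 \<Longrightarrow> distr Q angular (\<Theta> k) = angular"
  using marked by (auto simp: marked_poisson_arrivals_def)

lemma marks_measurable: "k \<ge> 1 \<Longrightarrow> \<Theta> k \<in> measurable Q angular"
  using indep_marks unfolding prob_space.indep_vars_def[OF prob_Q] by (meson atLeast_iff)

lemma marks_sphere: "k \<ge> 1 \<Longrightarrow> \<omega> \<in> space Q \<Longrightarrow> \<Theta> k \<omega> \<in> unit_sphere f"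
  using measurable_space[OF marks_measurable] by simp

lemma arrivals_sequence_measurable:
    "(\<lambda>\<omega>. \<lambda>k\<in>{1..}. \<Gamma> k \<omega>) \<in> measurable Q (PiM {1..} (\<lambda>_. borel))"
  and marks_sequence_measurable: "(\<lambda>\<omega>. \<lambda>k\<in>{1..}. \<Theta> k \<omega>) \<in> measurable Q (PiM {1..} (\<lambda>_. angular))"
  by (intro measurable_restrict arrivals_measurable[OF std] marks_measurable; simp)+

lemma indep_arrivals_marks:
  "prob_space.indep_set Q
    (sets (vimage_algebra (space Q) (\<lambda>\<omega>. \<lambda>k\<in>{1..}. \<Gamma> k \<omega>) (PiM {1..} (\<lambda>_. borel))))
    (sets (vimage_algebra (space Q) (\<lambda>\<omega>. \<lambda>k\<in>{1..}. \<Theta> k \<omega>) (PiM {1..} (\<lambda>_. angular))))"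
  using marked by (simp add: marked_poisson_arrivals_def)

definition point :: "nat \<Rightarrow> 'q \<Rightarrow> ereal ^ 'd" where "point k \<omega> = polar_point (\<Gamma> k \<omega>) (\<Theta> k \<omega>)"

lemma point_measurable: "k \<ge> 1 \<Longrightarrow> point k \<in> borel_measurable Q"
  unfolding point_def[abs_def]
  using measurable_compose[OF measurable_Pair[OF arrivals_measurable_restrict[OF std] marks_measurable] polar_point_measurable]
  by simp

lemma f_polar_point:
  assumes "t > 0" "\<theta> \<in> unit_sphere f"
  shows "f (polar_point t \<theta>) = ennreal (mass powr (1 / \<alpha>) * t powr (- 1 / \<alpha>))"
proof -
  have "mass powr (1 / \<alpha>) * t powr (- 1 / \<alpha>) > 0" using mass_pos assms(1) by simp
  then show ?thesis
    using assms(2) unfolding polar_point_def to_ereal_vec_scale by (simp add: f_scale unit_sphere_def)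
qed

lemma f_point: "k \<ge> 1 \<Longrightarrow> \<omega> \<in> space Q \<Longrightarrow>
    f (point k \<omega>) = ennreal (mass powr (1 / \<alpha>) * \<Gamma> k \<omega> powr (- 1 / \<alpha>))"
  unfolding point_def by (intro f_polar_point arrivals_pos[OF std] marks_sphere)

text \<open>The radius at time \<open>t\<close> decreases in \<open>t\<close> and equals
  \<open>r\<close> at \<open>t = mass * r powr (- \<alpha>)\<close>. Points above a positive level
  therefore arrive within a bounded time.\<close>

lemma level_bound:
  assumes "r > 0" "t > 0" "r \<le> mass powr (1 / \<alpha>) * t powr (- 1 / \<alpha>)"
  shows "t \<le> mass * r powr (- \<alpha>)"
proof (rule ccontr)
  define b where "b = mass * r powr (- \<alpha>)"
  have b: "b > 0" using mass_pos assms(1) by (simp add: b_def)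
  assume "\<not> t \<le> mass * r powr (- \<alpha>)"
  then have "b < t" by (simp add: b_def)
  then have "t powr (- 1 / \<alpha>) < b powr (- 1 / \<alpha>)"
    using b alpha_pos by (intro powr_less_mono2_neg) auto
  also have "b powr (- 1 / \<alpha>) = mass powr (- 1 / \<alpha>) * r"
    using mass_pos assms(1) alpha_pos by (simp add: b_def powr_mult powr_powr)
  finally have "mass powr (1 / \<alpha>) * t powr (- 1 / \<alpha>) < mass powr (1 / \<alpha>) * (mass powr (- 1 / \<alpha>) * r)"
    using mass_pos by (intro mult_strict_left_mono) auto
  also have "\<dots> = r"
    using mass_pos by (simp add: mult.assoc[symmetric] flip: powr_add)
  finally show False using assms(3) by simp
qed

lemma finite_points:
  assumes \<omega>: "\<omega> \<in> space Q" and r: "r > 0"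
  shows "finite {k \<in> {1..}. ennreal r \<le> f (point k \<omega>)}"
proof (rule finite_subset[OF _ arrivals_finite[OF std \<omega>, of "mass * r powr (- \<alpha>)"]])
  show "{k \<in> {1..}. ennreal r \<le> f (point k \<omega>)} \<subseteq> {k \<in> {1..}. \<Gamma> k \<omega> \<le> mass * r powr (- \<alpha>)}"
  proof
    fix k assume "k \<in> {k \<in> {1..}. ennreal r \<le> f (point k \<omega>)}"
    then have k: "k \<in> {1..}" and le: "ennreal r \<le> f (point k \<omega>)" by auto
    have pos: "\<Gamma> k \<omega> > 0" using arrivals_pos[OF std \<omega>] k by simp
    have "r \<le> mass powr (1 / \<alpha>) * \<Gamma> k \<omega> powr (- 1 / \<alpha>)"
      using le k f_point[OF _ \<omega>, of k] by (simp add: ennreal_le_iff)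
    then show "k \<in> {k \<in> {1..}. \<Gamma> k \<omega> \<le> mass * r powr (- \<alpha>)}"
      using level_bound[OF r pos] k by simp
  qed
qed

definition series :: "'q \<Rightarrow> (ereal ^ 'd) measure" where
  "series \<omega> = counting_measure E {1..} (\<lambda>k. point k \<omega>)"

lemma series_point_measure: "\<omega> \<in> space Q \<Longrightarrow> series \<omega> \<in> point_measures E"
  unfolding series_def by (intro counting_point_measure finite_points)

lemma series_integral_eventually:
  assumes h: "h \<in> Cc0" and \<omega>: "\<omega> \<in> space Q"
  shows "(\<lambda>K. \<Sum>k\<in>{1..K}. h (point k \<omega>)) \<longlonglongrightarrow> (\<integral>x. h x \<partial>series \<omega>)"
proof -
  obtain r where r: "r > 0" "\<And>x. h x \<noteq> 0 \<Longrightarrow> ennreal r \<le> f x" using h by (auto simp: Cc0_def)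
  obtain K0 where K0: "\<And>k. k \<ge> 1 \<Longrightarrow> ennreal r \<le> f (point k \<omega>) \<Longrightarrow> k \<le> K0"
    using finite_points[OF \<omega> r(1)] unfolding finite_nat_set_iff_bounded_le by auto
  have "(\<integral>x. h x \<partial>series \<omega>) = (\<Sum>k\<in>{1..K}. h (point k \<omega>))" if "K \<ge> K0" for K
    unfolding series_def using r(2) K0 that by (intro integral_counting[OF h]) force+
  then show ?thesis
    by (intro tendsto_eventually) (auto simp: eventually_sequentially intro!: exI[of _ K0])
qed

lemma series_measurable: "series \<in> measurable Q (borel_of (vague_topology E))"
proof (rule measurable_vague[OF series_point_measure])
  fix h :: "ereal ^ 'd \<Rightarrow> real" assume h: "h \<in> Cc0"
  show "(\<lambda>\<omega>. \<integral>x. h x \<partial>series \<omega>) \<in> borel_measurable Q"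
  proof (rule borel_measurable_LIMSEQ_real[OF series_integral_eventually[OF h]])
    show "(\<lambda>\<omega>. \<Sum>k\<in>{1..K}. h (point k \<omega>)) \<in> borel_measurable Q" for K
      by (intro borel_measurable_sum measurable_compose[OF point_measurable Cc0_measurable[OF h]]) auto
  qed
qed

text \<open>Here the time ranges over all reals, because the sequence of arrivals is treated as an
  element of \<open>PiM {1..} (\<lambda>_. borel)\<close>.\<close>

lemma polar_point_measurable_borel:
  "(\<lambda>(t, \<theta>). polar_point t \<theta>) \<in> borel_measurable (borel \<Otimes>\<^sub>M angular)"
proof -
  have "(\<lambda>\<theta>. \<theta>) \<in> borel_measurable (restrict_space borel (unit_sphere f))"
    by (rule measurable_restrict_space1) simp
  then have 2: "(\<lambda>\<theta>. \<theta>) \<in> borel_measurable angular"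
    using measurable_cong_sets[OF sets_angular refl] by blast
  have [measurable]: "(\<lambda>p. snd p) \<in> borel_measurable ((borel :: real measure) \<Otimes>\<^sub>M angular)"
    by (rule measurable_compose[OF measurable_snd 2])
  show ?thesis unfolding polar_point_def case_prod_beta by measurable
qed

text \<open>With the arrivals frozen at \<open>\<gamma>\<close>, the independent marks make the
  expectation factor over \<open>k\<close>. Finitely many terms are kept so that the factorisation
  concerns finite products; the passage to all terms is made in
  \<open>series_laplace\<close>.\<close>

lemma series_laplace_partial:
  assumes h: "h \<in> Cc0" "\<And>x. 0 \<le> h x"
  shows "(\<integral>\<omega>. (\<Prod>k\<in>{1..K}. exp (- h (point k \<omega>))) \<partial>Q) =
    (\<integral>\<omega>. (\<Prod>k\<in>{1..K}. \<integral>\<theta>. exp (- h (polar_point (\<Gamma> k \<omega>) \<theta>)) \<partial>angular) \<partial>Q)"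
proof -
  interpret prob_space Q by (rule prob_Q)
  have hm: "h \<in> borel_measurable borel" by (rule Cc0_measurable[OF h(1)])
  define F where "F = (\<lambda>(\<gamma> :: nat \<Rightarrow> real, \<theta> :: nat \<Rightarrow> real ^ 'd). \<Prod>k\<in>{1..K}. exp (- h (polar_point (\<gamma> k) (\<theta> k))))"
  have "(\<lambda>p. exp (- h (polar_point (fst p k) (snd p k)))) \<in>
      borel_measurable (PiM {1..} (\<lambda>_. borel) \<Otimes>\<^sub>M PiM {1..} (\<lambda>_. angular))" if "k \<in> {1..K}" for k
  proof -
    have "(\<lambda>p. (fst p k, snd p k)) \<in> measurable (PiM {1..} (\<lambda>_. borel :: real measure) \<Otimes>\<^sub>M PiM {1..} (\<lambda>_. angular)) (borel \<Otimes>\<^sub>M angular)"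
      using that by (intro measurable_Pair measurable_compose[OF measurable_fst measurable_component_singleton]
          measurable_compose[OF measurable_snd measurable_component_singleton]) auto
    from measurable_compose[OF measurable_compose[OF this polar_point_measurable_borel] hm]
    show ?thesis by (intro borel_measurable_exp_uminus) simp
  qed
  then have Fm: "F \<in> borel_measurable (PiM {1..} (\<lambda>_. borel) \<Otimes>\<^sub>M PiM {1..} (\<lambda>_. angular))"
    unfolding F_def case_prod_beta by (rule borel_measurable_prod)
  define G where "G t = (\<integral>\<theta>. exp (- h (polar_point t \<theta>)) \<partial>angular)" for t
  have sec: "(\<lambda>\<theta>. exp (- h (polar_point t \<theta>))) \<in> borel_measurable angular" for t
    using measurable_compose[OF measurable_Pair2[OF polar_point_measurable_borel, of t] hm]
    by (intro borel_measurable_exp_uminus) simp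
  have mark: "(\<lambda>\<omega>. exp (- h (polar_point t (\<Theta> k \<omega>)))) \<in> borel_measurable Q" if "k \<in> {1..K}" for t k
    using that measurable_compose[OF marks_measurable sec, of k] by auto
  have "(\<integral>\<omega>'. (\<Prod>k\<in>{1..K}. exp (- h (polar_point (\<gamma> k) (\<Theta> k \<omega>')))) \<partial>Q) = (\<Prod>k\<in>{1..K}. G (\<gamma> k))" for \<gamma>
  proof -
    have "indep_vars (\<lambda>_. borel) (\<lambda>k \<omega>'. exp (- h (polar_point (\<gamma> k) (\<Theta> k \<omega>')))) {1..K}"
      using indep_vars_compose2[OF indep_vars_subset[OF indep_marks], of "{1..K}" "\<lambda>k \<theta>. exp (- h (polar_point (\<gamma> k) \<theta>))" "\<lambda>_. borel"] sec
      by auto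
    moreover have "integrable Q (\<lambda>\<omega>'. exp (- h (polar_point (\<gamma> k) (\<Theta> k \<omega>'))))" if "k \<in> {1..K}" for k
      using h(2) mark[OF that] by (intro integrable_const_bound[of _ 1] AE_I2) auto
    ultimately have "(\<integral>\<omega>'. (\<Prod>k\<in>{1..K}. exp (- h (polar_point (\<gamma> k) (\<Theta> k \<omega>')))) \<partial>Q) =
        (\<Prod>k\<in>{1..K}. \<integral>\<omega>'. exp (- h (polar_point (\<gamma> k) (\<Theta> k \<omega>'))) \<partial>Q)"
      by (intro indep_vars_lebesgue_integral) auto
    also have "\<dots> = (\<Prod>k\<in>{1..K}. G (\<gamma> k))"
    proof (rule prod.cong[OF refl])
      fix k assume k: "k \<in> {1..K}"
      have "(\<integral>\<omega>'. exp (- h (polar_point (\<gamma> k) (\<Theta> k \<omega>'))) \<partial>Q) =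
          (\<integral>\<theta>. exp (- h (polar_point (\<gamma> k) \<theta>)) \<partial>distr Q angular (\<Theta> k))"
        using k sec marks_measurable by (intro integral_distr[symmetric]) auto
      then show "(\<integral>\<omega>'. exp (- h (polar_point (\<gamma> k) (\<Theta> k \<omega>'))) \<partial>Q) = G (\<gamma> k)"
        using k by (simp add: distr_marks G_def)
    qed
    finally show ?thesis .
  qed
  moreover have "(\<integral>\<^sup>+\<omega>'. ennreal (\<Prod>k\<in>{1..K}. exp (- h (polar_point (\<gamma> k) (\<Theta> k \<omega>')))) \<partial>Q) =
      ennreal (\<integral>\<omega>'. (\<Prod>k\<in>{1..K}. exp (- h (polar_point (\<gamma> k) (\<Theta> k \<omega>')))) \<partial>Q)" for \<gamma>
  proof (rule nn_integral_eq_integral)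
    show "integrable Q (\<lambda>\<omega>'. \<Prod>k\<in>{1..K}. exp (- h (polar_point (\<gamma> k) (\<Theta> k \<omega>'))))"
    proof (rule integrable_const_bound[of _ 1])
      show "(\<lambda>\<omega>'. \<Prod>k\<in>{1..K}. exp (- h (polar_point (\<gamma> k) (\<Theta> k \<omega>')))) \<in> borel_measurable Q"
        by (intro borel_measurable_prod mark)
    qed (use h(2) in \<open>auto simp: abs_prod intro!: prod_le_1 AE_I2\<close>)
  qed (auto intro!: prod_nonneg)
  ultimately have inner: "(\<integral>\<^sup>+\<omega>'. ennreal (\<Prod>k\<in>{1..K}. exp (- h (polar_point (\<gamma> k) (\<Theta> k \<omega>')))) \<partial>Q) =
      ennreal (\<Prod>k\<in>{1..K}. G (\<gamma> k))" for \<gamma> by simp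
  have Gm: "(\<lambda>\<omega>. G (\<Gamma> k \<omega>)) \<in> borel_measurable Q" if "k \<in> {1..K}" for k
    unfolding G_def
    using that measurable_compose[OF arrivals_measurable_restrict[OF std] laplace_exponent_polar(2)[OF h], of k] by auto
  have G0: "0 \<le> G t" for t unfolding G_def by (intro Bochner_Integration.integral_nonneg) auto
  have pm: "(\<lambda>\<omega>. exp (- h (point k \<omega>))) \<in> borel_measurable Q" if "k \<in> {1..K}" for k
    using that by (intro borel_measurable_exp_uminus measurable_compose[OF point_measurable hm]) auto
  have "(\<integral>\<omega>. (\<Prod>k\<in>{1..K}. exp (- h (point k \<omega>))) \<partial>Q) =
      enn2real (\<integral>\<^sup>+\<omega>. ennreal (\<Prod>k\<in>{1..K}. exp (- h (point k \<omega>))) \<partial>Q)"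
    by (intro integral_eq_nn_integral AE_I2 borel_measurable_prod pm prod_nonneg) auto
  also have "(\<integral>\<^sup>+\<omega>. ennreal (\<Prod>k\<in>{1..K}. exp (- h (point k \<omega>))) \<partial>Q) =
      (\<integral>\<^sup>+\<omega>. ennreal (F (\<lambda>k\<in>{1..}. \<Gamma> k \<omega>, \<lambda>k\<in>{1..}. \<Theta> k \<omega>)) \<partial>Q)"
    by (simp add: F_def point_def)
  also have "\<dots> = (\<integral>\<^sup>+\<omega>. \<integral>\<^sup>+\<omega>'. ennreal (F (\<lambda>k\<in>{1..}. \<Gamma> k \<omega>, \<lambda>k\<in>{1..}. \<Theta> k \<omega>')) \<partial>Q \<partial>Q)"
    using Fm by (intro indep_set_nn_integral[OF arrivals_sequence_measurable marks_sequence_measurable indep_arrivals_marks]) measurable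
  also have "\<dots> = (\<integral>\<^sup>+\<omega>. ennreal (\<Prod>k\<in>{1..K}. G (\<Gamma> k \<omega>)) \<partial>Q)"
    using inner by (simp add: F_def)
  also have "enn2real \<dots> = (\<integral>\<omega>. (\<Prod>k\<in>{1..K}. G (\<Gamma> k \<omega>)) \<partial>Q)"
    by (intro integral_eq_nn_integral[symmetric] AE_I2 borel_measurable_prod Gm prod_nonneg G0)
  finally show ?thesis by (simp only: G_def)
qed

text \<open>Once the marks are averaged, the product of the \<open>G (\<Gamma> k)\<close> is
  \<open>exp\<close> of minus the sum of \<open>g (\<Gamma> k)\<close> for
  \<open>g = - ln G\<close>. This is a Laplace functional of the unmarked arrival process, and its
  exponent integrates \<open>1 - exp (- g) = 1 - G\<close>, which the polar form of
  \<open>\<nu>\<close> identifies.\<close>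

theorem series_laplace:
  assumes h: "h \<in> Cc0" "\<And>x. 0 \<le> h x"
  shows "(\<integral>\<omega>. exp (- (\<integral>x. h x \<partial>series \<omega>)) \<partial>Q) = exp (- (\<integral>x. 1 - exp (- h x) \<partial>\<nu>))"
proof -
  interpret prob_space Q by (rule prob_Q)
  interpret angular: prob_space angular by (rule prob_angular)
  let ?L = "restrict_space lborel {0 :: real<..}"
  define G where "G t = (\<integral>\<theta>. exp (- h (polar_point t \<theta>)) \<partial>angular)" for t
  have Gm: "G \<in> borel_measurable ?L" unfolding G_def by (rule laplace_exponent_polar(2)[OF h])
  obtain b where b: "\<And>x. \<bar>h x\<bar> \<le> b" using Cc0_bounded[OF h(1)] by blast
  obtain r where r: "r > 0" "\<And>x. h x \<noteq> 0 \<Longrightarrow> ennreal r \<le> f x" using h(1) by (auto simp: Cc0_def)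
  \<comment> \<open>After time \<open>t0\<close> all points lie below the level \<open>r\<close>
    that \<open>h\<close> needs, so \<open>G = 1\<close> and \<open>g = 0\<close> there.\<close>
  define t0 where "t0 = mass * r powr (- \<alpha>)"
  have t0: "t0 > 0" using mass_pos r by (simp add: t0_def)
  have int: "integrable angular (\<lambda>\<theta>. exp (- h (polar_point t \<theta>)))" for t
  proof -
    have "(\<lambda>\<theta>. exp (- h (polar_point t \<theta>))) \<in> borel_measurable angular"
      using measurable_compose[OF measurable_Pair2[OF polar_point_measurable_borel, of t] Cc0_measurable[OF h(1)]]
      by (intro borel_measurable_exp_uminus) simp
    then show ?thesis using h(2) by (intro angular.integrable_const_bound[of _ 1] AE_I2) auto
  qed
  have one: "(\<integral>\<theta>. k \<partial>angular) = k" for k :: real using angular.prob_space by simp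
  have G_low: "exp (- b) \<le> G t" for t
  proof -
    have "h x \<le> b" for x using b[of x] by simp
    then have "(\<integral>\<theta>. exp (- b) \<partial>angular) \<le> G t" unfolding G_def using int by (intro integral_mono) auto
    then show ?thesis by (simp only: one)
  qed
  have G_up: "G t \<le> 1" for t
  proof -
    have "G t \<le> (\<integral>\<theta>. 1 \<partial>angular)" unfolding G_def using int h(2) by (intro integral_mono) auto
    then show ?thesis by (simp only: one)
  qed
  have G_pos: "G t > 0" for t using G_low[of t] by (meson exp_gt_zero less_le_trans)
  have G_one: "G t = 1" if t: "t > t0" for t
  proof -
    have "exp (- h (polar_point t \<theta>)) = 1" if \<theta>: "\<theta> \<in> space angular" for \<theta>
    proof -
      have "h (polar_point t \<theta>) = 0"
      proof (rule ccontr)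
        assume "h (polar_point t \<theta>) \<noteq> 0"
        then have "ennreal r \<le> ennreal (mass powr (1 / \<alpha>) * t powr (- 1 / \<alpha>))"
          using r(2) f_polar_point[of t \<theta>] t t0 \<theta> by fastforce
        then have "r \<le> mass powr (1 / \<alpha>) * t powr (- 1 / \<alpha>)" by (simp add: ennreal_le_iff)
        then show False using level_bound[OF r(1), of t] t t0 by (simp add: t0_def)
      qed
      then show ?thesis by simp
    qed
    then have "G t = (\<integral>\<theta>. 1 \<partial>angular)" unfolding G_def by (intro Bochner_Integration.integral_cong) auto
    then show ?thesis by (simp only: one)
  qed
  \<comment> \<open>\<open>exp (- b) \<le> G \<le> 1\<close> makes \<open>g\<close> well defined,
    nonnegative and bounded by \<open>b\<close>, as \<open>poisson_process_laplace\<close>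
    demands.\<close>
  define g where "g t = - ln (G t)" for t
  have gm: "g \<in> borel_measurable ?L" unfolding g_def[abs_def] using Gm by measurable
  have g_exp: "exp (- g t) = G t" for t using G_pos[of t] by (simp add: g_def)
  have g0: "0 \<le> g t" for t using G_up[of t] G_pos[of t] by (simp add: g_def)
  have gb: "g t \<le> b" for t using ln_mono[OF G_low[of t] exp_gt_zero] by (simp add: g_def)
  have g_zero: "g t = 0" if "t > t0" for t using G_one[OF that] by (simp add: g_def)
  define N where "N \<omega> = counting_measure {0 :: real<..} {1..} (\<lambda>k. \<Gamma> k \<omega>)" for \<omega>
  have N: "poisson_process Q {0<..} ?L N"
    using std unfolding standard_poisson_arrivals_def N_def[abs_def] by blast
  have gk: "(\<lambda>\<omega>. g (\<Gamma> k \<omega>)) \<in> borel_measurable Q" if "k \<in> {1..K}" for k and K :: nat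
    using that measurable_compose[OF arrivals_measurable_restrict[OF std] gm, of k] by auto
  have lim: "(\<lambda>K. \<Sum>k\<in>{1..K}. g (\<Gamma> k \<omega>)) \<longlonglongrightarrow> (\<integral>t. g t \<partial>N \<omega>)" if "\<omega> \<in> space Q" for \<omega>
    unfolding N_def by (rule arrivals_partial_sums_tendsto[OF std that gm g_zero])
  have Nm: "(\<lambda>\<omega>. \<integral>t. g t \<partial>N \<omega>) \<in> borel_measurable Q"
    by (rule borel_measurable_LIMSEQ_real[OF lim]) (auto intro!: borel_measurable_sum gk)
  have hk: "(\<lambda>\<omega>. h (point k \<omega>)) \<in> borel_measurable Q" if "k \<in> {1..K}" for k and K :: nat
    using that by (intro measurable_compose[OF point_measurable Cc0_measurable[OF h(1)]]) auto
  have "(\<lambda>K. \<integral>\<omega>. exp (- (\<Sum>k\<in>{1..K}. h (point k \<omega>))) \<partial>Q) \<longlonglongrightarrow> (\<integral>\<omega>. exp (- (\<integral>x. h x \<partial>series \<omega>)) \<partial>Q)"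
  proof (rule integral_dominated_convergence[where w = "\<lambda>_. 1"])
    show "(\<lambda>\<omega>. exp (- (\<integral>x. h x \<partial>series \<omega>))) \<in> borel_measurable Q"
      by (rule borel_measurable_exp_uminus[OF vague_integral_measurable[OF series_measurable h(1)]])
    show "(\<lambda>\<omega>. exp (- (\<Sum>k\<in>{1..K}. h (point k \<omega>)))) \<in> borel_measurable Q" for K
      by (intro borel_measurable_exp_uminus borel_measurable_sum hk)
    show "AE \<omega> in Q. (\<lambda>K. exp (- (\<Sum>k\<in>{1..K}. h (point k \<omega>)))) \<longlonglongrightarrow> exp (- (\<integral>x. h x \<partial>series \<omega>))"
      by (intro AE_I2 tendsto_exp tendsto_minus series_integral_eventually[OF h(1)])
  qed (use h(2) in \<open>auto intro!: sum_nonneg AE_I2\<close>)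
  moreover have "(\<lambda>K. \<integral>\<omega>. exp (- (\<Sum>k\<in>{1..K}. g (\<Gamma> k \<omega>))) \<partial>Q) \<longlonglongrightarrow> (\<integral>\<omega>. exp (- (\<integral>t. g t \<partial>N \<omega>)) \<partial>Q)"
  proof (rule integral_dominated_convergence[where w = "\<lambda>_. 1"])
    show "(\<lambda>\<omega>. exp (- (\<integral>t. g t \<partial>N \<omega>))) \<in> borel_measurable Q"
      by (rule borel_measurable_exp_uminus[OF Nm])
    show "(\<lambda>\<omega>. exp (- (\<Sum>k\<in>{1..K}. g (\<Gamma> k \<omega>)))) \<in> borel_measurable Q" for K
      by (intro borel_measurable_exp_uminus borel_measurable_sum gk)
    show "AE \<omega> in Q. (\<lambda>K. exp (- (\<Sum>k\<in>{1..K}. g (\<Gamma> k \<omega>)))) \<longlonglongrightarrow> exp (- (\<integral>t. g t \<partial>N \<omega>))"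
      by (intro AE_I2 tendsto_exp tendsto_minus lim)
  qed (use g0 in \<open>auto intro!: sum_nonneg AE_I2\<close>)
  moreover have "(\<integral>\<omega>. exp (- (\<Sum>k\<in>{1..K}. h (point k \<omega>))) \<partial>Q) = (\<integral>\<omega>. exp (- (\<Sum>k\<in>{1..K}. g (\<Gamma> k \<omega>))) \<partial>Q)" for K
    using series_laplace_partial[OF h, of K]
    by (simp add: exp_sum g_exp flip: sum_negf G_def)
  ultimately have "(\<integral>\<omega>. exp (- (\<integral>x. h x \<partial>series \<omega>)) \<partial>Q) = (\<integral>\<omega>. exp (- (\<integral>t. g t \<partial>N \<omega>)) \<partial>Q)"
    by (metis (no_types, lifting) LIMSEQ_unique ext)
  also have "\<dots> = exp (- (\<integral>t. 1 - exp (- g t) \<partial>?L))"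
  proof (rule poisson_process_laplace[OF N _ gm _ gb _ Nm])
    show "sets (N \<omega>) = sets ?L" for \<omega> unfolding N_def sets_counting by (simp add: sets_restrict_space)
    have "{t \<in> space ?L. g t \<noteq> 0} \<subseteq> {0<..t0}" using g_zero by (force simp: space_restrict_space)
    moreover have S: "{0<..t0} \<in> sets ?L" by (subst sets_restrict_space_iff) auto
    ultimately have "emeasure ?L {t \<in> space ?L. g t \<noteq> 0} \<le> emeasure ?L {0<..t0}" by (rule emeasure_mono)
    also have "\<dots> = emeasure lborel {0<..t0}" by (intro emeasure_restrict_space) auto
    also have "\<dots> < \<infinity>" using t0 by simp
    finally show "emeasure ?L {t \<in> space ?L. g t \<noteq> 0} < \<infinity>" .
  qed (rule g0)
  also have "(\<integral>t. 1 - exp (- g t) \<partial>?L) = (\<integral>x. 1 - exp (- h x) \<partial>\<nu>)"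
    using laplace_exponent_polar(1)[OF h] by (simp add: g_exp G_def)
  finally show ?thesis .
qed

theorem poisson_equal_in_distribution_series:
  assumes N: "poisson_process P E \<nu> N"
  shows "equal_in_distribution (vague_topology E) P N Q series"
proof (rule equal_in_distribution_of_laplace[OF _ prob_Q _ series_measurable])
  show "prob_space P" "N \<in> measurable P (borel_of (vague_topology E))"
    using N by (auto simp: poisson_process_def)
qed (simp add: poisson_laplace[OF N] series_laplace)

end

section \<open>Implicit order statistics\<close>

definition precedes :: "(nat \<Rightarrow> 'b::linorder) \<Rightarrow> nat \<Rightarrow> nat \<Rightarrow> bool" where
  "precedes v i j \<longleftrightarrow> v i > v j \<or> (v i = v j \<and> i < j)"

text \<open>The inverse of \<open>order_index\<close> on \<open>{1..n}\<close>, as a cardinality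
  instead of a definite description. Counting \<open>j\<close> itself makes ranks start at
  1.\<close>

definition order_rank :: "(nat \<Rightarrow> 'b::linorder) \<Rightarrow> nat \<Rightarrow> nat \<Rightarrow> nat" where
  "order_rank v n j = card {i \<in> {1..n}. i = j \<or> precedes v i j}"

lemma precedes_irrefl: "\<not> precedes v i i"
  and precedes_trans: "precedes v i j \<Longrightarrow> precedes v j k \<Longrightarrow> precedes v i k"
  and precedes_total: "i \<noteq> j \<Longrightarrow> precedes v i j \<or> precedes v j i"
  by (auto simp: precedes_def)

lemma rank_strict_mono:
  assumes "i \<in> {1..n}" "j \<in> {1..n}" "precedes v i j"
  shows "order_rank v n i < order_rank v n j"
  unfolding order_rank_def
proof (rule psubset_card_mono)
  have "j \<notin> {k \<in> {1..n}. k = i \<or> precedes v k i}"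
    using assms(3) precedes_irrefl precedes_trans by blast
  moreover have "{k \<in> {1..n}. k = i \<or> precedes v k i} \<subseteq> {k \<in> {1..n}. k = j \<or> precedes v k j}"
    using assms(3) precedes_trans by blast
  ultimately show "{k \<in> {1..n}. k = i \<or> precedes v k i} \<subset> {k \<in> {1..n}. k = j \<or> precedes v k j}"
    using assms(2) by blast
qed simp

lemma inj_on_rank: "inj_on (order_rank v n) {1..n}"
proof (rule inj_onI, rule ccontr)
  fix i j assume "i \<in> {1..n}" "j \<in> {1..n}" "order_rank v n i = order_rank v n j" "i \<noteq> j"
  then show False using precedes_total[of i j v] rank_strict_mono[of i n j v] rank_strict_mono[of j n i v] by auto
qed

lemma rank_bij: "bij_betw (order_rank v n) {1..n} {1..n}"
proof -
  have "order_rank v n j \<in> {1..n}" if j: "j \<in> {1..n}" for j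
  proof -
    have "card {j} \<le> order_rank v n j" unfolding order_rank_def using j by (intro card_mono) auto
    moreover have "order_rank v n j \<le> card {1..n}" unfolding order_rank_def by (intro card_mono) auto
    ultimately show ?thesis by simp
  qed
  then have "order_rank v n ` {1..n} = {1..n}"
    using inj_on_rank by (intro endo_inj_surj) auto
  then show ?thesis using inj_on_rank by (simp add: bij_betw_def)
qed

text \<open>The definite description is resolved by showing that the inverse of the rank function is
  the only permutation with the required order.\<close>

lemma order_index_properties:
  "order_index v n permutes {1..n} \<and> (\<forall>j\<in>{1..n}. order_index v n (order_rank v n j) = j)"
proof -
  let ?P = "\<lambda>k. k permutes {1..n} \<and> (\<forall>i j. 1 \<le> i \<and> i < j \<and> j \<le> n \<longrightarrow> precedes v (k i) (k j))"
  define k0 where "k0 i = (if i \<in> {1..n} then inv_into {1..n} (order_rank v n) i else i)" for i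
  have inv: "bij_betw (inv_into {1..n} (order_rank v n)) {1..n} {1..n}"
    by (rule bij_betw_inv_into[OF rank_bij])
  have "bij_betw k0 {1..n} {1..n}"
    using inv by (rule bij_betw_cong[THEN iffD1, rotated]) (simp add: k0_def)
  then have perm: "k0 permutes {1..n}" by (rule bij_imp_permutes) (auto simp: k0_def)
  have rank_k0: "order_rank v n (k0 i) = i" if "i \<in> {1..n}" for i
    using that bij_betw_inv_into_right[OF rank_bij that] by (simp add: k0_def)
  have in_range: "k i \<in> {1..n}" if "k permutes {1..n}" "i \<in> {1..n}" for k i
    using that permutes_in_image by metis
  have P0: "?P k0"
  proof (intro conjI allI impI perm)
    fix i j assume ij: "1 \<le> i \<and> i < j \<and> j \<le> n"
    then have r: "order_rank v n (k0 i) = i" "order_rank v n (k0 j) = j" by (auto intro!: rank_k0)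
    have "k0 i \<in> {1..n}" by (rule in_range[OF perm]) (use ij in auto)
    moreover have "k0 j \<in> {1..n}" by (rule in_range[OF perm]) (use ij in auto)
    ultimately show "precedes v (k0 i) (k0 j)"
      using rank_strict_mono[of "k0 j" n "k0 i" v] precedes_total[of "k0 i" "k0 j" v] r ij by (cases "k0 i = k0 j") auto
  qed
  have uniq: "k = k0" if k: "?P k" for k
  proof
    fix i
    show "k i = k0 i"
    proof (cases "i \<in> {1..n}")
      case False
      then show ?thesis using k by (auto simp: k0_def permutes_not_in)
    next
      case True
      have kp: "k permutes {1..n}" using k by simp
      \<comment> \<open>The indices up to and including \<open>k i\<close> in the order are the
        first \<open>i\<close> values of \<open>k\<close>, so \<open>k i\<close> has rank
        \<open>i\<close>; ranks being injective, this forces \<open>k = k0\<close>.\<close>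
      have "{j \<in> {1..n}. j = k i \<or> precedes v j (k i)} = k ` {1..i}"
      proof (intro equalityI subsetI)
        fix j assume j: "j \<in> {j \<in> {1..n}. j = k i \<or> precedes v j (k i)}"
        have "j \<in> k ` {1..n}" using j permutes_image[OF kp] by simp
        then obtain i' where i': "i' \<in> {1..n}" "j = k i'" by blast
        have "i' \<le> i"
        proof (rule ccontr)
          assume "\<not> i' \<le> i"
          then have "precedes v (k i) (k i')" using k True i' by auto
          then show False using j i' precedes_irrefl precedes_trans by (metis (mono_tags, lifting) mem_Collect_eq)
        qed
        then show "j \<in> k ` {1..i}" using i' by auto
      next
        fix j assume "j \<in> k ` {1..i}"
        then obtain i' where i': "1 \<le> i'" "i' \<le> i" "j = k i'" by auto
        then have "i' = i \<or> precedes v (k i') (k i)" using k True by (cases "i' = i") auto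
        moreover have "k i' \<in> {1..n}" using i' True by (intro in_range[OF kp]) auto
        ultimately show "j \<in> {j \<in> {1..n}. j = k i \<or> precedes v j (k i)}" using i' by auto
      qed
      moreover have "inj_on k {1..i}" using permutes_inj[OF kp] inj_on_subset by blast
      ultimately have "order_rank v n (k i) = i" by (simp add: order_rank_def card_image)
      then show ?thesis
        using inj_onD[OF inj_on_rank, of v n "k i" "k0 i"] rank_k0[OF True] in_range[OF kp True] in_range[OF perm True] by simp
    qed
  qed
  have "order_index v n = (THE k. ?P k)" by (simp add: order_index_def precedes_def)
  also have "\<dots> = k0" by (rule the_equality[where P = ?P, OF P0 uniq])
  finally have eq: "order_index v n = k0" .
  have "k0 (order_rank v n j) = j" if "j \<in> {1..n}" for j
    using that bij_betw_inv_into_left[OF rank_bij that] rank_bij[of v n] by (auto simp: k0_def bij_betw_def)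
  then show ?thesis using perm by (simp add: eq)
qed

lemma order_index_outside: "i \<notin> {1..n} \<Longrightarrow> order_index v n i = i"
  using order_index_properties[of v n] by (auto simp: permutes_not_in)

lemma order_index_range: "i \<in> {1..n} \<Longrightarrow> order_index v n i \<in> {1..n}"
  using order_index_properties[of v n] permutes_in_image[of "order_index v n" "{1..n}" i] by blast

lemma order_index_eq_iff:
  assumes "i \<in> {1..n}" "j \<in> {1..n}"
  shows "order_index v n i = j \<longleftrightarrow> order_rank v n j = i"
proof
  assume "order_index v n i = j"
  moreover have "order_index v n (order_rank v n j) = j" using order_index_properties assms(2) by blast
  moreover have "inj (order_index v n)" using order_index_properties[of v n] permutes_inj by blast
  ultimately show "order_rank v n j = i" by (metis injD)
next
  assume "order_rank v n j = i"
  then show "order_index v n i = j" using order_index_properties assms(2) by blast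
qed

text \<open>The event that the \<open>i\<close>-th index is \<open>j\<close> says that
  \<open>j\<close> has rank \<open>i\<close>, and the rank is a finite sum of indicators of
  comparisons.\<close>

lemma measurable_order_index:
  fixes v :: "nat \<Rightarrow> 'w \<Rightarrow> 'b::{linorder_topology, second_countable_topology}"
  assumes v: "\<And>j. j \<ge> 1 \<Longrightarrow> v j \<in> borel_measurable M"
  shows "(\<lambda>\<omega>. order_index (\<lambda>j. v j \<omega>) n i) \<in> measurable M (count_space UNIV)"
proof (cases "i \<in> {1..n}")
  case False
  then show ?thesis by (simp add: order_index_outside)
next
  case True
  have "{\<omega> \<in> space M. order_index (\<lambda>j. v j \<omega>) n i = j} \<in> sets M" for j
  proof (cases "j \<in> {1..n}")
    case False
    then have "{\<omega> \<in> space M. order_index (\<lambda>j. v j \<omega>) n i = j} = {}"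
      using order_index_range[OF True] by blast
    then show ?thesis by (metis sets.empty_sets)
  next
    case j: True
    have "{\<omega> \<in> space M. precedes (\<lambda>j. v j \<omega>) l j} \<in> sets M" if "l \<in> {1..n}" for l
    proof -
      have [measurable]: "v l \<in> borel_measurable M" "v j \<in> borel_measurable M"
        using v[of l] v[of j] that j by auto
      show ?thesis unfolding precedes_def by measurable
    qed
    then have pm: "(\<lambda>\<omega>. indicator {\<omega> \<in> space M. precedes (\<lambda>j. v j \<omega>) l j} \<omega> :: real) \<in> borel_measurable M"
      if "l \<in> {1..n}" for l using that by (intro borel_measurable_indicator)
    define R where "R \<omega> = (\<Sum>l\<in>{1..n}. if l = j then 1 else indicator {\<omega> \<in> space M. precedes (\<lambda>j. v j \<omega>) l j} \<omega> :: real)" for \<omega>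
    have Rm[measurable]: "R \<in> borel_measurable M"
      unfolding R_def using pm by (intro borel_measurable_sum) auto
    have R: "R \<omega> = real (order_rank (\<lambda>j. v j \<omega>) n j)" if "\<omega> \<in> space M" for \<omega>
    proof -
      have "R \<omega> = (\<Sum>l\<in>{1..n}. if l = j \<or> precedes (\<lambda>j. v j \<omega>) l j then 1 else 0)"
        unfolding R_def using that by (intro sum.cong) (auto simp: indicator_def)
      also have "\<dots> = real (card {l \<in> {1..n}. l = j \<or> precedes (\<lambda>j. v j \<omega>) l j})"
        by (subst sum.inter_filter[symmetric]) auto
      finally show ?thesis by (simp add: order_rank_def)
    qed
    have "{\<omega> \<in> space M. order_index (\<lambda>j. v j \<omega>) n i = j} = {\<omega> \<in> space M. R \<omega> = real i}"
      using R unfolding order_index_eq_iff[OF True j] by auto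
    also have "\<dots> \<in> sets M" by measurable
    finally show ?thesis .
  qed
  then show ?thesis
    by (subst measurable_count_space_eq2_countable) (auto simp: vimage_def Int_def conj_commute)
qed

section \<open>Borel sets of finite products\<close>

lemma openin_product_box:
  assumes "openin (product_topology (\<lambda>_. euclidean) I) U" "x \<in> U"
  obtains V where "\<And>i. i \<in> I \<Longrightarrow> open (V i)" "x \<in> PiE I V" "PiE I V \<subseteq> U"
proof -
  have "\<forall>x\<in>U. \<exists>V. finite {i \<in> I. V i \<noteq> topspace euclidean} \<and> (\<forall>i\<in>I. openin euclidean (V i)) \<and>
      x \<in> PiE I V \<and> PiE I V \<subseteq> U"
    using assms(1) unfolding openin_product_topology_alt .
  then obtain V where "\<forall>i\<in>I. openin euclidean (V i)" "x \<in> PiE I V" "PiE I V \<subseteq> U"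
    using assms(2) by blast
  then show ?thesis using that[of V] by (simp flip: open_openin)
qed

text \<open>Boxes over a countable base form a countable family as \<open>I\<close> is finite, and
  every open set is the union of those it contains.\<close>

lemma openin_product_in_PiM:
  fixes U :: "('i \<Rightarrow> 'b::second_countable_topology) set"
  assumes I: "finite I" and U: "openin (product_topology (\<lambda>_. euclidean) I) U"
  shows "U \<in> sets (PiM I (\<lambda>_. borel))"
proof -
  obtain \<B> :: "'b set set" where \<B>: "countable \<B>" "topological_basis \<B>"
    using ex_countable_basis by blast
  define \<C> where "\<C> = {b \<in> PiE I (\<lambda>_. \<B>). PiE I b \<subseteq> U}"
  have countable: "countable \<C>" unfolding \<C>_def using I \<B>(1) by (intro countable_Collect countable_PiE) auto
  have "U = (\<Union>b\<in>\<C>. PiE I b)"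
  proof (intro equalityI subsetI)
    fix x assume x: "x \<in> U"
    obtain V where V: "\<And>i. i \<in> I \<Longrightarrow> open (V i)" "x \<in> PiE I V" "PiE I V \<subseteq> U"
      using openin_product_box[OF U x] by blast
    have "\<exists>B\<in>\<B>. x i \<in> B \<and> B \<subseteq> V i" if "i \<in> I" for i
      using \<B>(2) V(1)[OF that] V(2) that by (meson PiE_mem topological_basisE)
    then obtain b where b: "\<And>i. i \<in> I \<Longrightarrow> b i \<in> \<B> \<and> x i \<in> b i \<and> b i \<subseteq> V i" by metis
    have "PiE I (restrict b I) = PiE I b" by (intro PiE_cong) auto
    moreover have "PiE I b \<subseteq> PiE I V" using b by (intro PiE_mono) auto
    ultimately have "restrict b I \<in> \<C>" using b V(3) by (auto simp: \<C>_def)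
    moreover have "x \<in> PiE I (restrict b I)" using b V(2) by (auto simp: PiE_iff)
    ultimately show "x \<in> (\<Union>b\<in>\<C>. PiE I b)" by blast
  qed (auto simp: \<C>_def)
  also have "\<dots> \<in> sets (PiM I (\<lambda>_. borel))"
  proof (rule sets.countable_UN''[OF countable])
    fix b assume "b \<in> \<C>"
    then have "open (b i)" if "i \<in> I" for i
      using that topological_basis_open[OF \<B>(2)] by (auto simp: \<C>_def PiE_iff)
    then show "PiE I b \<in> sets (PiM I (\<lambda>_. borel))" using I by (intro sets_PiM_I_finite) auto
  qed
  finally show ?thesis .
qed

lemma measurable_borel_of_product:
  fixes Y :: "'i \<Rightarrow> 'w \<Rightarrow> 'b::second_countable_topology"
  assumes I: "finite I" and Y: "\<And>i. i \<in> I \<Longrightarrow> Y i \<in> borel_measurable M"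
  shows "(\<lambda>\<omega>. \<lambda>i\<in>I. Y i \<omega>) \<in> measurable M (borel_of (product_topology (\<lambda>_. euclidean) I))"
proof (rule measurable_borel_of)
  have Ym: "(\<lambda>\<omega>. \<lambda>i\<in>I. Y i \<omega>) \<in> measurable M (PiM I (\<lambda>_. borel))"
    by (intro measurable_restrict Y)
  show "{\<omega> \<in> space M. (\<lambda>i\<in>I. Y i \<omega>) \<in> U} \<in> sets M"
    if "openin (product_topology (\<lambda>_. euclidean) I) U" for U
    using measurable_sets[OF Ym openin_product_in_PiM[OF I that]]
    by (simp add: vimage_def Int_def conj_commute)
qed simp

section \<open>Vague neighbourhoods that locate the largest points\<close>

context marked_series
begin

definition level :: "nat \<Rightarrow> 'q \<Rightarrow> real" where
  "level k \<omega> = mass powr (1 / \<alpha>) * \<Gamma> k \<omega> powr (- 1 / \<alpha>)"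

lemma level_pos: "k \<ge> 1 \<Longrightarrow> \<omega> \<in> space Q \<Longrightarrow> level k \<omega> > 0"
  using mass_pos arrivals_pos[OF std, of \<omega> k] by (simp add: level_def)

lemma level_strict_antimono:
  assumes "\<omega> \<in> space Q" "1 \<le> i" "i < j"
  shows "level j \<omega> < level i \<omega>"
proof -
  have "\<Gamma> j \<omega> powr (- 1 / \<alpha>) < \<Gamma> i \<omega> powr (- 1 / \<alpha>)"
    using alpha_pos by (intro powr_less_mono2_neg arrivals_pos[OF std assms(1,2)] arrivals_strict_mono[OF std assms]) simp
  then show ?thesis using mass_pos by (simp add: level_def)
qed

lemma f_point_level: "k \<ge> 1 \<Longrightarrow> \<omega> \<in> space Q \<Longrightarrow> f (point k \<omega>) = ennreal (level k \<omega>)"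
  unfolding level_def by (rule f_point)

lemma point_eq: "point k \<omega> = to_ereal_vec (level k \<omega> *\<^sub>R \<Theta> k \<omega>)"
  by (simp add: point_def polar_point_def level_def)

text \<open>A witness for a vague neighbourhood: under \<open>separates\<close>, a point measure with
  \<open>\<integral> h i > 0\<close> for \<open>1 \<le> i \<le> m\<close> and \<open>\<integral> b < m + 1\<close> has exactly \<open>m\<close> points in \<open>{f \<ge> s m}\<close>, one in each
  shell \<open>{s i < f < s (i - 1)}\<close>, and the \<open>i\<close>-th largest of them lies in \<open>V i\<close>.\<close>

definition separates ::
  "nat \<Rightarrow> (nat \<Rightarrow> real) \<Rightarrow> (nat \<Rightarrow> (real ^ 'd) set) \<Rightarrow> (nat \<Rightarrow> ereal ^ 'd \<Rightarrow> real) \<Rightarrow> (ereal ^ 'd \<Rightarrow> real) \<Rightarrow> bool" where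
  "separates m s V h b \<longleftrightarrow>
     (\<forall>i j. i \<le> j \<and> j \<le> m \<longrightarrow> s j \<le> s i) \<and>
     (\<forall>i\<in>{1..m}. h i \<in> Cc0 \<and>
       (\<forall>x. 0 \<le> h i x \<and> (h i x \<noteq> 0 \<longrightarrow> ennreal (s i) < f x \<and> f x < ennreal (s (i - 1)) \<and> x \<in> to_ereal_vec ` V i))) \<and>
     b \<in> Cc0 \<and> (\<forall>x. 0 \<le> b x \<and> (ennreal (s m) \<le> f x \<longrightarrow> b x = 1))"

definition neighbourhood :: "nat \<Rightarrow> (nat \<Rightarrow> ereal ^ 'd \<Rightarrow> real) \<Rightarrow> (ereal ^ 'd \<Rightarrow> real) \<Rightarrow> (ereal ^ 'd) measure set" where
  "neighbourhood m h b =
     {\<mu> \<in> point_measures E. (\<forall>i\<in>{1..m}. (\<integral>x. h i x \<partial>\<mu>) > 0) \<and> (\<integral>x. b x \<partial>\<mu>) < real m + 1}"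

lemma openin_neighbourhood:
  assumes "separates m s V h b"
  shows "openin (vague_topology E) (neighbourhood m h b)"
proof -
  have "openin (vague_topology E) {\<mu> \<in> point_measures E. (\<integral>x. b x \<partial>\<mu>) \<in> {..<real m + 1}}"
    using assms by (intro openin_vague_integral) (auto simp: separates_def)
  moreover have "openin (vague_topology E) {\<mu> \<in> point_measures E. (\<integral>x. h i x \<partial>\<mu>) \<in> {0<..}}" if "i \<in> {1..m}" for i
    using assms that by (intro openin_vague_integral) (auto simp: separates_def)
  \<comment> \<open>Inserting \<open>topspace\<close> keeps the intersected family nonempty when
    \<open>m = 0\<close>.\<close>
  ultimately have "openin (vague_topology E)
      ({\<mu> \<in> point_measures E. (\<integral>x. b x \<partial>\<mu>) \<in> {..<real m + 1}} \<inter>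
       \<Inter> (insert (topspace (vague_topology E)) ((\<lambda>i. {\<mu> \<in> point_measures E. (\<integral>x. h i x \<partial>\<mu>) \<in> {0<..}}) ` {1..m})))"
    by (intro openin_Int openin_Inter) auto
  also have "\<dots> = neighbourhood m h b"
    by (auto simp: neighbourhood_def topspace_vague)
  finally show ?thesis .
qed

lemma series_in_neighbourhood:
  assumes \<omega>: "\<omega> \<in> space Q" and m: "m \<ge> 1"
    and V: "\<And>i. i \<in> {1..m} \<Longrightarrow> open (V i)" "\<And>i. i \<in> {1..m} \<Longrightarrow> level i \<omega> *\<^sub>R \<Theta> i \<omega> \<in> V i"
  obtains s h b where "separates m s V h b" "series \<omega> \<in> neighbourhood m h b"
proof -
  \<comment> \<open>Midpoints between consecutive levels, which decrease strictly;
    \<open>s 0\<close> is any number above the largest level. Thus the \<open>i\<close>-th point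
    lies alone in the \<open>i\<close>-th shell.\<close>
  define s where "s i = (if i = 0 then level 1 \<omega> + 1 else (level i \<omega> + level (Suc i) \<omega>) / 2)" for i
  have s_between: "level (Suc i) \<omega> < s i" for i
    using level_strict_antimono[OF \<omega>, of i "Suc i"] by (auto simp: s_def field_simps)
  have s_less: "s i < level i \<omega>" if "i \<ge> 1" for i
    using level_strict_antimono[OF \<omega>, of i "Suc i"] that by (auto simp: s_def field_simps)
  have s_pos: "s i > 0" for i
    using s_between[of i] level_pos[OF _ \<omega>, of "Suc i"] by simp
  have s_dec: "s (Suc i) \<le> s i" for i
    using s_between[of i] s_less[of "Suc i"] by simp
  have s_mono: "s j \<le> s i" if "i \<le> j" for i j
    using that by (induction rule: dec_induct) (auto intro: order_trans s_dec)
  have "\<exists>h. h \<in> Cc0 \<and> (\<forall>x. 0 \<le> h x \<and> (h x \<noteq> 0 \<longrightarrow> ennreal (s i) < f x \<and> f x < ennreal (s (i - 1)) \<and> x \<in> to_ereal_vec ` V i))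
      \<and> h (point i \<omega>) > 0" if i: "i \<in> {1..m}" for i
  proof -
    define B where "B = {x. f x > ennreal (s i)} \<inter> {x. f x < ennreal (s (i - 1))} \<inter> to_ereal_vec ` V i"
    have "open B" unfolding B_def
      using V(1)[OF i] by (intro open_Int open_f_greater open_to_ereal_vec_image open_Collect_less f_cont continuous_on_const)
    moreover have "ennreal (s i) \<le> f x" if "x \<in> B" for x using that by (auto simp: B_def)
    ultimately obtain h :: "nat \<Rightarrow> ereal ^ 'd \<Rightarrow> real"
      where h: "\<And>k. h k \<in> Cc0" "\<And>k x. 0 \<le> h k x" "\<And>k x. h k x \<le> indicator B x"
        "\<And>x. (\<lambda>k. h k x) \<longlonglongrightarrow> indicator B x"
      using open_indicator_approx[OF _ s_pos] by blast
    have "point i \<omega> \<in> B"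
    proof -
      have "ennreal (s i) < f (point i \<omega>)"
        using i f_point_level[OF _ \<omega>, of i] s_less[of i] s_pos[of i] by (simp add: ennreal_less_iff)
      moreover have "f (point i \<omega>) < ennreal (s (i - 1))"
        using i f_point_level[OF _ \<omega>, of i] s_between[of "i - 1"] level_pos[OF _ \<omega>, of i] by (simp add: ennreal_less_iff)
      ultimately show ?thesis using V(2)[OF i] by (simp add: B_def point_eq)
    qed
    then have "(\<lambda>k. h k (point i \<omega>)) \<longlonglongrightarrow> 1" using h(4)[of "point i \<omega>"] by simp
    then have "\<forall>\<^sub>F k in sequentially. 0 < h k (point i \<omega>)" by (rule order_tendstoD) simp
    then obtain k where k: "0 < h k (point i \<omega>)" by (auto simp: eventually_sequentially)
    have "x \<in> B" if "h k x \<noteq> 0" for x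
      using h(2)[of k x] h(3)[of k x] that by (cases "x \<in> B") auto
    then show ?thesis using h(1,2) k by (intro exI[of _ "h k"]) (auto simp: B_def)
  qed
  then obtain h where h: "\<And>i. i \<in> {1..m} \<Longrightarrow> h i \<in> Cc0"
    "\<And>i x. i \<in> {1..m} \<Longrightarrow> 0 \<le> h i x \<and> (h i x \<noteq> 0 \<longrightarrow> ennreal (s i) < f x \<and> f x < ennreal (s (i - 1)) \<and> x \<in> to_ereal_vec ` V i)"
    "\<And>i. i \<in> {1..m} \<Longrightarrow> h i (point i \<omega>) > 0"
    by metis
  \<comment> \<open>The cutoff vanishes from the level of point \<open>m + 1\<close> downwards and
    is 1 from \<open>s m\<close> upwards. The first \<open>m\<close> points contribute at most 1
    each and the others nothing, so its integral is below \<open>m + 1\<close>.\<close>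
  define b where "b = bump (level (Suc m) \<omega>) (s m)"
  have lm: "0 < level (Suc m) \<omega>" "level (Suc m) \<omega> < s m"
    using level_pos[OF _ \<omega>, of "Suc m"] s_between by auto
  have b: "b \<in> Cc0" unfolding b_def by (rule bump_Cc0[OF lm])
  have "separates m s V h b"
    unfolding separates_def using s_mono h(1,2) b bump_nonneg bump_eq_1[OF lm] by (auto simp: b_def)
  moreover have "series \<omega> \<in> neighbourhood m h b"
    unfolding neighbourhood_def
  proof (intro CollectI conjI ballI series_point_measure[OF \<omega>])
    fix i assume i: "i \<in> {1..m}"
    have "h i (point i \<omega>) \<le> (\<Sum>k\<in>{1..K}. h i (point k \<omega>))" if "K \<ge> i" for K
      using i that h(2)[OF i] by (intro member_le_sum) auto
    then have "h i (point i \<omega>) \<le> (\<integral>x. h i x \<partial>series \<omega>)"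
      by (intro LIMSEQ_le_const[OF series_integral_eventually[OF h(1)[OF i] \<omega>]]) auto
    then show "0 < (\<integral>x. h i x \<partial>series \<omega>)" using h(3)[OF i] by simp
  next
    have "(\<Sum>k\<in>{1..K}. b (point k \<omega>)) \<le> real m" for K
    proof -
      have zero: "b (point k \<omega>) = 0" if "k > m" for k
      proof (rule ccontr)
        assume "b (point k \<omega>) \<noteq> 0"
        then have "ennreal (level (Suc m) \<omega>) < f (point k \<omega>)" unfolding b_def by (rule bump_nonzero[OF lm])
        then have "level (Suc m) \<omega> < level k \<omega>"
          using that lm(1) f_point_level[OF _ \<omega>, of k] by (simp add: ennreal_less_iff)
        then show False using level_strict_antimono[OF \<omega>, of "Suc m" k] that by (cases "k = Suc m") auto
      qed
      have "(\<Sum>k\<in>{1..K}. b (point k \<omega>)) \<le> (\<Sum>k\<in>{1..K}. if k \<le> m then 1 else 0)"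
        using zero bump_le_1 by (intro sum_mono) (auto simp: b_def)
      also have "\<dots> = real (card {k \<in> {1..K}. k \<le> m})"
        by (subst sum.inter_filter[symmetric]) auto
      also have "\<dots> \<le> real (card {1..m})" by (intro of_nat_mono card_mono) auto
      finally show ?thesis by simp
    qed
    then have "(\<integral>x. b x \<partial>series \<omega>) \<le> real m"
      by (intro LIMSEQ_le_const2[OF series_integral_eventually[OF b \<omega>]]) auto
    then show "(\<integral>x. b x \<partial>series \<omega>) < real m + 1" by simp
  qed
  ultimately show ?thesis by (rule that)
qed

text \<open>Positive integrals of the \<open>h i\<close> provide one sample index \<open>j i\<close>
  per shell. The bound on the integral of \<open>b\<close> excludes further indices above level
  \<open>s m\<close>, so \<open>j i\<close> must have rank \<open>i\<close>. Ties cannot occur among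
  the selected indices, because the shells are disjoint.\<close>

lemma sample_in_neighbourhood:
  assumes n: "n \<ge> 1" and sep: "separates m s V h b" and S: "sample X n \<omega> \<in> neighbourhood m h b"
    and i: "i \<in> {1..m}"
  shows "(1 / a n) *\<^sub>R X (order_index (\<lambda>j. f (to_ereal_vec (X j \<omega>))) n i) \<omega> \<in> V i"
proof -
  define v where "v j = f (to_ereal_vec (X j \<omega>))" for j
  define w where "w j = f (scaled n (X j \<omega>))" for j
  have w: "w j = ennreal (1 / a n) * v j" for j
    using a_pos[OF n] by (simp add: w_def v_def scaled_def to_ereal_vec_scale f_scale)
  have wv: "w i \<le> w j" if "v i \<le> v j" for i j
    unfolding w using that by (rule mult_left_mono) simp
  note sep' = sep[unfolded separates_def]
  have s_anti: "ennreal (s j) \<le> ennreal (s i)" if "i \<le> j" "j \<le> m" for i j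
    using sep' that by (intro ennreal_leI) blast
  have "\<exists>j\<in>{1..n}. h i (scaled n (X j \<omega>)) \<noteq> 0" if i: "i \<in> {1..m}" for i
  proof (rule ccontr)
    assume "\<not> (\<exists>j\<in>{1..n}. h i (scaled n (X j \<omega>)) \<noteq> 0)"
    then have "(\<Sum>j\<in>{1..n}. h i (scaled n (X j \<omega>))) = 0" by (intro sum.neutral) auto
    moreover have "h i \<in> Cc0" using sep' i by blast
    moreover have "0 < (\<integral>x. h i x \<partial>sample X n \<omega>)" using S i unfolding neighbourhood_def by blast
    ultimately show False by (simp add: sample_integral)
  qed
  then obtain j where j: "\<And>i. i \<in> {1..m} \<Longrightarrow> j i \<in> {1..n}" "\<And>i. i \<in> {1..m} \<Longrightarrow> h i (scaled n (X (j i) \<omega>)) \<noteq> 0"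
    by metis
  have wj: "ennreal (s i) < w (j i)" "w (j i) < ennreal (s (i - 1))" "scaled n (X (j i) \<omega>) \<in> to_ereal_vec ` V i"
    if "i \<in> {1..m}" for i
    using sep' j(2)[OF that] that unfolding w_def by blast+
  have w_less: "w (j i') < w (j i)" if "i \<in> {1..m}" "i' \<in> {1..m}" "i < i'" for i i'
  proof -
    have "w (j i') < ennreal (s (i' - 1))" by (rule wj(2)[OF that(2)])
    also have "\<dots> \<le> ennreal (s i)" using that by (intro s_anti) auto
    also have "\<dots> < w (j i)" by (rule wj(1)[OF that(1)])
    finally show ?thesis .
  qed
  have inj: "inj_on j {1..m}"
  proof (rule inj_onI, rule ccontr)
    fix x y assume "x \<in> {1..m}" "y \<in> {1..m}" "j x = j y" "x \<noteq> y"
    then show False using w_less[of x y] w_less[of y x] by (cases "x < y") auto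
  qed
  define C where "C = {l \<in> {1..n}. ennreal (s m) \<le> w l}"
  have "j ` {1..m} \<subseteq> C"
  proof
    fix l assume "l \<in> j ` {1..m}"
    then obtain i where i: "i \<in> {1..m}" "l = j i" by blast
    have "ennreal (s m) \<le> ennreal (s i)" using i by (intro s_anti) auto
    then show "l \<in> C" using wj(1)[OF i(1)] j(1)[OF i(1)] i by (auto simp: C_def)
  qed
  moreover have "card C \<le> m"
  proof -
    have "real (card C) = (\<Sum>l\<in>C. b (scaled n (X l \<omega>)))"
      using sep' by (simp add: C_def w_def)
    also have "\<dots> \<le> (\<Sum>l\<in>{1..n}. b (scaled n (X l \<omega>)))"
      using sep' by (intro sum_mono2) (auto simp: C_def)
    also have "\<dots> = (\<integral>x. b x \<partial>sample X n \<omega>)" using sep' by (simp add: sample_integral)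
    also have "\<dots> < real m + 1" using S unfolding neighbourhood_def by blast
    finally show ?thesis by linarith
  qed
  moreover have "finite C" by (simp add: C_def)
  \<comment> \<open>Different shells give \<open>m\<close> different indices in \<open>C\<close>,
    and \<open>C\<close> has at most \<open>m\<close> elements.\<close>
  ultimately have C: "j ` {1..m} = C"
    using card_image[OF inj] by (intro card_seteq) auto
  have "{l \<in> {1..n}. l = j i \<or> precedes v l (j i)} = j ` {1..i}"
  proof (intro equalityI subsetI)
    fix l assume l: "l \<in> {l \<in> {1..n}. l = j i \<or> precedes v l (j i)}"
    have le: "w (j i) \<le> w l" using l by (auto simp: precedes_def intro: wv less_imp_le)
    have "ennreal (s m) \<le> ennreal (s i)" using i by (intro s_anti) auto
    then have "l \<in> C" using wj(1)[OF i] le l by (auto simp: C_def)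
    then obtain i' where i': "i' \<in> {1..m}" "l = j i'" using C by blast
    have "i' \<le> i" using w_less[OF i i'(1)] le i'(2) by (cases "i < i'") auto
    then show "l \<in> j ` {1..i}" using i' by auto
  next
    fix l assume "l \<in> j ` {1..i}"
    then obtain i' where i': "1 \<le> i'" "i' \<le> i" "l = j i'" by auto
    have im: "i' \<in> {1..m}" using i' i by auto
    have "v (j i') > v (j i)" if "i' < i"
      using w_less[OF im i that] wv[of "j i'" "j i"] by (auto simp: not_le[symmetric])
    then have "l = j i \<or> precedes v l (j i)" using i' by (cases "i' = i") (auto simp: precedes_def)
    then show "l \<in> {l \<in> {1..n}. l = j i \<or> precedes v l (j i)}" using j(1)[OF im] i' by auto
  qed
  moreover have "inj_on j {1..i}" using inj i by (auto intro: inj_on_subset)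
  ultimately have rank_j: "order_rank v n (j i) = i" by (simp add: order_rank_def card_image)
  \<comment> \<open>A rank lies in \<open>{1..n}\<close>, so \<open>i \<le> n\<close> is a
    consequence of membership in the neighbourhood; the default \<open>order_index v n i = i\<close>
    for \<open>i > n\<close> is not met here.\<close>
  then have "i \<in> {1..n}" using bij_betw_apply[OF rank_bij j(1)[OF i], of v] rank_j by simp
  then have "order_index v n i = j i" using order_index_eq_iff[OF _ j(1)[OF i]] rank_j by blast
  moreover have "(1 / a n) *\<^sub>R X (j i) \<omega> \<in> V i"
    using wj(3)[OF i] by (auto simp: scaled_def) (metis of_to_ereal_vec)
  ultimately show ?thesis by (simp add: v_def[abs_def])
qed

theorem order_statistics_converge:
  assumes M: "prob_space M" and indep: "prob_space.indep_vars M (\<lambda>_. borel) X {1..}"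
    and copies: "\<And>i. i \<ge> 1 \<Longrightarrow> distr M borel (X i) = distr M\<^sub>0 borel X\<^sub>0"
    and m: "m \<ge> 1"
  shows "converges_in_distribution (product_topology (\<lambda>_. euclidean) {1..m})
    M (\<lambda>n \<omega>. \<lambda>i\<in>{1..m}. (1 / a n) *\<^sub>R X (order_index (\<lambda>j. f (to_ereal_vec (X j \<omega>))) n i) \<omega>)
    Q (\<lambda>\<omega>. \<lambda>i\<in>{1..m}. level i \<omega> *\<^sub>R \<Theta> i \<omega>)" (is "converges_in_distribution ?T M ?Y Q ?Z")
proof -
  interpret M: prob_space M by fact
  interpret Q: prob_space Q by (rule prob_Q)
  have Xm: "X i \<in> borel_measurable M" if "i \<ge> 1" for i
    using indep that unfolding M.indep_vars_def by (meson atLeast_iff)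
  have Sm: "sample X n \<in> measurable M (borel_of (vague_topology E))" for n
    by (rule sample_measurable[OF Xm])
  have Ym: "?Y n \<in> measurable M (borel_of ?T)" for n
  proof (rule measurable_borel_of_product)
    fix i assume i: "i \<in> {1..m}"
    define ix where "ix \<omega> = order_index (\<lambda>j. f (to_ereal_vec (X j \<omega>))) n i" for \<omega>
    have "(\<lambda>\<omega>. f (to_ereal_vec (X j \<omega>))) \<in> borel_measurable M" if "j \<ge> 1" for j
      using measurable_compose[OF measurable_compose[OF Xm[OF that] to_ereal_vec_measurable] f_borel] .
    then have ixm: "ix \<in> measurable M (count_space UNIV)"
      unfolding ix_def by (rule measurable_order_index)
    have "ix \<omega> \<ge> 1" for \<omega>
      unfolding ix_def using i order_index_range[of i n] order_index_outside[of i n]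
      by (cases "i \<in> {1..n}") (force simp: order_index_outside)+
    \<comment> \<open>Indices are at least 1, by the default also when \<open>i > n\<close>. Writing
      \<open>max 1\<close> lets the composition range over all naturals while using measurability of
      \<open>X j\<close> for \<open>j \<ge> 1\<close> only.\<close>
    then have eq: "X (ix \<omega>) \<omega> = X (max 1 (ix \<omega>)) \<omega>" for \<omega> by (simp add: max_absorb2)
    have "(\<lambda>\<omega>. X (max 1 (ix \<omega>)) \<omega>) \<in> borel_measurable M"
      by (rule measurable_compose_countable[OF _ ixm, of "\<lambda>j. X (max 1 j)"]) (simp add: Xm)
    then show "(\<lambda>\<omega>. (1 / a n) *\<^sub>R X (order_index (\<lambda>j. f (to_ereal_vec (X j \<omega>))) n i) \<omega>) \<in> borel_measurable M"
      unfolding ix_def[symmetric] eq by measurable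
  qed simp
  have Zm: "?Z \<in> measurable Q (borel_of ?T)"
  proof (rule measurable_borel_of_product)
    fix i assume i: "i \<in> {1..m}"
    have "(\<lambda>\<theta>. \<theta>) \<in> borel_measurable (restrict_space borel (unit_sphere f))"
      by (rule measurable_restrict_space1) simp
    then have "(\<lambda>\<theta>. \<theta>) \<in> borel_measurable angular"
      using measurable_cong_sets[OF sets_angular refl] by blast
    then have [measurable]: "\<Theta> i \<in> borel_measurable Q"
      using measurable_compose[OF marks_measurable, of i] i by auto
    have [measurable]: "\<Gamma> i \<in> borel_measurable Q" using i by (intro arrivals_measurable[OF std]) auto
    show "(\<lambda>\<omega>. level i \<omega> *\<^sub>R \<Theta> i \<omega>) \<in> borel_measurable Q" unfolding level_def by measurable
  qed simp
  show ?thesis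
  proof (rule converges_in_distribution_of_open_sets[OF M prob_Q Ym Zm])
    fix U e assume U: "openin ?T U" and e: "e > (0::real)"
    \<comment> \<open>The union runs over all witnesses whose box fits into \<open>U\<close>, since
      the thresholds and test functions depend on \<open>\<omega>\<close>. It is open as a union of
      open sets, so no measurable choice of witnesses is involved.\<close>
    define \<O> where "\<O> = \<Union> {neighbourhood m h b | s V h b. separates m s V h b \<and> PiE {1..m} V \<subseteq> U}"
    have O: "openin (vague_topology E) \<O>"
      unfolding \<O>_def by (rule openin_Union) (auto intro: openin_neighbourhood)
    have "{\<omega> \<in> space Q. ?Z \<omega> \<in> U} \<subseteq> {\<omega> \<in> space Q. series \<omega> \<in> \<O>}"
    proof (intro subsetI CollectI conjI)
      fix \<omega> assume "\<omega> \<in> {\<omega> \<in> space Q. ?Z \<omega> \<in> U}"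
      then have \<omega>: "\<omega> \<in> space Q" "?Z \<omega> \<in> U" by auto
      then show "\<omega> \<in> space Q" by simp
      obtain V where V: "\<And>i. i \<in> {1..m} \<Longrightarrow> open (V i)" "?Z \<omega> \<in> PiE {1..m} V" "PiE {1..m} V \<subseteq> U"
        using openin_product_box[OF U \<omega>(2)] by blast
      have in_V: "level i \<omega> *\<^sub>R \<Theta> i \<omega> \<in> V i" if "i \<in> {1..m}" for i
        using PiE_mem[OF V(2) that] that by simp
      obtain s h b where "separates m s V h b" "series \<omega> \<in> neighbourhood m h b"
        by (rule series_in_neighbourhood[where V = V, OF \<omega>(1) m V(1) in_V])
      then show "series \<omega> \<in> \<O>" using V(3) unfolding \<O>_def by blast
    qed
    then have 1: "measure Q {\<omega> \<in> space Q. ?Z \<omega> \<in> U} \<le> measure Q {\<omega> \<in> space Q. series \<omega> \<in> \<O>}"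
      by (intro Q.finite_measure_mono measurable_borel_of_openin[OF series_measurable O])
    have "measure M {\<omega> \<in> space M. sample X n \<omega> \<in> \<O>} \<le> measure M {\<omega> \<in> space M. ?Y n \<omega> \<in> U}" if n: "n \<ge> 1" for n
    proof (intro M.finite_measure_mono measurable_borel_of_openin[OF Ym U] subsetI)
      fix \<omega> assume "\<omega> \<in> {\<omega> \<in> space M. sample X n \<omega> \<in> \<O>}"
      then obtain s V h b where V: "\<omega> \<in> space M" "sample X n \<omega> \<in> neighbourhood m h b" "separates m s V h b" "PiE {1..m} V \<subseteq> U"
        unfolding \<O>_def by blast
      have "?Y n \<omega> \<in> PiE {1..m} V"
        using sample_in_neighbourhood[OF n V(3,2)] by auto
      then show "\<omega> \<in> {\<omega> \<in> space M. ?Y n \<omega> \<in> U}" using V(1,4) by blast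
    qed
    then have 2: "\<forall>\<^sub>F n in sequentially. measure M {\<omega> \<in> space M. sample X n \<omega> \<in> \<O>} \<le> measure M {\<omega> \<in> space M. ?Y n \<omega> \<in> U}"
      by (auto simp: eventually_sequentially)
    have "\<forall>\<^sub>F n in sequentially.
      measure Q {\<omega> \<in> space Q. series \<omega> \<in> \<O>} - e < measure M {\<omega> \<in> space M. sample X n \<omega> \<in> \<O>}"
      using O e by (intro laplace_open_set_lower_bound M prob_Q Sm series_measurable)
        (simp_all add: series_laplace sample_laplace[OF M indep copies])
    with 2 show "\<forall>\<^sub>F n in sequentially.
      measure Q {\<omega> \<in> space Q. ?Z \<omega> \<in> U} - e < measure M {\<omega> \<in> space M. ?Y n \<omega> \<in> U}"
      by eventually_elim (use 1 in linarith)
  qed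
qed

end

section \<open>Translation back to the definitions in terms of \<open>E\<close> and
  \<open>c\<close>\<close>

theorem theorem5p1:
  fixes f :: "ereal ^ 'd \<Rightarrow> ennreal"
    and \<alpha> c :: real and a :: "nat \<Rightarrow> real" and \<nu> :: "(ereal ^ 'd) measure"
    and D E :: "(ereal ^ 'd) set"
    and M\<^sub>0 :: "'v measure" and X\<^sub>0 :: "'v \<Rightarrow> real ^ 'd"
    and M :: "'w measure" and X :: "nat \<Rightarrow> 'w \<Rightarrow> real ^ 'd"
    and P :: "'p measure" and N :: "'p \<Rightarrow> (ereal ^ 'd) measure"
    and Q :: "'q measure" and \<Gamma> :: "nat \<Rightarrow> 'q \<Rightarrow> real" and \<Theta> :: "nat \<Rightarrow> 'q \<Rightarrow> real ^ 'd"
  assumes f_cont: "continuous_on UNIV f"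
    and f_hom: "homogeneous f"
    and f_fin: "\<And>x. f (to_ereal_vec x) < \<infinity>"
    and D_eq: "D = {x. f x = 0}" and E_eq: "E = - D"
    and rv: "RV M\<^sub>0 X\<^sub>0 \<alpha> a D \<nu>"
    and M: "prob_space M"
    and indep: "prob_space.indep_vars M (\<lambda>_. borel) X {1..}"
    and copies: "\<And>i. i \<ge> 1 \<Longrightarrow> distr M borel (X i) = distr M\<^sub>0 borel X\<^sub>0"
    and c_eq: "c = measure \<nu> {x. f x > 1}"
  shows
    "(poisson_process P E \<nu> N \<longrightarrow>
        converges_in_distribution (vague_topology E)
          M (\<lambda>n \<omega>. counting_measure E {1..n} (\<lambda>i. to_ereal_vec ((1 / a n) *\<^sub>R X i \<omega>)))
          P N)
     \<and>
     (0 < c \<and> emeasure \<nu> {x. f x > 1} = ennreal c \<and>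
      emeasure (spectral_measure f \<nu>) (unit_sphere f) = ennreal c \<and>
      (poisson_process P E \<nu> N \<and>
       marked_poisson_arrivals Q \<Gamma> (scale_measure (ennreal (1 / c)) (spectral_measure f \<nu>)) \<Theta> \<longrightarrow>
         equal_in_distribution (vague_topology E)
           P N
           Q (\<lambda>\<omega>. counting_measure E {1..}
                (\<lambda>k. to_ereal_vec
                  ((c powr (1 / \<alpha>) * \<Gamma> k \<omega> powr (- 1 / \<alpha>)) *\<^sub>R \<Theta> k \<omega>)))))
     \<and>
     (marked_poisson_arrivals Q \<Gamma> (scale_measure (ennreal (1 / c)) (spectral_measure f \<nu>)) \<Theta> \<longrightarrow>
       (\<forall>m\<ge>1.
         converges_in_distribution (product_topology (\<lambda>_. euclidean) {1..m})
           M (\<lambda>n \<omega>. \<lambda>i\<in>{1..m}.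
               (1 / a n) *\<^sub>R X (order_index (\<lambda>j. f (to_ereal_vec (X j \<omega>))) n i) \<omega>)
           Q (\<lambda>\<omega>. \<lambda>i\<in>{1..m}.
               (c powr (1 / \<alpha>) * \<Gamma> i \<omega> powr (- 1 / \<alpha>)) *\<^sub>R \<Theta> i \<omega>)))"
proof -
  interpret regularly_varying f \<alpha> a \<nu> M\<^sub>0 X\<^sub>0
    using f_cont f_hom f_fin rv by unfold_locales (simp_all add: D_eq)
  have E: "E = - {x. f x = 0}" by (simp add: E_eq D_eq)
  have c: "c = mass" by (simp add: c_eq mass_def)
  have angular: "scale_measure (ennreal (1 / c)) (spectral_measure f \<nu>) = angular"
    by (simp add: angular_def c)
  have sample: "(\<lambda>n \<omega>. counting_measure E {1..n} (\<lambda>i. to_ereal_vec ((1 / a n) *\<^sub>R X i \<omega>))) = sample X"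
    by (simp add: sample_def[abs_def] scaled_def E)
  have marked: "marked_series f \<alpha> a \<nu> M\<^sub>0 X\<^sub>0 Q \<Gamma> \<Theta>" if "marked_poisson_arrivals Q \<Gamma> angular \<Theta>"
    using that by unfold_locales
  have "converges_in_distribution (vague_topology E) M (sample X) P N" if "poisson_process P E \<nu> N"
    using sample_converges_to_poisson[OF M indep copies] that by (simp add: E)
  moreover have "equal_in_distribution (vague_topology E) P N Q (\<lambda>\<omega>. counting_measure E {1..}
      (\<lambda>k. to_ereal_vec ((c powr (1 / \<alpha>) * \<Gamma> k \<omega> powr (- 1 / \<alpha>)) *\<^sub>R \<Theta> k \<omega>)))"
    if N: "poisson_process P E \<nu> N" and mk: "marked_poisson_arrivals Q \<Gamma> angular \<Theta>"
  proof -
    interpret marked_series f \<alpha> a \<nu> M\<^sub>0 X\<^sub>0 Q \<Gamma> \<Theta> by (rule marked[OF mk])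
    show ?thesis
      using poisson_equal_in_distribution_series[OF N[unfolded E]]
      by (simp add: series_def[abs_def] point_def polar_point_def E c)
  qed
  moreover have "converges_in_distribution (product_topology (\<lambda>_. euclidean) {1..m})
      M (\<lambda>n \<omega>. \<lambda>i\<in>{1..m}. (1 / a n) *\<^sub>R X (order_index (\<lambda>j. f (to_ereal_vec (X j \<omega>))) n i) \<omega>)
      Q (\<lambda>\<omega>. \<lambda>i\<in>{1..m}. (c powr (1 / \<alpha>) * \<Gamma> i \<omega> powr (- 1 / \<alpha>)) *\<^sub>R \<Theta> i \<omega>)"
    if mk: "marked_poisson_arrivals Q \<Gamma> angular \<Theta>" and m: "m \<ge> 1" for m
  proof -
    interpret marked_series f \<alpha> a \<nu> M\<^sub>0 X\<^sub>0 Q \<Gamma> \<Theta> by (rule marked[OF mk])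
    show ?thesis
      using order_statistics_converge[OF M indep copies m] unfolding level_def c .
  qed
  moreover have "0 < c" "emeasure \<nu> {x. f x > 1} = ennreal c"
      "emeasure (spectral_measure f \<nu>) (unit_sphere f) = ennreal c"
    using mass_pos emeasure_f_greater_one emeasure_spectral_sphere by (simp_all add: c)
  ultimately show ?thesis unfolding sample angular by blast
qed

end
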